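(* For $0<t<1$ let \[Q(t)=\frac{3t+2\sqrt{(1-t)^3}-2}{t^2}.\] Then for all integers $n\geq 92$, \[f(n)+\frac{1000}{\mu(n-1)^5}<Q(u_n).\]
   Context: $\overline{p}(n)$ denotes the number of overpartitions of $n$ (partitions of $n$ in which the first occurrence of each distinct part may be overlined), and $u_n=\dfrac{\overline{p}(n-1)\overline{p}(n+1)}{\overline{p}(n)^2}$. Let $\mu(m)=\pi\sqrt{m}$. For an integer $n\geq 2$ put $x=\mu(n-1)$, $y=\mu(n)$, $z=\mu(n+1)$, and define \[f(n)=e^{x-2y+z}\,\frac{y^{14}(x^5-x^4-1)(z^5-z^4-1)}{x^7z^7(y^5-y^4+1)^2}.\] *)

theory Defs
  imports Complex_Main "HOL-Library.Multiset"
begin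

definition partitions :: "nat \<Rightarrow> nat multiset set" where
  "partitions n = {P. (\<forall>k\<in>#P. 0 < k) \<and> sum_mset P = n}"

(* an overpartition: a partition P together with the set S of distinct parts
   whose first occurrence is overlined *)
definition overpartitions :: "nat \<Rightarrow> (nat multiset \<times> nat set) set" where
  "overpartitions n = {(P, S). P \<in> partitions n \<and> S \<subseteq> set_mset P}"

definition overpart :: "nat \<Rightarrow> nat" where
  "overpart n = card (overpartitions n)"

definition u_seq :: "nat \<Rightarrow> real" where
  "u_seq n = real (overpart (n - 1)) * real (overpart (n + 1)) / (real (overpart n))^2"

definition mu :: "real \<Rightarrow> real" where
  "mu m = pi * sqrt m"

definition f_fun :: "nat \<Rightarrow> real" where
  "f_fun n = (let x = mu (real n - 1); y = mu (real n); z = mu (real n + 1) in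
     exp (x - 2*y + z) * (y^14 * (x^5 - x^4 - 1) * (z^5 - z^4 - 1))
       / (x^7 * z^7 * (y^5 - y^4 + 1)^2))"

definition Q :: "real \<Rightarrow> real" where
  "Q t = (3*t + 2 * sqrt ((1 - t)^3) - 2) / t^2"

end

theory Submission
  imports Defs "HOL-Complex_Analysis.Complex_Analysis" "HOL-Probability.Distributions" "HOL-Real_Asymp.Real_Asymp"
begin

text \<open>The generating function of the overpartition numbers is the reciprocal of the theta series
  \<open>theta4 q\<close>, the sum of \<open>(-1) ^ j * q ^ j\<^sup>2\<close> over all integers \<open>j\<close>. On the arc \<open>norm s = 1 / (2 * sqrt n)\<close>,
  \<open>\<bar>Arg s\<bar> \<le> pi / 3\<close>, of the half plane with \<open>q = exp (- pi * s)\<close>, the theta transformation turns the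
  coefficient integral into an incomplete Gaussian integral; on the vertical lines that join the arc to
  \<open>Im s = 1\<close> and \<open>Im s = -1\<close> a comparison of the product formula with its value at \<open>norm q\<close> gives an
  exponential saving. So \<open>overpart n\<close> is \<open>exp \<mu> * (1 - 1 / \<mu>) / (8 * n)\<close>, with \<open>\<mu> = mu n\<close>, up to an exponentially
  small relative error. Since \<open>Q u = 1 - (w / (1 + w))\<^sup>2\<close> with \<open>w = sqrt (1 - u)\<close>, the claim is an upper bound
  for \<open>1 - u_seq n\<close> in terms of \<open>1 - f_fun n - 1000 / mu (n - 1) ^ 5\<close>. It follows from the asymptotics for \<open>n \<ge> 500\<close>; below that the values
  of \<open>overpart\<close> are computed from the recurrence that \<open>theta4\<close> provides.\<close>

section \<open>Overpartitions with bounded parts and the finite Gauss identity\<close>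

text \<open>The size of the margin shapes everything. \<open>1 - u_seq n\<close> is about
  \<open>pi / 4\<close> times \<open>n\<close> to the power -3/2, and \<open>Q u\<close> exceeds
  \<open>u\<close> by about twice the power 3/2 of \<open>1 - u\<close>, which is of order -9/4 in
  \<open>n\<close>. What has to be absorbed, the term \<open>1000 / mu (n - 1) ^ 5\<close> and the
  error of the asymptotics, has order -5/2. The advantage is only a fourth root of \<open>n\<close>,
  so all constants are explicit and many small \<open>n\<close> remain. The radius of the arc makes
  \<open>pi / (4 * s)\<close> and \<open>pi * n * s\<close> complex conjugates; their sum is the
  real number \<open>mu n * cos (Arg s)\<close>. In the variable \<open>sin (Arg s / 2)\<close> the
  main integrand becomes a quadratic polynomial times a Gaussian, from which the factor
  \<open>1 - 1 / mu n\<close> drops out without Bessel functions. No contour integral is formed: a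
  primitive that grows by a constant along the period \<open>2 * i\<close> is compared at the
  corners of the path. The link between the product and \<open>theta4\<close> is a finite algebraic
  identity, so that one induction serves real and complex analysis as well as the exact integer
  recurrence.\<close>

definition opart_le :: "nat \<Rightarrow> nat \<Rightarrow> nat" where
  "opart_le m n = (\<Sum>P | P \<in> partitions n \<and> set_mset P \<subseteq> {..m}. 2 ^ card (set_mset P))"

lemma partitions_part_le:
  assumes "P \<in> partitions n" "k \<in># P"
  shows "k \<le> n"
proof -
  from \<open>k \<in># P\<close> obtain P' where "P = add_mset k P'" by (rule mset_add)
  thus ?thesis using assms(1) by (auto simp: partitions_def)
qed

lemma size_le_sum_mset:
  "\<forall>k\<in>#P. 0 < k \<Longrightarrow> size P \<le> sum_mset (P :: nat multiset)"
  by (induction P) auto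

lemma finite_partitions: "finite (partitions n)"
proof (rule finite_subset)
  show "partitions n \<subseteq> mset ` {xs. set xs \<subseteq> {..n} \<and> length xs \<le> n}"
  proof
    fix P assume P: "P \<in> partitions n"
    obtain xs where xs: "mset xs = P" using ex_mset by blast
    have "set xs \<subseteq> {..n}" using partitions_part_le[OF P] xs by auto
    moreover have "length xs \<le> n"
      using size_le_sum_mset[of P] P unfolding partitions_def xs [symmetric] by simp
    ultimately show "P \<in> mset ` {xs. set xs \<subseteq> {..n} \<and> length xs \<le> n}"
      using xs by blast
  qed
  show "finite (mset ` {xs. set xs \<subseteq> {..n} \<and> length xs \<le> n})"
    by (intro finite_imageI finite_lists_length_le) simp
qed

lemma overpart_eq_opart_le:
  assumes "n \<le> m"
  shows "overpart n = opart_le m n"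
proof -
  have "overpartitions n = Sigma (partitions n) (\<lambda>P. Pow (set_mset P))"
    unfolding overpartitions_def by auto
  hence "overpart n = (\<Sum>P\<in>partitions n. card (Pow (set_mset P)))"
    unfolding overpart_def by (simp only:) (rule card_SigmaI, simp_all add: finite_partitions)
  also have "partitions n = {P. P \<in> partitions n \<and> set_mset P \<subseteq> {..m}}"
    using partitions_part_le le_trans[OF _ assms] by blast
  finally show ?thesis by (simp add: opart_le_def card_Pow)
qed

lemma opart_le_0: "opart_le 0 n = (if n = 0 then 1 else 0)"
proof -
  have empty: "P = {#}" if "P \<in> partitions n" "set_mset P \<subseteq> {..0}" for P n
  proof (rule ccontr)
    assume "P \<noteq> {#}"
    then obtain k where "k \<in># P" by blast
    thus False using that by (auto simp: partitions_def)
  qed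
  have "{P. P \<in> partitions n \<and> set_mset P \<subseteq> {..0}} = (if n = 0 then {{#}} else {})"
  proof (cases "n = 0")
    case True
    have "{#} \<in> partitions n" using True by (simp add: partitions_def)
    thus ?thesis using True empty by auto
  next
    case False
    have "{#} \<notin> partitions n" using False by (simp add: partitions_def)
    thus ?thesis using False empty by auto
  qed
  thus ?thesis by (simp add: opart_le_def)
qed

text \<open>Removing one copy of \<open>Suc m\<close> from a partition that contains it leaves a
  partition \<open>P\<close> of \<open>n - Suc m\<close>. Putting it back doubles the weight exactly
  if \<open>P\<close> does not contain \<open>Suc m\<close>: hence one sum over all such
  \<open>P\<close> and a second one over those with parts at most \<open>m\<close>. In terms of
  generating functions this is multiplication by \<open>(1 + q ^ k) / (1 - q ^ k)\<close> for
  \<open>k = Suc m\<close>.\<close>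

lemma opart_le_Suc:
  "opart_le (Suc m) n = opart_le m n +
     (if n \<ge> Suc m then opart_le m (n - Suc m) + opart_le (Suc m) (n - Suc m) else 0)"
proof -
  define A where "A = {P. P \<in> partitions n \<and> set_mset P \<subseteq> {..Suc m}}"
  have fin: "finite {P. P \<in> partitions k \<and> R P}" for k R
    using finite_partitions by simp
  have A0: "{P \<in> A. Suc m \<notin># P} = {P. P \<in> partitions n \<and> set_mset P \<subseteq> {..m}}"
    by (auto simp: A_def le_Suc_eq)
  have "opart_le (Suc m) n = (\<Sum>P\<in>{P \<in> A. Suc m \<notin># P} \<union> {P \<in> A. Suc m \<in># P}. 2 ^ card (set_mset P))"
    unfolding opart_le_def A_def by (rule sum.cong) auto
  also have "\<dots> = (\<Sum>P\<in>{P \<in> A. Suc m \<notin># P}. 2 ^ card (set_mset P)) + (\<Sum>P\<in>{P \<in> A. Suc m \<in># P}. 2 ^ card (set_mset P))"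
    by (rule sum.union_disjoint) (auto simp: A_def fin)
  also have "(\<Sum>P\<in>{P \<in> A. Suc m \<notin># P}. 2 ^ card (set_mset P)) = opart_le m n"
    unfolding A0 opart_le_def by simp
  also have "(\<Sum>P\<in>{P \<in> A. Suc m \<in># P}. 2 ^ card (set_mset P)) =
     (if n \<ge> Suc m then opart_le m (n - Suc m) + opart_le (Suc m) (n - Suc m) else 0)"
  proof (cases "n \<ge> Suc m")
    case False
    have empty: "{P \<in> A. Suc m \<in># P} = {}"
      using False partitions_part_le by (auto simp: A_def)
    show ?thesis unfolding empty using False by simp
  next
    case True
    define k where "k = n - Suc m"
    define B where "B = {P. P \<in> partitions k \<and> set_mset P \<subseteq> {..Suc m}}"
    have finB: "finite B" by (simp add: B_def fin)
    have "(\<Sum>P\<in>{P \<in> A. Suc m \<in># P}. 2 ^ card (set_mset P)) =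
          (\<Sum>P\<in>B. (2 ^ card (set_mset (add_mset (Suc m) P)) :: nat))"
    proof (rule sum.reindex_bij_witness[of _ "add_mset (Suc m)" "\<lambda>P. P - {#Suc m#}"])
      fix P assume P: "P \<in> {P \<in> A. Suc m \<in># P}"
      then obtain P' where P': "P = add_mset (Suc m) P'" by (auto elim: mset_add)
      show "P - {#Suc m#} \<in> B"
        using P unfolding P' by (auto simp: A_def B_def partitions_def k_def)
    qed (use True in \<open>auto simp: A_def B_def partitions_def k_def\<close>)
    also have "\<dots> = (\<Sum>P\<in>B. 2 ^ card (set_mset P) + (if Suc m \<in># P then 0 else 2 ^ card (set_mset P)))"
      by (rule sum.cong) (auto simp: insert_absorb)
    also have "\<dots> = opart_le (Suc m) k + (\<Sum>P\<in>B. if Suc m \<in># P then 0 else 2 ^ card (set_mset P))"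
      by (simp add: sum.distrib opart_le_def B_def)
    also have "(\<Sum>P\<in>B. if Suc m \<in># P then 0 else 2 ^ card (set_mset P)) =
       (\<Sum>P\<in>{P\<in>B. Suc m \<notin># P}. (2 ^ card (set_mset P) :: nat))"
      using finB by (subst sum.inter_filter) (auto intro!: sum.cong)
    also have "{P\<in>B. Suc m \<notin># P} = {P. P \<in> partitions k \<and> set_mset P \<subseteq> {..m}}"
      by (auto simp: B_def le_Suc_eq)
    finally show ?thesis using True by (simp add: k_def opart_le_def)
  qed
  finally show ?thesis .
qed

lemma opart_le_mono: "opart_le m n \<le> opart_le (Suc m) n"
  using opart_le_Suc[of m n] by linarith

text \<open>The finite form of Gauss's identity goes back to Shanks; \<open>c k\<close> plays the role of
  \<open>1 / (1 + q ^ k)\<close>, so that the identity is available for formal power series as well.\<close>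
lemma finite_gauss_identity:
  fixes q :: "'a :: comm_ring_1" and c :: "nat \<Rightarrow> 'a"
  assumes c: "\<And>k. (1 + q ^ k) * c k = 1"
  shows "1 + 2 * (\<Sum>j=1..n. (-1) ^ j * q ^ j\<^sup>2) =
    (\<Sum>j=0..n. (-1) ^ j * 2 * c j * q ^ (j * (n + 1)) * (\<Prod>k=Suc j..n. (1 - q ^ k) * c k))"
proof (induction n)
  case 0
  have "2 * c 0 = 1" using c[of 0] by simp
  thus ?case by simp
next
  case (Suc n)
  define r where "r k = (1 - q ^ k) * c k" for k
  define \<rho> where "\<rho> n j = (\<Prod>k=Suc j..n. r k)" for n j
  \<comment> \<open>The induction step is a telescoping argument: by \<open>key\<close>, the
    \<open>j\<close>-th summand changes from \<open>n\<close> to \<open>Suc n\<close> by a multiple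
    of \<open>E j - E' j\<close>, where \<open>E'\<close> is \<open>E\<close> shifted by one with
    initial value 0. The sum over \<open>j\<close> then collapses to \<open>E n\<close>, which
    together with the new summand \<open>j = Suc n\<close> yields the next theta term.\<close>
  define E where "E j = (-1) ^ j * q ^ (Suc j * Suc n) * \<rho> n j" for j
  define E' where "E' j = (case j of 0 \<Rightarrow> 0 | Suc i \<Rightarrow> E i)" for j
  define N where "N = Suc n"
  have \<rho>1: "\<rho> (Suc n) j = \<rho> n j * r (Suc n)" if "j \<le> n" for j
    using that by (simp add: \<rho>_def)
  have key: "(-1) ^ j * 2 * c j * q ^ (j * (Suc n + 1)) * \<rho> (Suc n) j
      - (-1) ^ j * 2 * c j * q ^ (j * (n + 1)) * \<rho> n j = - 2 * c N * (E j - E' j)" if j: "j \<le> n" for j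
  proof -
    have e1: "q ^ (j * (Suc n + 1)) = q ^ (j * N) * q ^ j"
      by (simp add: N_def power_add [symmetric] algebra_simps)
    have e2: "q ^ (Suc j * Suc n) = q ^ (j * N) * q ^ N"
      by (simp add: N_def power_add [symmetric] algebra_simps)
    have cN: "(1 + q ^ N) * c N = 1" and cj: "(1 + q ^ j) * c j = 1" by (rule c)+
    have E': "- E' j = (-1) ^ j * q ^ (j * N) * r j * \<rho> n j"
    proof (cases j)
      case 0
      thus ?thesis by (simp add: E'_def r_def)
    next
      case (Suc i)
      have "\<rho> n i = r j * \<rho> n j"
        using j Suc unfolding \<rho>_def by (simp add: prod.atLeast_Suc_atMost)
      thus ?thesis by (simp add: E'_def Suc E_def N_def)
    qed
    have "2 * c j * (q ^ j * r N - 1) = - 2 * c N * (q ^ N + r j)"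
    proof -
      have "2 * c j * (q ^ j * r N - 1) = 2 * c j * (q ^ j * r N - (1 + q ^ N) * c N)"
        using cN by simp
      also have "\<dots> = - 2 * c N * (r j + q ^ N * ((1 + q ^ j) * c j))"
        unfolding r_def by (simp add: algebra_simps)
      finally show ?thesis unfolding cj by (simp add: algebra_simps)
    qed
    hence "(-1) ^ j * q ^ (j * N) * \<rho> n j * (2 * c j * (q ^ j * r N - 1)) =
           (-1) ^ j * q ^ (j * N) * \<rho> n j * (- 2 * c N * (q ^ N + r j))"
      by simp
    moreover have "- 2 * c N * (E j - E' j) = (-1) ^ j * q ^ (j * N) * \<rho> n j * (- 2 * c N * (q ^ N + r j))"
    proof -
      have "- 2 * c N * (E j - E' j) = - 2 * c N * (E j + (- E' j))" by simp
      also have "\<dots> = (-1) ^ j * q ^ (j * N) * \<rho> n j * (- 2 * c N * (q ^ N + r j))"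
        unfolding E' unfolding E_def e2 by (simp add: algebra_simps)
      finally show ?thesis .
    qed
    moreover have "(-1) ^ j * 2 * c j * q ^ (j * (Suc n + 1)) * \<rho> (Suc n) j
      - (-1) ^ j * 2 * c j * q ^ (j * (n + 1)) * \<rho> n j
      = (-1) ^ j * q ^ (j * N) * \<rho> n j * (2 * c j * (q ^ j * r N - 1))"
      unfolding e1 \<rho>1[OF j] by (simp add: N_def algebra_simps)
    ultimately show ?thesis by simp
  qed
  have tel: "(\<Sum>j=0..m. E j - E' j) = E m" for m
    by (induction m) (auto simp: E'_def)
  have sq: "q ^ (Suc n * Suc n) = q ^ (Suc n)\<^sup>2"
    by (simp only: power2_eq_square)
  have cN: "(1 + q ^ N) * c N = 1" by (rule c)
  have "(\<Sum>j=0..Suc n. (-1) ^ j * 2 * c j * q ^ (j * (Suc n + 1)) * \<rho> (Suc n) j)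
      - (\<Sum>j=0..n. (-1) ^ j * 2 * c j * q ^ (j * (n + 1)) * \<rho> n j)
      = (\<Sum>j=0..n. (-1) ^ j * 2 * c j * q ^ (j * (Suc n + 1)) * \<rho> (Suc n) j
           - (-1) ^ j * 2 * c j * q ^ (j * (n + 1)) * \<rho> n j)
        + (-1) ^ N * 2 * c N * q ^ (N * (N + 1)) * \<rho> N N"
    by (simp add: sum_subtractf N_def)
  also have "(\<Sum>j=0..n. (-1) ^ j * 2 * c j * q ^ (j * (Suc n + 1)) * \<rho> (Suc n) j
           - (-1) ^ j * 2 * c j * q ^ (j * (n + 1)) * \<rho> n j) = (\<Sum>j=0..n. - 2 * c N * (E j - E' j))"
    by (rule sum.cong) (use key in auto)
  also have "\<dots> = - 2 * c N * E n"
    by (simp only: sum_distrib_left [symmetric] tel)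
  also have "\<rho> N N = 1" by (simp add: \<rho>_def)
  also have "E n = - ((-1) ^ N * q ^ N\<^sup>2)"
    unfolding E_def sq by (simp add: \<rho>_def N_def)
  also have "q ^ (N * (N + 1)) = q ^ N\<^sup>2 * q ^ N"
    by (simp add: power_add power2_eq_square)
  also have "- 2 * c N * - ((- 1) ^ N * q ^ N\<^sup>2) + (- 1) ^ N * 2 * c N * (q ^ N\<^sup>2 * q ^ N) * 1
      = 2 * ((-1) ^ N * q ^ N\<^sup>2) * ((1 + q ^ N) * c N)"
    by (simp add: algebra_simps)
  also have "\<dots> = 2 * ((-1) ^ N * q ^ N\<^sup>2)" by (simp add: cN)
  finally have "(\<Sum>j=0..Suc n. (-1) ^ j * 2 * c j * q ^ (j * (Suc n + 1)) * \<rho> (Suc n) j)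
      = (\<Sum>j=0..n. (-1) ^ j * 2 * c j * q ^ (j * (n + 1)) * \<rho> n j) + 2 * ((-1) ^ N * q ^ N\<^sup>2)"
    by (simp add: algebra_simps)
  moreover have "1 + 2 * (\<Sum>j=1..Suc n. (-1) ^ j * q ^ j\<^sup>2) =
      1 + 2 * (\<Sum>j=1..n. (-1) ^ j * q ^ j\<^sup>2) + 2 * ((-1) ^ N * q ^ N\<^sup>2)"
    by (simp add: N_def distrib_left)
  ultimately show ?case using Suc unfolding \<rho>_def r_def by (simp only:)
qed

section \<open>The theta transformation\<close>

text \<open>The bilateral series with the terms for \<open>j\<close> and \<open>-j\<close> combined.
  It is needed for real and complex arguments, hence the general type.\<close>

definition theta4 :: "'a :: {real_normed_field, banach} \<Rightarrow> 'a" where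
  "theta4 q = 1 + 2 * (\<Sum>j. (-1) ^ Suc j * q ^ (Suc j)\<^sup>2)"

section \<open>From binomial coefficients to the theta transformation on the real line\<close>

lemma cos_le_exp:
  fixes x :: real
  assumes "0 \<le> x" "x \<le> pi / 2"
  shows "cos x \<le> exp (- x\<^sup>2 / 2)"
proof -
  have sc: "y * cos y \<le> sin y" if y: "0 \<le> y" "y \<le> pi / 2" for y :: real
  proof -
    have "(\<lambda>y. sin y - y * cos y) 0 \<le> (\<lambda>y. sin y - y * cos y) y"
    proof (rule DERIV_nonneg_imp_nondecreasing[where f = "\<lambda>y. sin y - y * cos y"])
      fix z :: real assume z: "0 \<le> z" "z \<le> y"
      have "((\<lambda>y. sin y - y * cos y) has_real_derivative z * sin z) (at z)"
        by (auto intro!: derivative_eq_intros)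
      moreover have "z * sin z \<ge> 0" using z y by (intro mult_nonneg_nonneg sin_ge_zero) auto
      ultimately show "\<exists>d. ((\<lambda>y. sin y - y * cos y) has_real_derivative d) (at z) \<and> 0 \<le> d" by blast
    qed (use y in auto)
    thus ?thesis by simp
  qed
  have "(\<lambda>y. exp (y\<^sup>2 / 2) * cos y) x \<le> (\<lambda>y. exp (y\<^sup>2 / 2) * cos y) 0"
  proof (rule DERIV_nonpos_imp_nonincreasing[where f = "\<lambda>y. exp (y\<^sup>2 / 2) * cos y"])
    fix y :: real assume y: "0 \<le> y" "y \<le> x"
    have "((\<lambda>y. exp (y\<^sup>2 / 2) * cos y) has_real_derivative exp (y\<^sup>2 / 2) * (y * cos y - sin y)) (at y)"
      by (auto intro!: derivative_eq_intros simp: algebra_simps)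
    moreover have "exp (y\<^sup>2 / 2) * (y * cos y - sin y) \<le> 0"
      using sc[of y] y assms by (intro mult_nonneg_nonpos) auto
    ultimately show "\<exists>d. ((\<lambda>y. exp (y\<^sup>2 / 2) * cos y) has_real_derivative d) (at y) \<and> d \<le> 0" by blast
  qed (use assms in auto)
  thus ?thesis by (simp add: exp_minus field_simps)
qed

text \<open>Wallis's product in another form: its partial products \<open>W n\<close> are the
  squares of \<open>4 ^ n / ((2 * n) choose n)\<close> divided by \<open>2 * n + 1\<close>.\<close>

lemma central_binomial_limit:
  "(\<lambda>n. 4 ^ n / (real ((2 * n) choose n) * sqrt (real n))) \<longlonglongrightarrow> sqrt pi"
proof -
  define W where "W n = (\<Prod>k=1..n. (4 * real k ^ 2) / (4 * real k ^ 2 - 1))" for n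
  have W: "W n = (4 ^ n / real ((2 * n) choose n))\<^sup>2 / (2 * real n + 1)" for n
  proof (induction n)
    case (Suc n)
    have rec: "real ((2 * Suc n) choose Suc n) * (real n + 1) = 2 * (2 * real n + 1) * real ((2 * n) choose n)"
    proof -
      have c: "real ((2 * k) choose k) = fact (2 * k) / (fact k * fact k)" for k
        using binomial_fact[of k "2 * k", where ?'a = real] by simp
      define F G a b where "F = (fact n :: real)" and "G = (fact (2 * n) :: real)"
        and "a = real n + 1" and "b = 2 * real n + 1"
      have F: "F > 0" "a > 0" by (simp_all add: F_def a_def)
      have f2: "fact (2 * Suc n) = 2 * a * b * G"
        by (simp add: a_def b_def G_def algebra_simps)
      have f1: "fact (Suc n) = a * F" by (simp add: F_def a_def algebra_simps)
      have "2 * a * b * G / (a * F * (a * F)) * a = 2 * b * (G / (F * F))"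
        using F by (simp add: field_simps)
      thus ?thesis unfolding c f2 f1 unfolding F_def G_def a_def b_def .
    qed
    define B where "B = real ((2 * n) choose n)"
    define B' where "B' = real ((2 * Suc n) choose Suc n)"
    have B: "B > 0" unfolding B_def by simp
    have B': "B' = 2 * (2 * real n + 1) * B / (real n + 1)"
      using rec unfolding B_def B'_def by (simp add: field_simps)
    have "W (Suc n) = (4 ^ n / B)\<^sup>2 / (2 * real n + 1) * ((4 * (real n + 1)\<^sup>2) / (4 * (real n + 1)\<^sup>2 - 1))"
      using Suc unfolding W_def B_def by (simp add: add.commute)
    also have "4 * (real n + 1)\<^sup>2 - 1 = (2 * real n + 1) * (2 * real n + 3)"
      by (simp add: power2_eq_square algebra_simps)
    also have "(4 ^ n / B)\<^sup>2 / (2 * real n + 1) * ((4 * (real n + 1)\<^sup>2) / ((2 * real n + 1) * (2 * real n + 3)))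
        = (4 ^ Suc n / B')\<^sup>2 / (2 * real (Suc n) + 1)"
      using B unfolding B' by (simp add: divide_simps power2_eq_square) (simp add: algebra_simps)
    finally show ?case unfolding B'_def .
  qed (simp add: W_def)
  have "W \<longlonglongrightarrow> pi / 2" unfolding W_def by (rule wallis)
  moreover have "(\<lambda>n. (2 * real n + 1) / real n) \<longlonglongrightarrow> 2" by real_asymp
  ultimately have "(\<lambda>n. sqrt (W n * ((2 * real n + 1) / real n))) \<longlonglongrightarrow> sqrt (pi / 2 * 2)"
    by (intro tendsto_intros)
  also have "(\<lambda>n. sqrt (W n * ((2 * real n + 1) / real n))) = (\<lambda>n. 4 ^ n / (real ((2 * n) choose n) * sqrt (real n)))"
  proof
    fix n
    have "2 * real n + 1 > 0" by simp
    hence "W n * ((2 * real n + 1) / real n) = (4 ^ n / real ((2 * n) choose n))\<^sup>2 / real n"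
      unfolding W by simp
    thus "sqrt (W n * ((2 * real n + 1) / real n)) = 4 ^ n / (real ((2 * n) choose n) * sqrt (real n))"
      by (simp only: real_sqrt_divide) (simp add: real_sqrt_divide)
  qed
  finally show ?thesis by simp
qed

text \<open>A discrete Gaussian: for \<open>a\<close> of the order of \<open>sqrt m\<close> the
  value is close to \<open>exp (- a\<^sup>2 / m)\<close>.\<close>

definition binom_ratio :: "nat \<Rightarrow> nat \<Rightarrow> real" where
  "binom_ratio m a = real ((2 * m) choose (m + a)) / real ((2 * m) choose m)"

lemma binom_ratio_prod:
  "binom_ratio m a = (\<Prod>i<a. (real m - real i) / (real m + real i + 1))"
proof (induction a)
  case (Suc a)
  have "Suc (m + a) * ((2 * m) choose Suc (m + a)) = (2 * m - (m + a)) * ((2 * m) choose (m + a))"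
    by (simp only: binomial_absorption binomial_absorb_comp)
  hence "real (Suc (m + a)) * real ((2 * m) choose Suc (m + a)) = real (2 * m - (m + a)) * real ((2 * m) choose (m + a))"
    by (simp only: of_nat_mult [symmetric])
  moreover have "real (2 * m - (m + a)) * real ((2 * m) choose (m + a)) = (real m - real a) * real ((2 * m) choose (m + a))"
    by (cases "a \<le> m") (auto simp: of_nat_diff)
  ultimately have "real ((2 * m) choose Suc (m + a)) = real ((2 * m) choose (m + a)) * ((real m - real a) / (real m + real a + 1))"
    by (simp add: field_simps)
  hence "binom_ratio m (Suc a) = binom_ratio m a * ((real m - real a) / (real m + real a + 1))"
    by (simp add: binom_ratio_def)
  thus ?case using Suc by simp
qed (simp add: binom_ratio_def)

lemma sum_odd_squares: "(\<Sum>i<a. 2 * real i + 1) = (real a)\<^sup>2"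
  by (induction a) (auto simp: power2_eq_square algebra_simps)

text \<open>Each factor of the product is \<open>1 - (2 * i + 1) / (m + i + 1)\<close>, at most an
  exponential; the odd numbers \<open>2 * i + 1\<close> add up to the square of \<open>a\<close>
  once the denominators have been enlarged to \<open>m + a\<close>.\<close>

lemma binom_ratio_upper:
  assumes "a \<le> m"
  shows "binom_ratio m a \<le> exp (- (real a)\<^sup>2 / (real m + real a))"
proof -
  have "binom_ratio m a \<le> (\<Prod>i<a. exp (- (2 * real i + 1) / (real m + real a)))"
    unfolding binom_ratio_prod
  proof (rule prod_mono, safe)
    fix i assume i: "i < a"
    show "0 \<le> (real m - real i) / (real m + real i + 1)" using i assms by simp
    have "(real m - real i) / (real m + real i + 1) = 1 + (- (2 * real i + 1) / (real m + real i + 1))"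
      by (simp add: divide_simps)
    also have "\<dots> \<le> exp (- (2 * real i + 1) / (real m + real i + 1))" by (rule exp_ge_add_one_self)
    also have "\<dots> \<le> exp (- (2 * real i + 1) / (real m + real a))"
      using i unfolding minus_divide_left [symmetric] exp_le_cancel_iff neg_le_iff_le
      by (intro divide_left_mono mult_pos_pos) auto
    finally show "(real m - real i) / (real m + real i + 1) \<le> exp (- (2 * real i + 1) / (real m + real a))" .
  qed
  also have "\<dots> = exp (- (real a)\<^sup>2 / (real m + real a))"
    by (simp add: exp_sum [symmetric] sum_odd_squares [symmetric] sum_divide_distrib [symmetric] sum_negf [symmetric])
  finally show ?thesis .
qed

text \<open>The same with reciprocals: the factor is the inverse of
  \<open>1 + (2 * i + 1) / (m - i)\<close>, which is at most an exponential, and the denominators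
  shrink to \<open>m - a\<close>. If \<open>a\<close> is proportional to \<open>sqrt m\<close>, both
  bounds have the same limit.\<close>

lemma binom_ratio_lower:
  assumes "a < m"
  shows "exp (- (real a)\<^sup>2 / (real m - real a)) \<le> binom_ratio m a"
proof -
  have "exp (- (real a)\<^sup>2 / (real m - real a)) = (\<Prod>i<a. exp (- (2 * real i + 1) / (real m - real a)))"
    by (simp add: exp_sum [symmetric] sum_odd_squares [symmetric] sum_divide_distrib [symmetric] sum_negf [symmetric])
  also have "\<dots> \<le> binom_ratio m a"
    unfolding binom_ratio_prod
  proof (rule prod_mono, safe)
    fix i assume i: "i < a"
    have "- (2 * real i + 1) / (real m - real a) \<le> - (2 * real i + 1) / (real m - real i)"
      using i assms unfolding minus_divide_left [symmetric] neg_le_iff_le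
      by (intro divide_left_mono mult_pos_pos) auto
    hence "exp (- (2 * real i + 1) / (real m - real a)) \<le> exp (- (2 * real i + 1) / (real m - real i))"
      by simp
    also have "\<dots> = 1 / exp ((2 * real i + 1) / (real m - real i))"
      by (simp only: minus_divide_left [symmetric] exp_minus inverse_eq_divide)
    also have "\<dots> \<le> 1 / (1 + (2 * real i + 1) / (real m - real i))"
      using i assms by (intro divide_left_mono exp_ge_add_one_self mult_pos_pos) (auto intro!: add_pos_nonneg)
    also have "\<dots> = (real m - real i) / (real m + real i + 1)"
      using i assms by (simp add: field_simps)
    finally show "exp (- (2 * real i + 1) / (real m - real a)) \<le> (real m - real i) / (real m + real i + 1)" .
  qed simp
  finally show ?thesis .
qed

text \<open>Binomial theorem for the power of \<open>cis x + cis (- x)\<close>, indexed by the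
  distance \<open>d\<close> from the central term; the terms at \<open>m - d\<close> and
  \<open>m + d\<close> agree.\<close>

lemma cos_power_expansion:
  "(2 * cos x) ^ (2 * m) = real ((2 * m) choose m) + 2 * (\<Sum>d=1..m. real ((2 * m) choose (m + d)) * cos (2 * real d * x))"
proof -
  define h where "h a = real ((2 * m) choose a) * cos ((2 * real a - 2 * real m) * x)" for a
  have "of_real ((2 * cos x) ^ (2 * m)) = (cis x + cis (- x)) ^ (2 * m)"
  proof -
    have "cis x + cis (- x) = of_real (2 * cos x)" by (simp add: complex_eq_iff)
    thus ?thesis by (simp only: of_real_power)
  qed
  also have "\<dots> = (\<Sum>a\<le>2 * m. of_nat ((2 * m) choose a) * cis x ^ a * cis (- x) ^ (2 * m - a))"
    by (rule binomial_ring)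
  also have "\<dots> = (\<Sum>a\<le>2 * m. of_real (real ((2 * m) choose a)) * cis ((2 * real a - 2 * real m) * x))"
  proof (rule sum.cong)
    fix a assume "a \<in> {..2 * m}"
    hence "real a * x + real (2 * m - a) * (- x) = (2 * real a - 2 * real m) * x"
      by (simp add: of_nat_diff algebra_simps)
    thus "of_nat ((2 * m) choose a) * cis x ^ a * cis (- x) ^ (2 * m - a) =
        of_real (real ((2 * m) choose a)) * cis ((2 * real a - 2 * real m) * x)"
      unfolding Complex.DeMoivre mult.assoc cis_mult by (simp only: of_real_of_nat_eq)
  qed simp
  finally have "Re (of_real ((2 * cos x) ^ (2 * m))) =
      Re (\<Sum>a\<le>2 * m. of_real (real ((2 * m) choose a)) * cis ((2 * real a - 2 * real m) * x))"
    by (rule arg_cong)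
  moreover have "Re (of_real c * cis t) = c * cos t" for c t by simp
  ultimately have "(2 * cos x) ^ (2 * m) = (\<Sum>a\<le>2 * m. h a)"
    unfolding h_def Re_sum Re_complex_of_real by (simp only:)
  also have "\<dots> = sum h {..<m} + h m + sum h {m<..2 * m}"
  proof -
    have "sum h {..2 * m} = sum h ({..<m} \<union> {m..2 * m})"
      by (rule arg_cong[of _ _ "sum h"]) auto
    also have "\<dots> = sum h {..<m} + sum h {m..2 * m}"
      by (rule sum.union_disjoint) auto
    also have "sum h {m..2 * m} = h m + sum h {m<..2 * m}"
      by (rule sum.head) simp
    finally show ?thesis by simp
  qed
  also have "sum h {m<..2 * m} = (\<Sum>d=1..m. h (m + d))"
    by (rule sum.reindex_bij_witness[of _ "\<lambda>d. m + d" "\<lambda>a. a - m"]) auto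
  also have "sum h {..<m} = (\<Sum>d=1..m. h (m - d))"
    by (rule sum.reindex_bij_witness[of _ "\<lambda>d. m - d" "\<lambda>a. m - a"]) auto
  also have "\<dots> = (\<Sum>d=1..m. h (m + d))"
  proof (rule sum.cong)
    fix d assume d: "d \<in> {1..m}"
    have "((2 * m) choose (m - d)) = ((2 * m) choose (m + d))"
      using d by (subst binomial_symmetric) (auto simp: algebra_simps)
    moreover have "cos ((2 * real (m - d) - 2 * real m) * x) = cos ((2 * real (m + d) - 2 * real m) * x)"
    proof -
      have "(2 * real (m - d) - 2 * real m) * x = - ((2 * real (m + d) - 2 * real m) * x)"
        using d by (simp add: of_nat_diff algebra_simps)
      thus ?thesis by (simp only: cos_minus)
    qed
    ultimately show "h (m - d) = h (m + d)" by (simp only: h_def)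
  qed simp
  finally show ?thesis by (simp add: h_def sum_distrib_left)
qed

text \<open>Because the nodes are odd multiples of \<open>pi / (2 * l)\<close>, the surviving
  frequencies carry alternating signs, which become the signs of \<open>theta4\<close>. The other
  frequencies cancel: after multiplication by \<open>2 * sin t\<close> the sum telescopes to
  \<open>sin (2 * l * t) = 0\<close>, and \<open>sin t\<close> is nonzero since \<open>l\<close>
  does not divide \<open>d\<close>.\<close>

lemma sum_cos_odd_multiples:
  fixes l d :: nat
  assumes "l > 0"
  shows "(\<Sum>k<l. cos (2 * real d * (pi * (2 * real k + 1) / (2 * real l)))) =
           (if l dvd d then real l * (-1) ^ (d div l) else 0)"
proof -
  define t where "t = real d * pi / real l"
  have arg: "2 * real d * (pi * (2 * real k + 1) / (2 * real l)) = (2 * real k + 1) * t" for k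
    using assms by (simp add: t_def field_simps)
  show ?thesis
  proof (cases "l dvd d")
    case True
    then obtain e where e: "d = l * e" by auto
    have t: "t = real e * pi" using assms by (simp add: t_def e)
    have "cos ((2 * real k + 1) * t) = (-1) ^ e" for k :: nat
    proof -
      have "(2 * real k + 1) * t = real ((2 * k + 1) * e) * pi"
        by (simp add: t algebra_simps)
      thus ?thesis by (simp only: cos_npi) (simp add: power_mult power_add)
    qed
    thus ?thesis using assms unfolding arg by (simp add: e)
  next
    case False
    have tel: "2 * sin t * (\<Sum>k<n. cos ((2 * real k + 1) * t)) = sin (2 * real n * t)" for n
    proof (induction n)
      case (Suc n)
      have "2 * sin t * cos ((2 * real n + 1) * t) = sin (2 * real (Suc n) * t) - sin (2 * real n * t)"
      proof -
        have "2 * real (Suc n) * t = (2 * real n + 1) * t + t" "2 * real n * t = (2 * real n + 1) * t - t"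
          by (simp_all add: algebra_simps)
        thus ?thesis by (simp only: sin_add sin_diff) simp
      qed
      thus ?case using Suc by (simp add: distrib_left)
    qed simp
    have "sin (2 * real l * t) = 0"
      using sin_npi[of "2 * d"] assms by (simp add: t_def field_simps)
    moreover have "sin t \<noteq> 0"
    proof
      assume "sin t = 0"
      then obtain i :: int where "t = of_int i * pi" by (auto simp: sin_zero_iff_int2)
      hence "real d = of_int i * real l" using assms by (simp add: t_def field_simps)
      hence "int d = i * int l" by (metis of_int_eq_iff of_int_mult of_int_of_nat_eq)
      thus False using False by (metis dvd_triv_right int_dvd_int_iff)
    qed
    ultimately show ?thesis using tel[of l] False unfolding arg by simp
  qed
qed

text \<open>A finite theta transformation. Summing \<open>cos_power_expansion\<close> over the nodes
  keeps only the binomial coefficients at distances \<open>d = j * l\<close>. When \<open>m\<close>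
  and \<open>l\<close> grow with \<open>l\<^sup>2 / m\<close> fixed, the left side turns into
  \<open>theta4\<close> and the right side into the dual series.\<close>

lemma binomial_cos_sum:
  fixes l m :: nat
  assumes "l > 0"
  shows "1 + 2 * (\<Sum>j=1..m. (-1) ^ j * binom_ratio m (j * l)) =
     4 ^ m / (real ((2 * m) choose m) * real l) * (\<Sum>k<l. cos (pi * (2 * real k + 1) / (2 * real l)) ^ (2 * m))"
proof -
  define B where "B = real ((2 * m) choose m)"
  have B: "B > 0" by (simp add: B_def)
  define y where "y k = pi * (2 * real k + 1) / (2 * real l)" for k
  have "4 ^ m * (\<Sum>k<l. cos (y k) ^ (2 * m)) = (\<Sum>k<l. (2 * cos (y k)) ^ (2 * m))"
    by (simp add: sum_distrib_left power_mult_distrib power_mult)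
  also have "\<dots> = (\<Sum>k<l. B + 2 * (\<Sum>d=1..m. real ((2 * m) choose (m + d)) * cos (2 * real d * y k)))"
    by (simp only: cos_power_expansion B_def)
  also have "\<dots> = real l * B + 2 * (\<Sum>d=1..m. real ((2 * m) choose (m + d)) * (\<Sum>k<l. cos (2 * real d * y k)))"
    unfolding sum.distrib sum_distrib_left [symmetric] by (subst sum.swap) (simp add: sum_distrib_left)
  also have "(\<Sum>d=1..m. real ((2 * m) choose (m + d)) * (\<Sum>k<l. cos (2 * real d * y k)))
      = (\<Sum>d=1..m. if l dvd d then real l * (real ((2 * m) choose (m + d)) * (-1) ^ (d div l)) else 0)"
    unfolding y_def sum_cos_odd_multiples[OF assms] by (rule sum.cong) auto
  also have "\<dots> = (\<Sum>d\<in>{d\<in>{1..m}. l dvd d}. real l * (real ((2 * m) choose (m + d)) * (-1) ^ (d div l)))"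
    by (rule sum.inter_filter [symmetric]) simp
  also have "\<dots> = (\<Sum>j\<in>{j\<in>{1..m}. j * l \<le> m}. real l * (real ((2 * m) choose (m + j * l)) * (-1) ^ j))"
  proof (rule sum.reindex_bij_witness[of _ "\<lambda>j. j * l" "\<lambda>d. d div l"])
    fix d assume d: "d \<in> {d\<in>{1..m}. l dvd d}"
    then obtain e where e: "d = l * e" by auto
    have "e \<ge> 1" using d e by (cases e) auto
    moreover have "e \<le> m"
      using assms d unfolding e by (auto intro: order.trans[of e "l * e"])
    ultimately show "d div l \<in> {j\<in>{1..m}. j * l \<le> m}"
      using d assms unfolding e by (simp add: mult.commute del: mult_le_cancel1)
  qed (use assms in auto)
  also have "\<dots> = (\<Sum>j=1..m. real l * (real ((2 * m) choose (m + j * l)) * (-1) ^ j))"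
    by (rule sum.mono_neutral_left) auto
  also have "\<dots> = (\<Sum>j=1..m. real l * B * ((-1) ^ j * binom_ratio m (j * l)))"
    using B by (intro sum.cong) (auto simp: binom_ratio_def B_def)
  also have "real l * B + 2 * \<dots> = real l * B * (1 + 2 * (\<Sum>j=1..m. (-1) ^ j * binom_ratio m (j * l)))"
    by (simp only: sum_distrib_left [symmetric]) (simp add: algebra_simps)
  finally show ?thesis using B assms unfolding B_def [symmetric] y_def [symmetric] by (simp add: field_simps)
qed

lemma binom_ratio_le_one: "binom_ratio m a \<le> 1"
proof (cases "a \<le> m")
  case True
  have "exp (- (real a)\<^sup>2 / (real m + real a)) \<le> 1" by simp
  thus ?thesis using binom_ratio_upper[OF True] by linarith
qed (simp add: binom_ratio_def binomial_eq_0)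

text \<open>Weaker than \<open>binom_ratio_upper\<close> but valid for all \<open>a\<close>, with an
  exponent quadratic in \<open>a\<close>; this supplies the dominating sequence for Tannery's
  theorem.\<close>

lemma binom_ratio_upper':
  "binom_ratio m a \<le> exp (- (real a)\<^sup>2 / (2 * real m))"
proof (cases "a \<le> m")
  case True
  show ?thesis
  proof (cases "m = 0")
    case False
    have "(real a)\<^sup>2 / (2 * real m) \<le> (real a)\<^sup>2 / (real m + real a)"
      using True False by (intro divide_left_mono mult_pos_pos) auto
    hence "exp (- (real a)\<^sup>2 / (real m + real a)) \<le> exp (- (real a)\<^sup>2 / (2 * real m))" by simp
    thus ?thesis using binom_ratio_upper[OF True] by (rule order.trans[rotated])
  qed (use binom_ratio_le_one in simp)
qed (simp add: binom_ratio_def binomial_eq_0)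

text \<open>Tannery's theorem is applied to both sides of \<open>binomial_cos_sum\<close> with
  \<open>l = l N\<close> and \<open>m = m N\<close>. These are integers with
  \<open>(l N)\<^sup>2 / m N = x\<close>, which is why \<open>x\<close> has to be the square of a
  rational number here.\<close>

lemma theta_transformation_rational:
  fixes p b :: nat
  assumes p: "p > 0" and b: "b > 0"
  defines "x \<equiv> 4 * (real p)\<^sup>2 / (real b)\<^sup>2"
  shows "theta4 (exp (- x)) = 2 * sqrt (pi / x) * (\<Sum>k. exp (- (pi\<^sup>2 * (2 * real k + 1)\<^sup>2 / (4 * x))))"
proof -
  define l where "l N = 2 * p * N" for N
  define m where "m N = b\<^sup>2 * N\<^sup>2" for N
  define A where "A j N = (-1) ^ Suc j * binom_ratio (m N) (Suc j * l N)" for j N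
  define y where "y k N = pi * (2 * real k + 1) / (2 * real (l N))" for k N
  \<comment> \<open>Only half of the nodes are kept. The reflection of \<open>k\<close> to
    \<open>l N - 1 - k\<close> replaces \<open>y k N\<close> by \<open>pi - y k N\<close> and leaves
    the even power of the cosine unchanged, whence a factor 2. Nodes near \<open>pi\<close>, where
    the powers would not be small, are thereby avoided.\<close>
  define C where "C k N = (if k < p * N then cos (y k N) ^ (2 * m N) else 0)" for k N
  have x: "x > 0" using p b by (simp add: x_def)
  have limA: "(\<lambda>N. A j N) \<longlonglongrightarrow> (-1) ^ Suc j * exp (- x * (real (Suc j))\<^sup>2)" for j
  proof -
    define c where "c = real (Suc j) * 2 * real p"
    define d where "d = (real b)\<^sup>2"
    have cd: "c > 0" "d > 0" using p b by (auto simp: c_def d_def)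
    have rl: "real (Suc j * l N) = c * real N" for N by (simp add: l_def c_def algebra_simps)
    have rm: "real (m N) = d * (real N)\<^sup>2" for N by (simp add: m_def d_def)
    have lim: "exp (- (c\<^sup>2 / d)) = exp (- x * (real (Suc j))\<^sup>2)"
      by (simp add: c_def d_def x_def power2_eq_square field_simps)
    have ev: "\<forall>\<^sub>F N in sequentially. Suc j * l N < m N"
    proof -
      have "\<forall>\<^sub>F N in sequentially. c * real N < d * (real N)\<^sup>2" using cd by real_asymp
      thus ?thesis by eventually_elim (simp only: rl [symmetric] rm [symmetric] of_nat_less_iff)
    qed
    have "(\<lambda>N. binom_ratio (m N) (Suc j * l N)) \<longlonglongrightarrow> exp (- (c\<^sup>2 / d))"
    proof (rule tendsto_sandwich)
      show "\<forall>\<^sub>F N in sequentially. exp (- (c * real N)\<^sup>2 / (d * (real N)\<^sup>2 - c * real N)) \<le> binom_ratio (m N) (Suc j * l N)"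
        using ev by eventually_elim (use binom_ratio_lower in \<open>simp only: rl [symmetric] rm [symmetric]\<close>)
      show "\<forall>\<^sub>F N in sequentially. binom_ratio (m N) (Suc j * l N) \<le> exp (- (c * real N)\<^sup>2 / (d * (real N)\<^sup>2 + c * real N))"
        using ev by eventually_elim (use binom_ratio_upper in \<open>simp only: rl [symmetric] rm [symmetric] less_imp_le\<close>)
      have eq: "- (c\<^sup>2 / d) = - (c\<^sup>2 * inverse d)" by (simp add: divide_inverse)
      show "(\<lambda>N. exp (- (c * real N)\<^sup>2 / (d * (real N)\<^sup>2 - c * real N))) \<longlonglongrightarrow> exp (- (c\<^sup>2 / d))"
        using cd unfolding eq by real_asymp
      show "(\<lambda>N. exp (- (c * real N)\<^sup>2 / (d * (real N)\<^sup>2 + c * real N))) \<longlonglongrightarrow> exp (- (c\<^sup>2 / d))"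
        using cd unfolding eq by real_asymp
    qed
    thus ?thesis unfolding lim A_def by (intro tendsto_mult_left)
  qed
  have limC: "(\<lambda>N. C k N) \<longlonglongrightarrow> exp (- (pi\<^sup>2 * (2 * real k + 1)\<^sup>2 / (4 * x)))" for k
  proof -
    define c where "c = pi * (2 * real k + 1) / (4 * real p)"
    have "(\<lambda>N. cos (c / real N) ^ (2 * b\<^sup>2 * N\<^sup>2)) \<longlonglongrightarrow> exp (- (c * (c * (real b)\<^sup>2)))"
      by real_asymp
    moreover have "- (c * (c * (real b)\<^sup>2)) = - (pi\<^sup>2 * (2 * real k + 1)\<^sup>2 / (4 * x))"
      using p b by (simp add: c_def x_def field_simps power2_eq_square)
    moreover have "\<forall>\<^sub>F N in sequentially. cos (c / real N) ^ (2 * b\<^sup>2 * N\<^sup>2) = C k N"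
      using eventually_gt_at_top[of k]
    proof eventually_elim
      case (elim N)
      hence "k < p * N" using p by (cases p) auto
      moreover have "c / real N = y k N" by (simp add: c_def y_def l_def)
      ultimately show ?case by (simp add: C_def m_def mult.assoc)
    qed
    ultimately show ?thesis by (simp add: filterlim_cong[OF refl refl])
  qed
  define rA where "rA = exp (- (2 * (real p)\<^sup>2 / (real b)\<^sup>2))"
  have rA: "0 < rA" "rA < 1" using p b by (auto simp: rA_def)
  have sumA: "(\<lambda>N. \<Sum>j. A j N) \<longlonglongrightarrow> (\<Sum>j. (-1) ^ Suc j * exp (- x * (real (Suc j))\<^sup>2))"
  proof (rule tannerys_theorem[THEN conjunct2, THEN conjunct2])
    show "summable (\<lambda>j. rA ^ j)" using rA by simp
    have "\<forall>\<^sub>F N in sequentially. \<forall>j. norm (A j N) \<le> rA ^ j"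
      using eventually_gt_at_top[of "0::nat"]
    proof eventually_elim
      case (elim N)
      show ?case
      proof
      fix j
      have "norm (A j N) = binom_ratio (m N) (Suc j * l N)"
        by (simp add: A_def binom_ratio_def abs_mult)
      also have "\<dots> \<le> exp (- (real (Suc j * l N))\<^sup>2 / (2 * real (m N)))" by (rule binom_ratio_upper')
      also have "- (real (Suc j * l N))\<^sup>2 / (2 * real (m N)) = real ((Suc j)\<^sup>2) * (- (2 * (real p)\<^sup>2 / (real b)\<^sup>2))"
        using elim b by (simp add: l_def m_def field_simps power2_eq_square)
      also have "exp \<dots> = rA ^ (Suc j)\<^sup>2"
        unfolding rA_def by (rule exp_of_nat_mult)
      also have "\<dots> \<le> rA ^ j"
        using rA by (intro power_decreasing) (auto simp: power2_eq_square)
      finally show "norm (A j N) \<le> rA ^ j" .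
      qed
    qed
    thus "\<forall>\<^sub>F (j, N) in sequentially \<times>\<^sub>F sequentially. norm (A j N) \<le> rA ^ j"
      unfolding eventually_prod_filter
      by (intro exI[of _ "\<lambda>_. True"] exI[of _ "\<lambda>N. \<forall>j. norm (A j N) \<le> rA ^ j"]) auto
  qed (use limA in auto)
  \<comment> \<open>\<open>cos_le_exp\<close> bounds \<open>C k N\<close> by
    \<open>rC ^ (2 * k + 1)\<^sup>2\<close>, independently of \<open>N\<close>.\<close>
  define rC where "rC = exp (- (pi\<^sup>2 * (real b)\<^sup>2 / (16 * (real p)\<^sup>2)))"
  have rC: "0 < rC" "rC < 1" using p b by (auto simp: rC_def)
  have sumC: "(\<lambda>N. \<Sum>k. C k N) \<longlonglongrightarrow> (\<Sum>k. exp (- (pi\<^sup>2 * (2 * real k + 1)\<^sup>2 / (4 * x))))"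
  proof (rule tannerys_theorem[THEN conjunct2, THEN conjunct2])
    show "summable (\<lambda>k. rC ^ k)" using rC by simp
    have "norm (C k N) \<le> rC ^ k" for k N
    proof (cases "k < p * N")
      case True
      have N: "N > 0" using True by (cases N) auto
      have "2 * real k + 1 \<le> 2 * real (p * N)" using True by (simp flip: of_nat_mult)
      hence yb: "0 \<le> y k N" "y k N \<le> pi / 2"
        using p N by (auto simp: y_def l_def divide_simps mult_ac)
      have "norm (C k N) = cos (y k N) ^ (2 * m N)"
        using True by (simp add: C_def power_mult)
      also have "\<dots> \<le> exp (- (y k N)\<^sup>2 / 2) ^ (2 * m N)"
        using cos_le_exp[OF yb] yb by (intro power_mono cos_ge_zero) auto
      also have "\<dots> = exp (real (2 * m N) * (- (y k N)\<^sup>2 / 2))"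
        by (rule exp_of_nat_mult [symmetric])
      also have "real (2 * m N) * (- (y k N)\<^sup>2 / 2) = real ((2 * k + 1)\<^sup>2) * (- (pi\<^sup>2 * (real b)\<^sup>2 / (16 * (real p)\<^sup>2)))"
        using N p by (simp add: y_def l_def m_def field_simps power2_eq_square)
      also have "exp \<dots> = rC ^ (2 * k + 1)\<^sup>2"
        unfolding rC_def by (rule exp_of_nat_mult)
      also have "\<dots> \<le> rC ^ k"
        using rC by (intro power_decreasing) (auto simp: power2_eq_square)
      finally show ?thesis .
    next
      case False
      thus ?thesis using rC by (simp add: C_def)
    qed
    thus "\<forall>\<^sub>F (k, N) in sequentially \<times>\<^sub>F sequentially. norm (C k N) \<le> rC ^ k"
      by (intro always_eventually) auto
  qed (use limC in auto)
  define K where "K n = 4 ^ n / (real ((2 * n) choose n) * sqrt (real n))" for n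
  have identity: "1 + 2 * (\<Sum>j. A j N) = (real b / real p) * K (m N) * (\<Sum>k. C k N)" if N: "N > 0" for N
  proof -
    have l: "l N > 0" using p N by (simp add: l_def)
    have "(\<Sum>j. A j N) = (\<Sum>j<m N. A j N)"
    proof (rule suminf_finite)
      fix j assume "j \<notin> {..<m N}"
      hence "m N < Suc j * l N" using l by (cases "l N") auto
      thus "A j N = 0" by (simp add: A_def binom_ratio_def)
    qed simp
    also have "\<dots> = (\<Sum>j=1..m N. (-1) ^ j * binom_ratio (m N) (j * l N))"
      unfolding A_def by (rule sum.reindex_bij_witness[of _ "\<lambda>j. j - 1" Suc]) auto
    finally have "1 + 2 * (\<Sum>j. A j N) = 4 ^ m N / (real ((2 * m N) choose m N) * real (l N)) *
        (\<Sum>k<l N. cos (y k N) ^ (2 * m N))"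
      using binomial_cos_sum[OF l, of "m N"] by (simp add: y_def)
    also have "(\<Sum>k<l N. cos (y k N) ^ (2 * m N)) = 2 * (\<Sum>k<p * N. cos (y k N) ^ (2 * m N))"
    proof -
      have sym: "cos (y (l N - 1 - k) N) ^ (2 * m N) = cos (y k N) ^ (2 * m N)" if k: "k < l N" for k
      proof -
        have "y (l N - 1 - k) N = pi - y k N"
          using k l by (simp add: y_def of_nat_diff field_simps)
        thus ?thesis by (simp add: cos_diff power_mult)
      qed
      have "{..<l N} = {..<p * N} \<union> {p * N..<l N}" by (auto simp: l_def)
      hence "(\<Sum>k<l N. cos (y k N) ^ (2 * m N)) =
          (\<Sum>k<p * N. cos (y k N) ^ (2 * m N)) + (\<Sum>k=p * N..<l N. cos (y k N) ^ (2 * m N))"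
        by (simp add: sum.union_disjoint ivl_disj_int)
      also have "(\<Sum>k=p * N..<l N. cos (y k N) ^ (2 * m N)) = (\<Sum>k<p * N. cos (y k N) ^ (2 * m N))"
        by (rule sum.reindex_bij_witness[of _ "\<lambda>k. l N - 1 - k" "\<lambda>k. l N - 1 - k"])
           (use sym in \<open>auto simp: l_def\<close>)
      finally show ?thesis by simp
    qed
    also have "(\<Sum>k<p * N. cos (y k N) ^ (2 * m N)) = (\<Sum>k. C k N)"
    proof -
      have "(\<Sum>k. C k N) = (\<Sum>k<p * N. C k N)"
        by (rule suminf_finite) (auto simp: C_def)
      thus ?thesis by (simp add: C_def)
    qed
    also have "4 ^ m N / (real ((2 * m N) choose m N) * real (l N)) * (2 * (\<Sum>k. C k N)) =
        (real b / real p) * K (m N) * (\<Sum>k. C k N)"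
    proof -
      have "sqrt (real (m N)) = real b * real N" by (simp add: m_def real_sqrt_mult)
      thus ?thesis unfolding K_def using N p b by (simp add: l_def divide_simps)
    qed
    finally show ?thesis .
  qed
  have "filterlim m at_top sequentially"
  proof (rule filterlim_at_top_mono[OF filterlim_ident])
    have "N \<le> m N" for N
    proof -
      have "N * 1 \<le> N * (b * b * N)" using b by (cases "N = 0") auto
      thus ?thesis by (simp add: m_def power2_eq_square mult_ac)
    qed
    thus "\<forall>\<^sub>F N in sequentially. N \<le> m N" by simp
  qed
  hence "(\<lambda>N. K (m N)) \<longlonglongrightarrow> sqrt pi"
    unfolding K_def by (rule filterlim_compose[OF central_binomial_limit])
  hence "(\<lambda>N. (real b / real p) * K (m N) * (\<Sum>k. C k N)) \<longlonglongrightarrow>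
      (real b / real p) * sqrt pi * (\<Sum>k. exp (- (pi\<^sup>2 * (2 * real k + 1)\<^sup>2 / (4 * x))))"
    by (intro tendsto_intros sumC)
  moreover have "\<forall>\<^sub>F N in sequentially. (real b / real p) * K (m N) * (\<Sum>k. C k N) = 1 + 2 * (\<Sum>j. A j N)"
    using eventually_gt_at_top[of 0] by eventually_elim (simp only: identity)
  ultimately have "(\<lambda>N. 1 + 2 * (\<Sum>j. A j N)) \<longlonglongrightarrow>
      (real b / real p) * sqrt pi * (\<Sum>k. exp (- (pi\<^sup>2 * (2 * real k + 1)\<^sup>2 / (4 * x))))"
    by (rule Lim_transform_eventually)
  moreover have "(\<lambda>N. 1 + 2 * (\<Sum>j. A j N)) \<longlonglongrightarrow> 1 + 2 * (\<Sum>j. (-1) ^ Suc j * exp (- x * (real (Suc j))\<^sup>2))"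
    by (intro tendsto_intros sumA)
  ultimately have "1 + 2 * (\<Sum>j. (-1) ^ Suc j * exp (- x * (real (Suc j))\<^sup>2)) =
      (real b / real p) * sqrt pi * (\<Sum>k. exp (- (pi\<^sup>2 * (2 * real k + 1)\<^sup>2 / (4 * x))))"
    by (rule LIMSEQ_unique [symmetric])
  moreover have "exp (- x * (real (Suc j))\<^sup>2) = exp (- x) ^ (Suc j)\<^sup>2" for j
    by (subst exp_of_nat_mult [symmetric]) (simp add: mult.commute)
  moreover have "real b / real p * sqrt pi = 2 * sqrt (pi / x)"
    using p b by (simp add: x_def real_sqrt_divide real_sqrt_mult)
  ultimately show ?thesis unfolding theta4_def by (simp only:)
qed

section \<open>Analytic continuation of the transformation to the half plane\<close>

lemma holomorphic_on_suminf:
  fixes f :: "nat \<Rightarrow> complex \<Rightarrow> complex"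
  assumes S: "open S" and hol: "\<And>n. f n holomorphic_on S"
  assumes M: "\<And>x. x \<in> S \<Longrightarrow> \<exists>d>0. cball x d \<subseteq> S \<and> (\<exists>M. summable M \<and> (\<forall>n. \<forall>y\<in>cball x d. norm (f n y) \<le> M n))"
  shows "(\<lambda>x. \<Sum>n. f n x) holomorphic_on S"
proof (rule holomorphic_uniform_sequence[OF S])
  show "(\<lambda>x. \<Sum>n<N. f n x) holomorphic_on S" for N
    by (intro holomorphic_intros hol)
  fix x assume "x \<in> S"
  from M[OF this] obtain d M where d: "d > 0" "cball x d \<subseteq> S" "summable M" "\<And>n y. y \<in> cball x d \<Longrightarrow> norm (f n y) \<le> M n"
    by blast
  have "uniform_limit (cball x d) (\<lambda>N x. \<Sum>n<N. f n x) (\<lambda>x. \<Sum>n. f n x) sequentially"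
    by (rule Weierstrass_m_test[OF d(4) d(3)])
  thus "\<exists>d>0. cball x d \<subseteq> S \<and> uniform_limit (cball x d) (\<lambda>N x. \<Sum>n<N. f n x) (\<lambda>x. \<Sum>n. f n x) sequentially"
    using d by blast
qed

lemma half_plane_props: "open {s. Re s > 0}" "convex {s. Re s > 0}" "connected {s. Re s > 0}"
  by (simp_all add: open_halfspace_Re_gt convex_halfspace_Re_gt convex_connected)

lemma holomorphic_theta4_exp:
  "(\<lambda>s. theta4 (exp (- (of_real pi * s))) :: complex) holomorphic_on {s. Re s > 0}"
proof -
  have "(\<lambda>s. \<Sum>j. (-1) ^ Suc j * exp (- (of_real pi * s)) ^ (Suc j)\<^sup>2 :: complex) holomorphic_on {s. Re s > 0}"
  proof (rule holomorphic_on_suminf[OF half_plane_props(1)])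
    fix s :: complex assume s: "s \<in> {s. Re s > 0}"
    define d where "d = Re s / 2"
    define r where "r = exp (- (pi * d))"
    have d: "d > 0" using s by (simp add: d_def)
    have r: "0 \<le> r" "r < 1" using d by (auto simp: r_def)
    have re: "Re y \<ge> d" if "y \<in> cball s d" for y
      using that abs_Re_le_cmod[of "s - y"] by (simp add: dist_norm d_def)
    have "norm ((-1) ^ Suc j * exp (- (of_real pi * y)) ^ (Suc j)\<^sup>2) \<le> r ^ j" if "y \<in> cball s d" for j y
    proof -
      have "norm (exp (- (of_real pi * y))) \<le> r" using re[OF that] by (simp add: r_def)
      hence "norm ((-1) ^ Suc j * exp (- (of_real pi * y)) ^ (Suc j)\<^sup>2) \<le> r ^ (Suc j)\<^sup>2"
        unfolding norm_mult norm_power by (simp add: power_mono)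
      also have "\<dots> \<le> r ^ j" using r by (intro power_decreasing) (auto simp: power2_eq_square)
      finally show ?thesis .
    qed
    moreover have "cball s d \<subseteq> {s. Re s > 0}" using re d by force
    moreover have "summable (\<lambda>j. r ^ j)" using r by simp
    ultimately show "\<exists>d>0. cball s d \<subseteq> {s. Re s > 0} \<and> (\<exists>M. summable M \<and>
        (\<forall>j. \<forall>y\<in>cball s d. norm ((-1) ^ Suc j * exp (- (of_real pi * y)) ^ (Suc j)\<^sup>2) \<le> M j))"
      using d by blast
  qed (intro holomorphic_intros)
  thus ?thesis unfolding theta4_def by (intro holomorphic_intros)
qed

text \<open>On a small disc around \<open>s\<close> the real part of \<open>1 / y\<close> has a
  positive lower bound \<open>c\<close>, because \<open>Re y\<close> is bounded below and
  \<open>norm y\<close> above; this makes the series converge uniformly there.\<close>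

lemma holomorphic_theta2_inverse:
  "(\<lambda>s. \<Sum>k. exp (- (of_real pi * (2 * of_nat k + 1)\<^sup>2 / (4 * s))) :: complex) holomorphic_on {s. Re s > 0}"
proof (rule holomorphic_on_suminf[OF half_plane_props(1)])
  fix s :: complex assume s: "s \<in> {s. Re s > 0}"
  define d where "d = Re s / 2"
  have d: "d > 0" using s by (simp add: d_def)
  have re: "Re y \<ge> d" if "y \<in> cball s d" for y
    using that abs_Re_le_cmod[of "s - y"] by (simp add: dist_norm d_def)
  define R where "R = norm s + d"
  define c where "c = d / R\<^sup>2"
  have R: "R > 0" using d by (simp add: R_def add_nonneg_pos)
  have c: "c > 0" using d R by (simp add: c_def)
  have inv: "Re (1 / y) \<ge> c" if y: "y \<in> cball s d" for y
  proof -
    have "norm y \<le> R" using y norm_triangle_sub[of y s] by (simp add: R_def dist_norm norm_minus_commute)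
    moreover have "norm y > 0" using re[OF y] d by auto
    ultimately have "d / R\<^sup>2 \<le> Re y / (norm y)\<^sup>2"
      using re[OF y] d by (intro frac_le power_mono) auto
    thus ?thesis by (simp add: c_def Re_divide cmod_power2)
  qed
  define r where "r = exp (- (pi * c / 4))"
  have r: "0 \<le> r" "r < 1" using c by (auto simp: r_def)
  have "norm (exp (- (of_real pi * (2 * of_nat k + 1)\<^sup>2 / (4 * y)))) \<le> r ^ k" if y: "y \<in> cball s d" for k y
  proof -
    have "Re (of_real pi * (2 * of_nat k + 1)\<^sup>2 / (4 * y)) = real ((2 * k + 1)\<^sup>2) * (pi * Re (1 / y) / 4)"
    proof -
      have "of_real pi * (2 * of_nat k + 1)\<^sup>2 / (4 * y) = of_real (real ((2 * k + 1)\<^sup>2) * (pi / 4)) * (1 / y)"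
        by (simp add: add.commute)
      thus ?thesis by (simp only: Re_complex_of_real times_complex.simps Im_complex_of_real)
    qed
    also have "\<dots> \<ge> real ((2 * k + 1)\<^sup>2) * (pi * c / 4)"
      using inv[OF y] by (intro mult_left_mono divide_right_mono) auto
    finally have "norm (exp (- (of_real pi * (2 * of_nat k + 1)\<^sup>2 / (4 * y)))) \<le> exp (real ((2 * k + 1)\<^sup>2) * (- (pi * c / 4)))"
      by simp
    also have "\<dots> = r ^ (2 * k + 1)\<^sup>2" unfolding r_def by (rule exp_of_nat_mult)
    also have "\<dots> \<le> r ^ k" using r by (intro power_decreasing) (auto simp: power2_eq_square)
    finally show ?thesis .
  qed
  moreover have "cball s d \<subseteq> {s. Re s > 0}" using re d by force
  moreover have "summable (\<lambda>j. r ^ j)" using r by simp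
  ultimately show "\<exists>d>0. cball s d \<subseteq> {s. Re s > 0} \<and> (\<exists>M. summable M \<and>
      (\<forall>k. \<forall>y\<in>cball s d. norm (exp (- (of_real pi * (2 * of_nat k + 1)\<^sup>2 / (4 * y)))) \<le> M k))"
    using d by blast
qed (intro holomorphic_intros, auto)

lemma theta4_of_real:
  assumes "\<bar>q\<bar> < 1"
  shows "theta4 (of_real q :: complex) = of_real (theta4 q)"
proof -
  have "summable (\<lambda>j. (-1) ^ Suc j * q ^ (Suc j)\<^sup>2)"
  proof (rule summable_comparison_test')
    show "summable (\<lambda>j. \<bar>q\<bar> ^ j)" using assms by simp
    show "norm ((-1) ^ Suc j * q ^ (Suc j)\<^sup>2) \<le> \<bar>q\<bar> ^ j" for j
      using assms by (simp add: abs_mult power_abs power_decreasing power2_eq_square del: power_Suc)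
  qed
  from suminf_of_real[OF this, where ?'a = complex] show ?thesis
    by (simp add: theta4_def)
qed

lemma summable_theta2_inverse:
  fixes s :: real
  assumes "s > 0"
  shows "summable (\<lambda>k. exp (- (pi * (2 * real k + 1)\<^sup>2 / (4 * s))))"
proof (rule summable_comparison_test')
  define r where "r = exp (- (pi / (4 * s)))"
  have r: "0 \<le> r" "r < 1" using assms by (auto simp: r_def)
  show "summable (\<lambda>k. r ^ k)" using r by simp
  fix k
  have "- (pi * (2 * real k + 1)\<^sup>2 / (4 * s)) = real ((2 * k + 1)\<^sup>2) * (- (pi / (4 * s)))"
    by (simp add: add.commute)
  hence "exp (- (pi * (2 * real k + 1)\<^sup>2 / (4 * s))) = exp (real ((2 * k + 1)\<^sup>2) * (- (pi / (4 * s))))"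
    by (simp only:)
  also have "\<dots> = r ^ (2 * k + 1)\<^sup>2" unfolding r_def by (rule exp_of_nat_mult)
  also have "\<dots> \<le> r ^ k" using r by (intro power_decreasing) (auto simp: power2_eq_square)
  finally show "norm (exp (- (pi * (2 * real k + 1)\<^sup>2 / (4 * s)))) \<le> r ^ k" by simp
qed

text \<open>Identity theorem: both sides are holomorphic in the half plane and agree by
  \<open>theta_transformation_rational\<close> on a set with a limit point.\<close>

theorem theta4_transformation:
  fixes s :: complex
  assumes s: "Re s > 0"
  shows "theta4 (exp (- (of_real pi * s))) =
    2 / csqrt s * (\<Sum>k. exp (- (of_real pi * (2 * of_nat k + 1)\<^sup>2 / (4 * s))))"
proof -
  define H where "H = {s. Re s > 0}"
  define R where "R s = 2 / csqrt s * (\<Sum>k. exp (- (of_real pi * (2 * of_nat k + 1)\<^sup>2 / (4 * s))))" for s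
  define D where "D s = theta4 (exp (- (of_real pi * s))) - R s" for s
  \<comment> \<open>\<open>pi * \<sigma> n\<close> is the square of a rational number, and the
    points accumulate at \<open>4 / pi\<close> without attaining it.\<close>
  define \<sigma> where "\<sigma> n = 4 * (real (n + 2))\<^sup>2 / (real (n + 1))\<^sup>2 / pi" for n :: nat
  have \<sigma>: "\<sigma> n > 0" for n by (simp add: \<sigma>_def)
  have holR: "R holomorphic_on H"
  proof -
    have "csqrt s \<noteq> 0" "s \<notin> \<real>\<^sub>\<le>\<^sub>0" if "s \<in> H" for s
      using that by (auto simp: H_def complex_nonpos_Reals_iff)
    thus ?thesis unfolding R_def
      using holomorphic_theta2_inverse[folded H_def] by (intro holomorphic_intros) auto
  qed
  have holD: "D holomorphic_on H"
    unfolding D_def using holomorphic_theta4_exp[folded H_def] by (intro holomorphic_intros holR)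
  have zero: "D (of_real (\<sigma> n)) = 0" for n
  proof -
    define x where "x = 4 * (real (n + 2))\<^sup>2 / (real (n + 1))\<^sup>2"
    have x: "x > 0" "pi * \<sigma> n = x" by (auto simp: x_def \<sigma>_def)
    have sx: "\<sigma> n = x / pi" by (simp add: x_def \<sigma>_def)
    have th: "theta4 (exp (- x)) = 2 * sqrt (pi / x) * (\<Sum>k. exp (- (pi\<^sup>2 * (2 * real k + 1)\<^sup>2 / (4 * x))))"
      unfolding x_def by (rule theta_transformation_rational) auto
    have "exp (- (of_real pi * of_real (\<sigma> n))) = (of_real (exp (- x)) :: complex)"
    proof -
      have "- (of_real pi * of_real (\<sigma> n)) = (of_real (- x) :: complex)" by (simp add: x(2) [symmetric])
      thus ?thesis by (simp only: exp_of_real)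
    qed
    hence "theta4 (exp (- (of_real pi * of_real (\<sigma> n)))) = (of_real (theta4 (exp (- x))) :: complex)"
      using x by (simp add: theta4_of_real)
    also have "\<dots> = R (of_real (\<sigma> n))"
    proof -
      have sm: "summable (\<lambda>k. exp (- (pi\<^sup>2 * (2 * real k + 1)\<^sup>2 / (4 * x))))"
        using summable_theta2_inverse[of "x / pi"] x by (simp add: power2_eq_square mult_ac)
      have tm: "of_real (exp (- (pi\<^sup>2 * (2 * real k + 1)\<^sup>2 / (4 * x)))) =
          exp (- (of_real pi * (2 * of_nat k + 1)\<^sup>2 / (4 * of_real (\<sigma> n))) :: complex)" for k
      proof -
        have "of_real pi * (2 * of_nat k + 1)\<^sup>2 / (4 * of_real (\<sigma> n)) =
            (of_real (pi\<^sup>2 * (2 * real k + 1)\<^sup>2 / (4 * x)) :: complex)"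
          using x by (simp add: sx field_simps power2_eq_square)
        thus ?thesis by (simp only: exp_of_real of_real_minus [symmetric])
      qed
      have "csqrt (of_real (\<sigma> n)) = of_real (sqrt (\<sigma> n))" using \<sigma>[of n] by simp
      moreover have "2 / of_real (sqrt (\<sigma> n)) = (of_real (2 * sqrt (pi / x)) :: complex)"
        by (simp add: sx real_sqrt_divide)
      ultimately show ?thesis unfolding th R_def tm [symmetric] suminf_of_real[OF sm, symmetric] by simp
    qed
    finally show ?thesis by (simp add: D_def)
  qed
  have "D s = 0"
  proof (rule analytic_continuation[OF holD, of "range (\<lambda>n. of_real (\<sigma> n))" "of_real (4 / pi)"])
    show "open H" "connected H" unfolding H_def by (rule half_plane_props)+
    show "range (\<lambda>n. complex_of_real (\<sigma> n)) \<subseteq> H" using \<sigma> by (auto simp: H_def)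
    show "complex_of_real (4 / pi) \<in> H" "s \<in> H" using s by (auto simp: H_def)
    show "D z = 0" if "z \<in> range (\<lambda>n. complex_of_real (\<sigma> n))" for z using that zero by auto
    show "complex_of_real (4 / pi) islimpt range (\<lambda>n. complex_of_real (\<sigma> n))"
      unfolding islimpt_sequential
    proof (intro exI[of _ "\<lambda>n. complex_of_real (\<sigma> n)"] conjI allI)
      have "\<sigma> n \<noteq> 4 / pi" for n
      proof
        assume "\<sigma> n = 4 / pi"
        hence "(real (n + 2))\<^sup>2 = (real (n + 1))\<^sup>2" by (simp add: \<sigma>_def field_simps)
        thus False by (simp add: power2_eq_iff_nonneg)
      qed
      hence "complex_of_real (\<sigma> n) \<noteq> of_real (4 / pi)" for n by (simp only: of_real_eq_iff not_False_eq_True)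
      thus "complex_of_real (\<sigma> n) \<in> range (\<lambda>n. complex_of_real (\<sigma> n)) - {complex_of_real (4 / pi)}" for n by blast
      have "\<sigma> \<longlonglongrightarrow> 4 / pi" unfolding \<sigma>_def divide_inverse by real_asymp
      thus "(\<lambda>n. complex_of_real (\<sigma> n)) \<longlonglongrightarrow> of_real (4 / pi)" by (rule tendsto_of_real)
    qed
  qed
  thus ?thesis by (simp add: D_def R_def)
qed

text \<open>The dual series has positive terms, and only \<open>k = 0\<close> is kept. The bound
  yields the positivity of \<open>theta4\<close> and later controls \<open>opart_gf\<close> at
  \<open>norm q\<close> on the vertical lines.\<close>

lemma theta4_real_ge:
  fixes s :: real
  assumes s: "s > 0"
  shows "theta4 (exp (- (pi * s))) \<ge> 2 / sqrt s * exp (- (pi / (4 * s)))"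
proof -
  define f where "f k = exp (- (pi * (2 * real k + 1)\<^sup>2 / (4 * s)))" for k :: nat
  have sm: "summable f" unfolding f_def by (rule summable_theta2_inverse[OF s])
  have tm: "exp (- (of_real pi * (2 * of_nat k + 1)\<^sup>2 / (4 * of_real s))) = (of_real (f k) :: complex)" for k
  proof -
    have "- (of_real pi * (2 * of_nat k + 1)\<^sup>2 / (4 * of_real s)) =
        (of_real (- (pi * (2 * real k + 1)\<^sup>2 / (4 * s))) :: complex)" by simp
    thus ?thesis unfolding f_def by (simp only: exp_of_real)
  qed
  have "- (of_real pi * of_real s) = (of_real (- (pi * s)) :: complex)" by simp
  hence "exp (- (of_real pi * of_real s)) = (of_real (exp (- (pi * s))) :: complex)"
    by (simp only: exp_of_real)
  hence "of_real (theta4 (exp (- (pi * s)))) = theta4 (exp (- (of_real pi * of_real s)) :: complex)"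
    using s by (simp add: theta4_of_real)
  also have "\<dots> = 2 / csqrt (of_real s) * (\<Sum>k. of_real (f k))"
    using s theta4_transformation[of "of_real s"] unfolding tm by simp
  also have "\<dots> = of_real (2 / sqrt s * (\<Sum>k. f k))"
    using s by (simp add: suminf_of_real[OF sm])
  finally have "theta4 (exp (- (pi * s))) = 2 / sqrt s * (\<Sum>k. f k)" by (simp only: of_real_eq_iff)
  moreover have "f 0 \<le> (\<Sum>k. f k)"
  proof -
    have "f k \<ge> 0" for k by (simp add: f_def)
    thus ?thesis using sum_le_suminf[OF sm, of "{0}"] by simp
  qed
  moreover have "f 0 = exp (- (pi / (4 * s)))" by (simp add: f_def)
  ultimately show ?thesis using s by (simp add: divide_right_mono)
qed

lemma theta4_pos:
  assumes "0 \<le> q" "q < 1"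
  shows "theta4 (q::real) > 0"
proof (cases "q = 0")
  case False
  define s where "s = - ln q / pi"
  have "ln q < 0" using False assms by simp
  hence s: "s > 0" by (simp add: s_def divide_neg_pos)
  have "q = exp (- (pi * s))" using False assms by (simp add: s_def)
  have "0 < 2 / sqrt s * exp (- (pi / (4 * s)))" using s by simp
  also have "\<dots> \<le> theta4 q" unfolding \<open>q = exp (- (pi * s))\<close> by (rule theta4_real_ge[OF s])
  finally show ?thesis .
qed (simp add: theta4_def zero_power)

section \<open>The generating function\<close>

text \<open>Partial product of Gauss's product for \<open>theta4\<close>; its reciprocal is the
  generating function of \<open>opart_le N\<close>.\<close>

definition gauss_prod :: "nat \<Rightarrow> 'a :: field \<Rightarrow> 'a" where
  "gauss_prod N q = (\<Prod>k=1..N. (1 - q ^ k) / (1 + q ^ k))"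

lemma power_ne_one:
  fixes q :: "'a :: real_normed_field"
  assumes "norm q < 1" "k > 0"
  shows "1 - q ^ k \<noteq> 0" "1 + q ^ k \<noteq> 0"
proof -
  have "norm (q ^ k) < 1" using assms by (simp add: norm_power power_less_one_iff)
  moreover have "norm (q ^ k) = 1" if "1 - q ^ k = 0 \<or> 1 + q ^ k = 0"
    using that by (metis eq_iff_diff_eq_0 eq_neg_iff_add_eq_0 norm_minus_cancel norm_one add.commute)
  ultimately show "1 - q ^ k \<noteq> 0" "1 + q ^ k \<noteq> 0" by auto
qed

lemma gauss_prod_nonzero:
  fixes q :: "'a :: real_normed_field"
  assumes "norm q < 1"
  shows "gauss_prod N q \<noteq> 0"
  using power_ne_one[OF assms] unfolding gauss_prod_def by (auto simp: prod_zero_iff)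

lemma gauss_prod_pos:
  fixes q :: real
  assumes "0 \<le> q" "q < 1"
  shows "gauss_prod N q > 0"
  unfolding gauss_prod_def
  by (intro prod_pos divide_pos_pos) (use assms in \<open>auto simp: power_less_one_iff add_pos_nonneg\<close>)

lemma gauss_prod_Suc: "gauss_prod (Suc N) q = gauss_prod N q * ((1 - q ^ Suc N) / (1 + q ^ Suc N))"
  by (simp add: gauss_prod_def)

text \<open>The power series identity in truncated form, so that it is available before convergence
  is known: cutting the shifted sums at \<open>M\<close> loses only nonnegative terms, which turns
  the functional equation into an inequality. As the bound does not depend on \<open>M\<close>,
  summability follows.\<close>

lemma opart_le_partial_sum:
  fixes r :: real
  assumes r: "0 \<le> r" "r < 1"
  shows "(\<Sum>n\<le>M. real (opart_le N n) * r ^ n) \<le> 1 / gauss_prod N r"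
proof (induction N)
  case 0
  have "(\<Sum>n\<le>M. real (opart_le 0 n) * r ^ n) = (\<Sum>n\<in>{0}. real (opart_le 0 n) * r ^ n)"
    by (rule sum.mono_neutral_right) (auto simp: opart_le_0)
  thus ?case by (simp add: opart_le_0 gauss_prod_def)
next
  case (Suc N)
  define m where "m = Suc N"
  define S where "S K = (\<Sum>n\<le>M. real (opart_le K n) * r ^ n)" for K
  have shift: "(\<Sum>n\<le>M. if n \<ge> m then a (n - m) * r ^ n else 0) \<le> r ^ m * (\<Sum>n\<le>M. a n * r ^ n)"
    if a: "\<And>n. a n \<ge> 0" for a :: "nat \<Rightarrow> real"
  proof -
    have "(\<Sum>n\<le>M. if n \<ge> m then a (n - m) * r ^ n else 0) = (\<Sum>n\<in>{n\<in>{..M}. m \<le> n}. a (n - m) * r ^ n)"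
      by (rule sum.inter_filter [symmetric]) simp
    also have "\<dots> = (\<Sum>n\<in>{n. n + m \<le> M}. a n * r ^ (n + m))"
      by (rule sum.reindex_bij_witness[of _ "\<lambda>n. n + m" "\<lambda>n. n - m"]) auto
    also have "\<dots> \<le> (\<Sum>n\<le>M. a n * r ^ (n + m))"
      by (rule sum_mono2) (use a r in auto)
    also have "\<dots> = r ^ m * (\<Sum>n\<le>M. a n * r ^ n)"
      by (simp add: sum_distrib_left power_add mult_ac)
    finally show ?thesis .
  qed
  have "S m = (\<Sum>n\<le>M. real (opart_le N n) * r ^ n + (if n \<ge> m then real (opart_le N (n - m)) * r ^ n else 0)
        + (if n \<ge> m then real (opart_le m (n - m)) * r ^ n else 0))"
    unfolding S_def by (rule sum.cong) (auto simp: m_def opart_le_Suc[of N] algebra_simps)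
  also have "\<dots> = S N + (\<Sum>n\<le>M. if n \<ge> m then real (opart_le N (n - m)) * r ^ n else 0)
      + (\<Sum>n\<le>M. if n \<ge> m then real (opart_le m (n - m)) * r ^ n else 0)"
    by (simp add: sum.distrib S_def)
  also have "\<dots> \<le> S N + r ^ m * S N + r ^ m * S m"
    unfolding S_def by (intro add_mono order.refl shift) auto
  finally have "S m * (1 - r ^ m) \<le> S N * (1 + r ^ m)" by (simp add: algebra_simps)
  moreover have rm: "r ^ m < 1" "r ^ m \<ge> 0" using r by (auto simp: m_def power_less_one_iff simp del: power_Suc)
  ultimately have "S m \<le> S N * ((1 + r ^ m) / (1 - r ^ m))" by (simp add: field_simps)
  also have "\<dots> \<le> 1 / gauss_prod N r * ((1 + r ^ m) / (1 - r ^ m))"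
    using Suc rm unfolding S_def by (intro mult_right_mono) auto
  also have "\<dots> = 1 / gauss_prod m r"
    unfolding m_def gauss_prod_Suc by simp
  finally show ?case unfolding S_def m_def .
qed

lemma summable_opart_le:
  fixes q :: "'a :: {real_normed_field, banach}"
  assumes "norm q < 1"
  shows "summable (\<lambda>n. of_nat (opart_le N n) * q ^ n)"
proof (rule summable_norm_cancel, rule bounded_imp_summable)
  show "(\<Sum>n\<le>M. norm (of_nat (opart_le N n) * q ^ n)) \<le> 1 / gauss_prod N (norm q)" for M
    using opart_le_partial_sum[of "norm q" N M] assms by (simp add: norm_mult norm_power)
qed auto

lemma sums_shift_power:
  fixes q :: "'a :: {real_normed_field, banach}"
  assumes "(\<lambda>n. a n * q ^ n) sums s"
  shows "(\<lambda>n. if n \<ge> m then a (n - m) * q ^ n else 0) sums (q ^ m * s)"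
proof -
  have "(\<lambda>n. q ^ m * (a n * q ^ n)) sums (q ^ m * s)"
    using assms by (rule sums_mult)
  hence "(\<lambda>n. (\<lambda>n. if n \<ge> m then a (n - m) * q ^ n else 0) (n + m)) sums (q ^ m * s)"
    by (simp add: power_add mult_ac)
  thus ?thesis by (subst (asm) sums_zero_iff_shift) auto
qed

lemma opart_le_sums:
  fixes q :: "'a :: {real_normed_field, banach}"
  assumes "norm q < 1"
  shows "(\<lambda>n. of_nat (opart_le N n) * q ^ n) sums (1 / gauss_prod N q)"
proof (induction N)
  case 0
  have "(\<lambda>n. of_nat (opart_le 0 n) * q ^ n) sums (\<Sum>n\<in>{0}. of_nat (opart_le 0 n) * q ^ n)"
    by (rule sums_finite) (auto simp: opart_le_0)
  thus ?case by (simp add: opart_le_0 gauss_prod_def)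
next
  case (Suc N)
  define m where "m = Suc N"
  define s where "s = 1 / gauss_prod N q"
  define t where "t = (\<Sum>n. of_nat (opart_le m n) * q ^ n)"
  have t: "(\<lambda>n. of_nat (opart_le m n) * q ^ n) sums t"
    unfolding t_def by (rule summable_sums) (rule summable_opart_le[OF assms])
  have "(\<lambda>n. of_nat (opart_le N n) * q ^ n + (if n \<ge> m then of_nat (opart_le N (n - m)) * q ^ n else 0)
        + (if n \<ge> m then of_nat (opart_le m (n - m)) * q ^ n else 0)) sums (s + q ^ m * s + q ^ m * t)"
    by (intro sums_add sums_shift_power t) (use Suc in \<open>auto simp: s_def\<close>)
  also have "(\<lambda>n. of_nat (opart_le N n) * q ^ n + (if n \<ge> m then of_nat (opart_le N (n - m)) * q ^ n else 0)
        + (if n \<ge> m then of_nat (opart_le m (n - m)) * q ^ n else 0)) = (\<lambda>n. of_nat (opart_le m n) * q ^ n)"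
    by (auto simp: fun_eq_iff m_def opart_le_Suc[of N] algebra_simps)
  finally have "t = s + q ^ m * s + q ^ m * t" using t sums_unique2 by blast
  hence "t * (1 - q ^ m) = s * (1 + q ^ m)" by (simp add: algebra_simps)
  hence "t = s * (1 + q ^ m) / (1 - q ^ m)"
    using power_ne_one[OF assms, of m] by (simp add: m_def eq_divide_eq del: power_Suc)
  hence "t = 1 / gauss_prod m q"
    unfolding s_def m_def gauss_prod_Suc by simp
  thus ?case using t unfolding m_def by simp
qed

section \<open>Convergence of the products to \<open>theta4\<close>\<close>

lemma summable_theta4:
  fixes q :: "'a :: {real_normed_field, banach}"
  assumes "norm q < 1"
  shows "summable (\<lambda>j. (-1) ^ Suc j * q ^ (Suc j)\<^sup>2)"
proof (rule summable_comparison_test')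
  show "summable (\<lambda>j. norm q ^ j)" using assms by simp
  fix j :: nat
  have "j \<le> (Suc j)\<^sup>2" by (simp add: power2_eq_square)
  thus "norm ((-1) ^ Suc j * q ^ (Suc j)\<^sup>2) \<le> norm q ^ j"
    using assms by (simp add: norm_mult norm_power power_decreasing)
qed

lemma theta4_partial_LIMSEQ:
  fixes q :: "'a :: {real_normed_field, banach}"
  assumes "norm q < 1"
  shows "(\<lambda>n. 1 + 2 * (\<Sum>j=1..n. (-1) ^ j * q ^ j\<^sup>2)) \<longlonglongrightarrow> theta4 q"
proof -
  have "(\<lambda>n. \<Sum>j<n. (-1) ^ Suc j * q ^ (Suc j)\<^sup>2) \<longlonglongrightarrow> (\<Sum>j. (-1) ^ Suc j * q ^ (Suc j)\<^sup>2)"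
    using summable_theta4[OF assms] by (rule summable_LIMSEQ)
  moreover have "(\<Sum>j<n. (-1) ^ Suc j * q ^ (Suc j)\<^sup>2) = (\<Sum>j=1..n. (-1) ^ j * q ^ j\<^sup>2)" for n
    by (rule sum.reindex_bij_witness[of _ "\<lambda>j. j - 1" Suc]) auto
  ultimately show ?thesis unfolding theta4_def by (intro tendsto_intros) simp
qed

text \<open>In \<open>finite_gauss_identity\<close> the term \<open>j = 0\<close> is
  \<open>gauss_prod n q\<close>, while every term with \<open>j \<ge> 1\<close> contains a power of
  \<open>q\<close> with exponent at least \<open>n + 1\<close>; together these are of order
  \<open>n * r ^ n\<close>. The bound \<open>C\<close> on the tail products remains a hypothesis
  because it is obtained differently for real and for complex \<open>q\<close>.\<close>

lemma gauss_prod_LIMSEQ_aux: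
  fixes q :: "'a :: {real_normed_field, banach}"
  assumes q: "norm q < 1"
  assumes C: "\<And>j n. j \<ge> 1 \<Longrightarrow> norm (\<Prod>k=Suc j..n. (1 - q ^ k) / (1 + q ^ k)) \<le> C"
  shows "(\<lambda>n. gauss_prod n q) \<longlonglongrightarrow> theta4 q"
proof -
  define r where "r = norm q"
  have r: "0 \<le> r" "r < 1" using q by (auto simp: r_def)
  have C0: "C \<ge> 0" using C[of 1 1] by (auto intro: order.trans[OF norm_ge_zero])
  define c where "c k = (if k = 0 then 1 / 2 else 1 / (1 + q ^ k))" for k
  have c: "(1 + q ^ k) * c k = 1" for k
    using power_ne_one[OF q, of k] by (auto simp: c_def)
  define t where "t n j = (-1) ^ j * 2 * c j * q ^ (j * (n + 1)) * (\<Prod>k=Suc j..n. (1 - q ^ k) * c k)" for n j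
  have prod_eq: "(\<Prod>k=Suc j..n. (1 - q ^ k) * c k) = (\<Prod>k=Suc j..n. (1 - q ^ k) / (1 + q ^ k))" for j n
    by (rule prod.cong) (auto simp: c_def)
  have id: "1 + 2 * (\<Sum>j=1..n. (-1) ^ j * q ^ j\<^sup>2) = gauss_prod n q + (\<Sum>j=1..n. t n j)" for n
  proof -
    have "1 + 2 * (\<Sum>j=1..n. (-1) ^ j * q ^ j\<^sup>2) = (\<Sum>j=0..n. t n j)"
      unfolding t_def by (rule finite_gauss_identity[OF c])
    also have "\<dots> = t n 0 + (\<Sum>j=1..n. t n j)"
      by (simp add: sum.atLeast_Suc_atMost)
    also have "t n 0 = gauss_prod n q"
      unfolding t_def prod_eq gauss_prod_def by (simp add: c_def)
    finally show ?thesis .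
  qed
  have tb: "norm (t n j) \<le> 2 / (1 - r) * C * r ^ (n + 1)" if j: "j \<in> {1..n}" for n j
  proof -
    have "norm (q ^ j) \<le> r"
      using j r power_decreasing[of 1 j r] by (simp add: norm_power r_def)
    hence "1 - r \<le> norm (1 + q ^ j)"
      using norm_diff_ineq[of 1 "q ^ j"] by simp
    hence "norm (c j) \<le> 1 / (1 - r)"
      using r j by (auto simp: c_def norm_divide intro!: divide_left_mono mult_pos_pos)
    moreover have "n + 1 \<le> j * (n + 1)" using j by (cases j) auto
    hence "norm (q ^ (j * (n + 1))) \<le> r ^ (n + 1)"
      unfolding norm_power r_def[symmetric] using r by (intro power_decreasing) auto
    moreover have "norm (\<Prod>k=Suc j..n. (1 - q ^ k) * c k) \<le> C"
      unfolding prod_eq using C j by auto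
    ultimately have "norm (t n j) \<le> 2 * (1 / (1 - r)) * r ^ (n + 1) * C"
      unfolding t_def norm_mult using r C0
      by (intro mult_mono) (auto simp: norm_power intro!: mult_nonneg_nonneg)
    thus ?thesis by (simp add: mult_ac)
  qed
  have "(\<lambda>n. \<Sum>j=1..n. t n j) \<longlonglongrightarrow> 0"
  proof (rule Lim_null_comparison)
    show "\<forall>\<^sub>F n in sequentially. norm (\<Sum>j=1..n. t n j) \<le> 2 / (1 - r) * C * r * (real n * r ^ n)"
    proof (intro always_eventually allI)
      fix n
      have "norm (\<Sum>j=1..n. t n j) \<le> (\<Sum>j=1..n. 2 / (1 - r) * C * r ^ (n + 1))"
        by (rule order.trans[OF norm_sum sum_mono]) (use tb in auto)
      thus "norm (\<Sum>j=1..n. t n j) \<le> 2 / (1 - r) * C * r * (real n * r ^ n)"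
        by (simp add: mult_ac)
    qed
    have "(\<lambda>n. real n * r ^ n) \<longlonglongrightarrow> 0"
      using powser_times_n_limit_0[of r] r by simp
    thus "(\<lambda>n. 2 / (1 - r) * C * r * (real n * r ^ n)) \<longlonglongrightarrow> 0"
      by (rule tendsto_mult_right_zero)
  qed
  with theta4_partial_LIMSEQ[OF q]
  have "(\<lambda>n. 1 + 2 * (\<Sum>j=1..n. (-1) ^ j * q ^ j\<^sup>2) - (\<Sum>j=1..n. t n j)) \<longlonglongrightarrow> theta4 q - 0"
    by (rule tendsto_diff)
  thus ?thesis unfolding id by simp
qed

lemma gauss_prod_LIMSEQ_real:
  fixes r :: real
  assumes r: "0 \<le> r" "r < 1"
  shows "(\<lambda>n. gauss_prod n r) \<longlonglongrightarrow> theta4 r"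
proof (rule gauss_prod_LIMSEQ_aux)
  show "norm (\<Prod>k=Suc j..n. (1 - r ^ k) / (1 + r ^ k)) \<le> 1" for j n
    unfolding prod_norm [symmetric]
  proof (rule prod_le_1)
    fix k assume "k \<in> {Suc j..n}"
    have "0 \<le> r ^ k" "r ^ k \<le> 1" using r by (auto intro: power_le_one)
    thus "0 \<le> norm ((1 - r ^ k) / (1 + r ^ k)) \<and> norm ((1 - r ^ k) / (1 + r ^ k)) \<le> 1"
      by (auto simp: divide_le_eq)
  qed
qed (use r in auto)

lemma gauss_prod_ge_theta4:
  fixes r :: real
  assumes r: "0 \<le> r" "r < 1"
  shows "theta4 r \<le> gauss_prod n r"
proof (rule decseq_ge[OF _ gauss_prod_LIMSEQ_real[OF r]])
  show "decseq (\<lambda>n. gauss_prod n r)"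
  proof (rule decseq_SucI)
    fix n
    have "0 \<le> r ^ Suc n" using r by (auto intro: power_le_one)
    hence "(1 - r ^ Suc n) / (1 + r ^ Suc n) \<le> 1" by (auto simp: divide_le_eq simp del: power_Suc)
    thus "gauss_prod (Suc n) r \<le> gauss_prod n r"
      unfolding gauss_prod_Suc using gauss_prod_pos[OF r, of n] by (intro mult_left_le) auto
  qed
qed

text \<open>The tail products are dominated by reciprocals of real products at
  \<open>norm q\<close>. Those decrease to \<open>theta4 (norm q)\<close>, which is positive by the
  theta transformation; hence the real case has to come first.\<close>

lemma gauss_prod_LIMSEQ:
  fixes q :: complex
  assumes q: "norm q < 1"
  shows "(\<lambda>n. gauss_prod n q) \<longlonglongrightarrow> theta4 q"
proof (rule gauss_prod_LIMSEQ_aux[OF q])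
  define r where "r = norm q"
  have r: "0 \<le> r" "r < 1" using q by (auto simp: r_def)
  fix j n :: nat
  define f where "f k = (1 + r ^ k) / (1 - r ^ k)" for k
  have f1: "f k \<ge> 1" if "k \<ge> 1" for k
  proof -
    have "r ^ k < 1" "r ^ k \<ge> 0" using r that by (auto simp: power_less_one_iff)
    thus ?thesis by (simp add: f_def)
  qed
  have "norm (\<Prod>k=Suc j..n. (1 - q ^ k) / (1 + q ^ k)) \<le> (\<Prod>k=Suc j..n. f k)"
    unfolding prod_norm [symmetric]
  proof (rule prod_mono)
    fix k assume "k \<in> {Suc j..n}"
    hence k: "k \<ge> 1" by simp
    have rk: "r ^ k < 1" "r ^ k \<ge> 0" using r k by (auto simp: power_less_one_iff)
    have "norm (1 - q ^ k) \<le> 1 + r ^ k"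
      using norm_triangle_ineq4[of 1 "q ^ k"] by (simp add: norm_power r_def)
    moreover have "1 - r ^ k \<le> norm (1 + q ^ k)"
      using norm_diff_ineq[of 1 "q ^ k"] by (simp add: norm_power r_def)
    ultimately have "norm ((1 - q ^ k) / (1 + q ^ k)) \<le> f k"
      unfolding norm_divide f_def using rk by (intro frac_le) auto
    thus "0 \<le> norm ((1 - q ^ k) / (1 + q ^ k)) \<and> norm ((1 - q ^ k) / (1 + q ^ k)) \<le> f k"
      by simp
  qed
  also have "\<dots> \<le> (\<Prod>k=1..n. f k)"
  proof (cases "j \<le> n")
    case True
    have "(\<Prod>k=1..n. f k) = (\<Prod>k=1..j. f k) * (\<Prod>k=Suc j..n. f k)"
      using True prod.ub_add_nat[of 1 j f "n - j"] by simp
    moreover have "(\<Prod>k=1..j. f k) \<ge> 1" by (rule prod_ge_1) (use f1 in auto)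
    moreover have "(\<Prod>k=Suc j..n. f k) \<ge> 0"
      by (intro prod_nonneg ballI order.trans[OF zero_le_one] f1) auto
    ultimately show ?thesis using mult_right_mono[of 1 "\<Prod>k=1..j. f k" "\<Prod>k=Suc j..n. f k"] by simp
  next
    case False
    have "(\<Prod>k=1..n. f k) \<ge> 1" by (rule prod_ge_1) (use f1 in auto)
    thus ?thesis using False by simp
  qed
  also have "\<dots> = 1 / gauss_prod n r"
    unfolding gauss_prod_def f_def by (simp add: prod_dividef)
  also have "\<dots> \<le> 1 / theta4 r"
    using gauss_prod_ge_theta4[OF r, of n] theta4_pos[OF r] gauss_prod_pos[OF r, of n]
    by (intro divide_left_mono) auto
  finally show "norm (\<Prod>k=Suc j..n. (1 - q ^ k) / (1 + q ^ k)) \<le> 1 / theta4 r" .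
qed

section \<open>The generating function of \<open>overpart\<close> in the unit disc\<close>

definition opart_gf :: "complex \<Rightarrow> complex" where
  "opart_gf q = (\<Sum>n. of_nat (overpart n) * q ^ n)"

lemma summable_overpart_real:
  fixes r :: real
  assumes r: "0 \<le> r" "r < 1"
  shows "summable (\<lambda>n. real (overpart n) * r ^ n)"
proof (rule bounded_imp_summable)
  fix M
  have "(\<Sum>n\<le>M. real (overpart n) * r ^ n) = (\<Sum>n\<le>M. real (opart_le M n) * r ^ n)"
    by (intro sum.cong) (auto simp: overpart_eq_opart_le[of _ M])
  also have "\<dots> \<le> 1 / gauss_prod M r" by (rule opart_le_partial_sum[OF r])
  also have "\<dots> \<le> 1 / theta4 r"
    using gauss_prod_ge_theta4[OF r, of M] theta4_pos[OF r] gauss_prod_pos[OF r, of M]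
    by (intro divide_left_mono) auto
  finally show "(\<Sum>n\<le>M. real (overpart n) * r ^ n) \<le> 1 / theta4 r" .
qed (use r in auto)

text \<open>Tannery's theorem in \<open>N\<close>: each coefficient is eventually constant and never
  exceeds its limit \<open>overpart n\<close>.\<close>

lemma inverse_gauss_prod_LIMSEQ:
  fixes q :: complex
  assumes q: "norm q < 1"
  shows "(\<lambda>N. 1 / gauss_prod N q) \<longlonglongrightarrow> opart_gf q"
proof -
  have mono: "opart_le N n \<le> overpart n" for N n
  proof (cases "N \<le> n")
    case True
    have "opart_le N n \<le> opart_le n n"
      using lift_Suc_mono_le[of "\<lambda>m. opart_le m n", OF opart_le_mono True] .
    thus ?thesis by (simp add: overpart_eq_opart_le[of n n])
  next
    case False
    thus ?thesis by (simp add: overpart_eq_opart_le[of n N])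
  qed
  have "(\<lambda>N. \<Sum>n. of_nat (opart_le N n) * q ^ n) \<longlonglongrightarrow> (\<Sum>n. of_nat (overpart n) * q ^ n)"
  proof (rule tannerys_theorem[THEN conjunct2, THEN conjunct2])
    fix n
    have "\<forall>\<^sub>F N in sequentially. of_nat (opart_le N n) * q ^ n = of_nat (overpart n) * q ^ n"
      using eventually_ge_at_top[of n] by eventually_elim (simp add: overpart_eq_opart_le)
    thus "(\<lambda>N. of_nat (opart_le N n) * q ^ n) \<longlonglongrightarrow> of_nat (overpart n) * q ^ n"
      by (rule tendsto_eventually)
  next
    show "\<forall>\<^sub>F (n, N) in at_top \<times>\<^sub>F sequentially.
        norm (of_nat (opart_le N n) * q ^ n) \<le> real (overpart n) * norm q ^ n"
      by (intro always_eventually) (auto simp: norm_mult norm_power intro!: mult_right_mono mono)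
  qed (use q summable_overpart_real[of "norm q"] in auto)
  moreover have "(\<Sum>n. of_nat (opart_le N n) * q ^ n) = 1 / gauss_prod N q" for N
    using opart_le_sums[OF q] by (rule sums_unique[symmetric])
  ultimately show ?thesis by (simp add: opart_gf_def)
qed

lemma opart_gf_theta4:
  assumes "norm q < 1"
  shows "opart_gf q * theta4 q = 1"
proof -
  have "(\<lambda>N. 1 / gauss_prod N q * gauss_prod N q) \<longlonglongrightarrow> opart_gf q * theta4 q"
    by (intro tendsto_mult inverse_gauss_prod_LIMSEQ gauss_prod_LIMSEQ assms)
  thus ?thesis using gauss_prod_nonzero[OF assms] by (simp add: LIMSEQ_const_iff)
qed

text \<open>The logarithm of \<open>(1 + w) / (1 - w)\<close> minus \<open>2 * w\<close> has
  nonnegative Taylor coefficients, so its real part is largest at \<open>norm w\<close>. Not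
  estimating the linear term is what leaves the saving factor. The proof differentiates along the
  ray through \<open>w\<close>, where the derivative is
  \<open>2 * u * z\<^sup>2 / (1 - z\<^sup>2)\<close>.\<close>

lemma norm_cayley_le:
  fixes w :: complex
  assumes w: "norm w < 1"
  shows "norm ((1 + w) / (1 - w)) \<le> (1 + norm w) / (1 - norm w) * exp (2 * Re w - 2 * norm w)"
proof (cases "w = 0")
  case False
  define r where "r = norm w"
  have r: "0 < r" "r < 1" using w False by (auto simp: r_def)
  define u where "u = w / of_real r"
  have u: "norm u = 1" "of_real r * u = w" using r by (auto simp: u_def r_def norm_divide)
  define g where "g t = Re (Ln (1 + of_real t * u) - Ln (1 - of_real t * u) - 2 * of_real t * u)" for t
  define h where "h t = ln (1 + t) - ln (1 - t) - 2 * t - g t" for t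
  have h_eq: "h = (\<lambda>t. ln (1 + t) - ln (1 - t) - 2 * t - g t)" by (simp add: h_def fun_eq_iff)
  have "h 0 \<le> h r"
  proof (rule DERIV_nonneg_imp_nondecreasing[where f = h])
    fix t assume t: "0 \<le> t" "t \<le> r"
    hence t1: "t < 1" using r by simp
    have ntu: "norm (of_real t * u) < 1" using t t1 u by (simp add: norm_mult)
    hence re: "\<bar>Re (of_real t * u)\<bar> < 1"
      using abs_Re_le_cmod[of "of_real t * u"] by linarith
    define z where "z = of_real t * u"
    have z: "\<bar>Re z\<bar> < 1" "norm z < 1" using re ntu by (auto simp: z_def)
    have nonpos: "1 + z \<notin> \<real>\<^sub>\<le>\<^sub>0" "1 - z \<notin> \<real>\<^sub>\<le>\<^sub>0"
      using z by (auto simp: complex_nonpos_Reals_iff)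
    have z2: "1 - z\<^sup>2 \<noteq> 0" "1 + z \<noteq> 0" "1 - z \<noteq> 0"
      using power_ne_one[OF z(2), of 2] power_ne_one[OF z(2), of 1] by auto
    define D where "D = u / (1 + z) + u / (1 - z) - 2 * u"
    have "((\<lambda>t. Ln (1 + t * u) - Ln (1 - t * u) - 2 * t * u) has_field_derivative D) (at (of_real t))"
      using nonpos unfolding D_def z_def
      by (auto intro!: derivative_eq_intros simp: divide_inverse)
    from has_vector_derivative_real_field[OF this]
    have "((\<lambda>t. Ln (1 + of_real t * u) - Ln (1 - of_real t * u) - 2 * of_real t * u)
            has_vector_derivative D) (at t)" .
    hence "(g has_vector_derivative Re D) (at t)"
      unfolding g_def
      by (rule bounded_linear.has_vector_derivative[OF bounded_linear_Re])
    hence "(h has_real_derivative (1 / (1 + t) + 1 / (1 - t) - 2 - Re D)) (at t)"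
      unfolding h_eq has_real_derivative_iff_has_vector_derivative[symmetric]
      using t t1 by (auto intro!: derivative_eq_intros simp: divide_simps)
    moreover have "Re D \<le> 1 / (1 + t) + 1 / (1 - t) - 2"
    proof -
      have "D = 2 * u * z\<^sup>2 / (1 - z\<^sup>2)"
        using z2 unfolding D_def by (simp add: divide_simps power2_eq_square) (simp add: algebra_simps)
      hence "norm D = 2 * t\<^sup>2 / norm (1 - z\<^sup>2)"
        using t by (simp add: norm_divide norm_mult norm_power u z_def)
      also have "\<dots> \<le> 2 * t\<^sup>2 / (1 - t\<^sup>2)"
      proof (rule divide_left_mono)
        have "norm (z\<^sup>2) = t\<^sup>2" using t by (simp add: z_def norm_mult norm_power u)
        thus "1 - t\<^sup>2 \<le> norm (1 - z\<^sup>2)" using norm_triangle_ineq2[of 1 "z\<^sup>2"] by simp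
        show "0 < norm (1 - z\<^sup>2) * (1 - t\<^sup>2)"
          using z2 t t1 by (intro mult_pos_pos) (auto simp: power_less_one_iff)
      qed auto
      also have "\<dots> = 1 / (1 + t) + 1 / (1 - t) - 2"
      proof -
        have "1 - t\<^sup>2 = (1 + t) * (1 - t)" by (simp add: power2_eq_square algebra_simps)
        thus ?thesis using t t1 by (simp add: divide_simps power2_eq_square)
      qed
      finally show ?thesis using complex_Re_le_cmod[of D] by linarith
    qed
    ultimately show "\<exists>y. (h has_real_derivative y) (at t) \<and> y \<ge> 0" by force
  qed (use r in simp)
  hence le: "Re (Ln (1 + w) - Ln (1 - w)) \<le> ln (1 + r) - ln (1 - r) + (2 * Re w - 2 * r)"
    using u(2) by (simp add: h_def g_def mult.assoc)
  have ne: "1 + w \<noteq> 0" "1 - w \<noteq> 0"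
    using power_ne_one[OF w, of 1] by auto
  have "norm ((1 + w) / (1 - w)) = exp (Re (Ln (1 + w) - Ln (1 - w)))"
    using ne by (simp add: exp_diff norm_divide)
  also have "\<dots> \<le> exp (ln (1 + r) - ln (1 - r) + (2 * Re w - 2 * r))"
    using le by simp
  also have "\<dots> = (1 + r) / (1 - r) * exp (2 * Re w - 2 * r)"
    using r by (simp add: exp_add exp_diff)
  finally show ?thesis unfolding r_def .
qed simp

text \<open>\<open>norm_cayley_le\<close> is multiplied over all \<open>w = q ^ k\<close>; the
  linear terms that it retains add up to geometric series, so the saving away from the positive axis
  has a closed form.\<close>

lemma norm_opart_gf_le:
  assumes q: "norm q < 1"
  shows "norm (opart_gf q) \<le>
    1 / theta4 (norm q) * exp (2 * (Re (q / (1 - q)) - norm q / (1 - norm q)))"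
proof -
  define r where "r = norm q"
  have r: "0 \<le> r" "r < 1" using q by (auto simp: r_def)
  have gs: "(\<lambda>N. \<Sum>k=1..N. z ^ k) \<longlonglongrightarrow> z / (1 - z)" if "norm z < 1" for z :: "'a :: {real_normed_field, banach}"
  proof -
    have "(\<lambda>N. z * (\<Sum>k<N. z ^ k)) \<longlonglongrightarrow> z * (1 / (1 - z))"
      using geometric_sums[OF that] by (intro tendsto_intros) (simp add: sums_def)
    moreover have "(\<Sum>k=1..N. z ^ k) = z * (\<Sum>k<N. z ^ k)" for N
      unfolding sum_distrib_left
      by (rule sum.reindex_bij_witness[of _ Suc "\<lambda>k. k - 1"]) (auto simp flip: power_Suc)
    ultimately show ?thesis by simp
  qed
  have bnd: "norm (1 / gauss_prod N q) \<le>
      1 / gauss_prod N r * exp (2 * Re (\<Sum>k=1..N. q ^ k) - 2 * (\<Sum>k=1..N. r ^ k))" for N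
  proof -
    have inv: "1 / gauss_prod N z = (\<Prod>k=1..N. (1 + z ^ k) / (1 - z ^ k))" for z :: "'a :: field"
      by (simp add: gauss_prod_def prod_dividef)
    have "norm (1 / gauss_prod N q) = (\<Prod>k=1..N. norm ((1 + q ^ k) / (1 - q ^ k)))"
      unfolding inv prod_norm ..
    also have "\<dots> \<le> (\<Prod>k=1..N. (1 + r ^ k) / (1 - r ^ k) * exp (2 * Re (q ^ k) - 2 * r ^ k))"
    proof (rule prod_mono, safe)
      fix k assume "k \<in> {1..N}"
      hence "norm (q ^ k) < 1" using q by (auto simp: norm_power power_less_one_iff)
      from norm_cayley_le[OF this]
      show "norm ((1 + q ^ k) / (1 - q ^ k)) \<le> (1 + r ^ k) / (1 - r ^ k) * exp (2 * Re (q ^ k) - 2 * r ^ k)"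
        by (simp add: norm_power r_def)
    qed auto
    also have "\<dots> = 1 / gauss_prod N r * exp (\<Sum>k=1..N. 2 * Re (q ^ k) - 2 * r ^ k)"
      by (simp only: inv prod.distrib exp_sum[OF finite_atLeastAtMost])
    also have "(\<Sum>k=1..N. 2 * Re (q ^ k) - 2 * r ^ k) = 2 * Re (\<Sum>k=1..N. q ^ k) - 2 * (\<Sum>k=1..N. r ^ k)"
      by (simp add: sum_subtractf sum_distrib_left)
    finally show ?thesis .
  qed
  have "norm (opart_gf q) \<le> 1 / theta4 r * exp (2 * Re (q / (1 - q)) - 2 * (r / (1 - r)))"
  proof (rule tendsto_le[OF sequentially_bot])
    show "(\<lambda>N. norm (1 / gauss_prod N q)) \<longlonglongrightarrow> norm (opart_gf q)"
      by (intro tendsto_norm inverse_gauss_prod_LIMSEQ q)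
    show "(\<lambda>N. 1 / gauss_prod N r * exp (2 * Re (\<Sum>k=1..N. q ^ k) - 2 * (\<Sum>k=1..N. r ^ k)))
        \<longlonglongrightarrow> 1 / theta4 r * exp (2 * Re (q / (1 - q)) - 2 * (r / (1 - r)))"
      by (intro tendsto_intros gauss_prod_LIMSEQ_real r gs)
         (use theta4_pos[OF r] q r in auto)
  qed (use bnd in auto)
  thus ?thesis by (simp add: r_def algebra_simps)
qed

section \<open>The exact recurrence, from formal power series\<close>

lemma opart_le_fps:
  defines "P \<equiv> (\<lambda>N. Abs_fps (\<lambda>n. of_nat (opart_le N n)) :: rat fps)"
  shows "P N * (\<Prod>k=1..N. (1 - fps_X ^ k) * inverse (1 + fps_X ^ k)) = 1"
proof (induction N)
  case 0
  show ?case by (auto simp: P_def fps_eq_iff opart_le_0)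
next
  case (Suc N)
  define m where "m = Suc N"
  have "P m = P N + fps_X ^ m * (P N + P m)"
  proof (rule fps_ext)
    fix n
    show "fps_nth (P m) n = fps_nth (P N + fps_X ^ m * (P N + P m)) n"
      using opart_le_Suc[of N n] unfolding P_def m_def
      by (simp add: fps_X_power_mult_nth del: power_Suc)
  qed
  hence "P m * (1 - fps_X ^ m) = P N * (1 + fps_X ^ m)"
    by (simp add: algebra_simps)
  moreover have "(1 + fps_X ^ m) * inverse (1 + fps_X ^ m :: rat fps) = 1"
    by (rule inverse_mult_eq_1') (simp add: m_def)
  ultimately have "P m * ((1 - fps_X ^ m) * inverse (1 + fps_X ^ m)) = P N"
    by (simp only: mult.assoc [symmetric]) (simp only: mult.assoc mult_1_right)
  moreover define h :: "nat \<Rightarrow> rat fps" where "h k = (1 - fps_X ^ k) * inverse (1 + fps_X ^ k)" for k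
  ultimately have "P m * h m = P N" by simp
  moreover have "(\<Prod>k=1..m. h k) = h m * (\<Prod>k=1..N. h k)" by (simp add: m_def mult.commute)
  ultimately have "P m * (\<Prod>k=1..m. h k) = P N * (\<Prod>k=1..N. h k)" by (simp only: mult.assoc [symmetric])
  thus ?case using Suc unfolding h_def m_def by (simp only:)
qed

text \<open>In \<open>finite_gauss_identity\<close> over formal power series, all terms with
  \<open>j \<ge> 1\<close> are divisible by \<open>fps_X ^ (N + 1)\<close>. Up to degree
  \<open>N\<close> the theta polynomial is therefore the exact reciprocal of the generating
  function, and the coefficient of degree \<open>n\<close> is compared.\<close>

lemma overpart_recurrence:
  assumes "n \<le> N"
  shows "int (overpart n) + 2 * (\<Sum>j=1..N. if j\<^sup>2 \<le> n then (-1) ^ j * int (overpart (n - j\<^sup>2)) else 0)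
     = (if n = 0 then 1 else 0)"
proof -
  define P :: "rat fps" where "P = Abs_fps (\<lambda>n. of_nat (opart_le N n))"
  define c :: "nat \<Rightarrow> rat fps" where "c k = inverse (1 + fps_X ^ k)" for k
  define R :: "nat \<Rightarrow> rat fps" where "R j = (\<Prod>k=Suc j..N. (1 - fps_X ^ k) * c k)" for j
  have c: "(1 + fps_X ^ k) * c k = 1" for k
    unfolding c_def by (rule inverse_mult_eq_1') (cases k; simp)
  have PR: "P * R 0 = 1"
    using opart_le_fps[of N] by (simp add: P_def R_def c_def)
  have "P * (1 + 2 * (\<Sum>j=1..N. (-1) ^ j * fps_X ^ j\<^sup>2)) =
        P * (\<Sum>j=0..N. (-1) ^ j * 2 * c j * fps_X ^ (j * (N + 1)) * R j)"
    unfolding R_def by (subst finite_gauss_identity[OF c]) simp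
  also have "\<dots> = P * (2 * c 0 * R 0 + (\<Sum>j=1..N. (-1) ^ j * 2 * c j * fps_X ^ (j * (N + 1)) * R j))"
    by (subst sum.atLeast_Suc_atMost) simp_all
  also have "2 * c 0 = 1" using c[of 0] by simp
  also have "(\<Sum>j=1..N. (-1) ^ j * 2 * c j * fps_X ^ (j * (N + 1)) * R j) =
      fps_X ^ (N + 1) * (\<Sum>j=1..N. (-1) ^ j * 2 * c j * fps_X ^ ((j - 1) * (N + 1)) * R j)"
    unfolding sum_distrib_left
  proof (rule sum.cong, goal_cases)
    case (2 j)
    hence "j * (N + 1) = (N + 1) + (j - 1) * (N + 1)" by (cases j) auto
    thus ?case by (simp only: power_add mult_ac)
  qed simp
  also have "P * (1 * R 0 + fps_X ^ (N + 1) * (\<Sum>j=1..N. (-1) ^ j * 2 * c j * fps_X ^ ((j - 1) * (N + 1)) * R j))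
     = 1 + fps_X ^ (N + 1) * (P * (\<Sum>j=1..N. (-1) ^ j * 2 * c j * fps_X ^ ((j - 1) * (N + 1)) * R j))"
    unfolding distrib_left mult_1_left PR by (simp only: mult.left_commute)
  finally have "fps_nth (P * (1 + 2 * (\<Sum>j=1..N. (-1) ^ j * fps_X ^ j\<^sup>2))) n = (if n = 0 then 1 else 0)"
    using assms by (simp add: fps_X_power_mult_nth del: power_Suc)
  moreover have "P * (1 + 2 * (\<Sum>j=1..N. (-1) ^ j * fps_X ^ j\<^sup>2)) =
      P + 2 * (\<Sum>j=1..N. fps_const ((-1) ^ j) * (fps_X ^ j\<^sup>2 * P))"
  proof -
    have "(-1 :: rat fps) ^ j = fps_const ((-1) ^ j)" for j :: nat
      by (metis fps_const_1_eq_1 fps_const_neg fps_const_power)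
    thus ?thesis by (simp only: distrib_left sum_distrib_left mult_1_right mult_1_left mult_ac)
  qed
  moreover have "fps_nth (P + 2 * (\<Sum>j=1..N. fps_const ((-1) ^ j) * (fps_X ^ j\<^sup>2 * P))) n =
     of_int (int (overpart n) + 2 * (\<Sum>j=1..N. if j\<^sup>2 \<le> n then (-1) ^ j * int (overpart (n - j\<^sup>2)) else 0))"
  proof -
    have "fps_nth (P + 2 * (\<Sum>j=1..N. fps_const ((-1) ^ j) * (fps_X ^ j\<^sup>2 * P))) n =
        fps_nth P n + 2 * (\<Sum>j=1..N. (-1) ^ j * fps_nth (fps_X ^ j\<^sup>2 * P) n)"
      by (simp add: fps_sum_nth numeral_fps_const)
    also have "(\<Sum>j=1..N. (-1) ^ j * fps_nth (fps_X ^ j\<^sup>2 * P) n) =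
        (\<Sum>j=1..N. of_int (if j\<^sup>2 \<le> n then (-1) ^ j * int (overpart (n - j\<^sup>2)) else 0))"
      using assms by (intro sum.cong refl)
        (auto simp: fps_X_power_mult_nth P_def overpart_eq_opart_le[of "n - _" N])
    finally show ?thesis using assms by (simp add: P_def overpart_eq_opart_le[of n N])
  qed
  ultimately have "(of_int (int (overpart n) + 2 * (\<Sum>j=1..N. if j\<^sup>2 \<le> n then (-1) ^ j * int (overpart (n - j\<^sup>2)) else 0)) :: rat)
    = of_int (if n = 0 then 1 else 0)" by simp
  thus ?thesis unfolding of_int_eq_iff .
qed

section \<open>The contour integral\<close>

text \<open>An unscaled error function. It exists because an entire function has a primitive;
  oddness is enforced by antisymmetrizing, and the limit is the Gaussian integral over the half
  line.\<close>

lemma gaussian_primitive: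
  obtains E :: "real \<Rightarrow> real" where
    "\<And>x. (E has_real_derivative exp (- x\<^sup>2)) (at x)" "\<And>x. E (- x) = - E x" "(E \<longlongrightarrow> sqrt pi / 2) at_top"
proof -
  have "(\<lambda>z :: complex. exp (- z\<^sup>2)) holomorphic_on UNIV" by (intro holomorphic_intros)
  hence "\<exists>F. \<forall>z :: complex. (F has_field_derivative exp (- z\<^sup>2)) (at z)"
    by (rule holomorphic_convex_primitive'[OF convex_UNIV open_UNIV]) auto
  then obtain F :: "complex \<Rightarrow> complex" where F: "\<And>z. (F has_field_derivative exp (- z\<^sup>2)) (at z)"
    by blast
  define E0 where "E0 x = Re (F (of_real x))" for x
  have E0: "(E0 has_real_derivative exp (- x\<^sup>2)) (at x)" for x
  proof -
    have "((\<lambda>x. F (of_real x)) has_vector_derivative exp (- (of_real x)\<^sup>2)) (at x)"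
      by (rule has_vector_derivative_real_field[OF F])
    from bounded_linear.has_vector_derivative[OF bounded_linear_Re this]
    have "(E0 has_vector_derivative Re (exp (- (of_real x)\<^sup>2))) (at x)" unfolding E0_def .
    moreover have "exp (- (of_real x)\<^sup>2) = (of_real (exp (- x\<^sup>2)) :: complex)"
      by (simp only: of_real_minus [symmetric] of_real_power [symmetric] exp_of_real)
    ultimately show ?thesis unfolding has_real_derivative_iff_has_vector_derivative by simp
  qed
  define E where "E x = (E0 x - E0 (- x)) / 2" for x
  have E: "(E has_real_derivative exp (- x\<^sup>2)) (at x)" for x
  proof -
    have "((\<lambda>x. E0 (- x)) has_real_derivative exp (- (- x)\<^sup>2) * (-1)) (at x)"
      by (rule DERIV_chain2[OF E0]) (auto intro!: derivative_eq_intros)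
    from DERIV_cdivide[OF DERIV_diff[OF E0 this], of 2] show ?thesis unfolding E_def by simp
  qed
  have E00: "E 0 = 0" by (simp add: E_def)
  define g :: "real \<Rightarrow> real" where "g x = indicator {0..} x *\<^sub>R exp (- x\<^sup>2)" for x
  have g: "integrable lborel g" "integral\<^sup>L lborel g = sqrt pi / 2"
    using gaussian_moment_0 unfolding g_def by (auto simp: has_bochner_integral_iff)
  have "((\<lambda>y. \<integral>x. indicator {..y} x *\<^sub>R g x \<partial>lborel) \<longlongrightarrow> sqrt pi / 2) at_top"
    unfolding g(2) [symmetric] by (rule tendsto_integral_at_top[OF _ g(1)]) simp
  moreover have "\<forall>\<^sub>F y in at_top. (\<integral>x. indicator {..y} x *\<^sub>R g x \<partial>lborel) = E y"
    using eventually_ge_at_top[of 0]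
  proof eventually_elim
    case (elim y)
    have "(\<integral>x. indicator {..y} x *\<^sub>R g x \<partial>lborel) = (\<integral>x. exp (- x\<^sup>2) * indicator {0..y} x \<partial>lborel)"
      by (rule Bochner_Integration.integral_cong) (auto simp: g_def indicator_def)
    also have "\<dots> = E y - E 0"
      using elim E by (intro integral_FTC_Icc_real) (auto intro!: continuous_intros)
    finally show ?case by (simp add: E00)
  qed
  ultimately have "(E \<longlongrightarrow> sqrt pi / 2) at_top" by (rule Lim_transform_eventually)
  moreover have "E (- x) = - E x" for x by (simp add: E_def diff_divide_distrib)
  ultimately show ?thesis using E by (intro that[of E])
qed

text \<open>The lower bound holds because \<open>E x + exp (- x\<^sup>2) / (2 * x)\<close> decreases
  to the same limit.\<close>

lemma gaussian_primitive_bounds: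
  fixes E :: "real \<Rightarrow> real"
  assumes E: "\<And>x. (E has_real_derivative exp (- x\<^sup>2)) (at x)" and lim: "(E \<longlongrightarrow> sqrt pi / 2) at_top"
    and x: "x > 0"
  shows "E x \<le> sqrt pi / 2" "sqrt pi / 2 - exp (- x\<^sup>2) / (2 * x) \<le> E x"
proof -
  show "E x \<le> sqrt pi / 2"
  proof (rule tendsto_lowerbound[OF lim])
    show "\<forall>\<^sub>F y in at_top. E x \<le> E y"
      using eventually_ge_at_top[of x]
    proof eventually_elim
      case (elim y)
      show ?case by (rule DERIV_nonneg_imp_nondecreasing[OF elim]) (use E in force)
    qed
  qed simp
  define T where "T y = E y + exp (- y\<^sup>2) / (2 * y)" for y
  have "((\<lambda>y::real. exp (- y\<^sup>2) / (2 * y)) \<longlongrightarrow> 0) at_top" by real_asymp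
  from tendsto_add[OF lim this] have limT: "(T \<longlongrightarrow> sqrt pi / 2) at_top" by (simp add: T_def[abs_def])
  have "sqrt pi / 2 \<le> T x"
  proof (rule tendsto_upperbound[OF limT])
    show "\<forall>\<^sub>F y in at_top. T y \<le> T x"
      using eventually_ge_at_top[of x]
    proof eventually_elim
      case (elim y)
      show ?case
      proof (rule DERIV_nonpos_imp_nonincreasing[OF elim])
        fix z assume z: "x \<le> z" "z \<le> y"
        hence z0: "z > 0" using x by simp
        have "(T has_real_derivative - exp (- z\<^sup>2) / (2 * z\<^sup>2)) (at z)"
          unfolding T_def using z0
          by (auto intro!: derivative_eq_intros E simp: field_simps power2_eq_square)
        thus "\<exists>d. (T has_real_derivative d) (at z) \<and> d \<le> 0" by force
      qed
    qed
  qed simp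
  thus "sqrt pi / 2 - exp (- x\<^sup>2) / (2 * x) \<le> E x" by (simp add: T_def)
qed

text \<open>This replaces Cauchy's formula. Integrating the series termwise gives exponentials of
  period \<open>2 * i\<close>, except for the index \<open>n\<close>, whose term is constant and has
  a linear primitive. The increment of \<open>H\<close> over a period thus isolates
  \<open>overpart n\<close>, and mean value estimates for \<open>H\<close> take the place of path
  integrals.\<close>

lemma overpart_contour_primitive:
  fixes n :: nat
  obtains H where
    "\<And>s. Re s > 0 \<Longrightarrow> (H has_field_derivative (opart_gf (exp (- (of_real pi * s))) * exp (of_real pi * of_nat n * s))) (at s)"
    "\<And>s. H (s + 2 * \<i>) = H s + 2 * \<i> * of_nat (overpart n)"
proof -
  \<comment> \<open>The value 0 at \<open>m = n\<close> removes the resonant term, which enters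
    \<open>H\<close> separately as \<open>of_nat (overpart n) * s\<close>.\<close>
  define c where "c m = (if m = n then 0 else of_nat (overpart m) / (of_real pi * (of_nat n - of_nat m)) :: complex)" for m
  define K where "K q = (\<Sum>m. c m * q ^ m)" for q
  define K' where "K' q = (\<Sum>m. diffs c m * q ^ m)" for q
  define e where "e s = exp (of_real pi * of_nat n * s)" for s :: complex
  define Q where "Q s = exp (- (of_real pi * s))" for s :: complex
  have nc: "norm (c m) \<le> real (overpart m)" for m
  proof (cases "m = n")
    case False
    have "1 \<le> \<bar>real n - real m\<bar>" using False by (cases "m < n") auto
    hence "1 * 1 \<le> pi * \<bar>real n - real m\<bar>" using pi_ge_two by (intro mult_mono) auto
    moreover have "norm (of_real pi * (of_nat n - of_nat m) :: complex) = pi * \<bar>real n - real m\<bar>"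
    proof -
      have "(of_nat n - of_nat m :: complex) = of_real (real n - real m)" by simp
      thus ?thesis by (simp only: norm_mult norm_of_real) simp
    qed
    moreover have "norm (c m) = real (overpart m) / norm (of_real pi * (of_nat n - of_nat m) :: complex)"
      using False by (simp only: c_def if_False norm_divide norm_of_nat)
    moreover have "real (overpart m) / (pi * \<bar>real n - real m\<bar>) \<le> real (overpart m) / 1"
      using calculation(1) by (intro divide_left_mono) auto
    ultimately show ?thesis by simp
  qed (simp add: c_def)
  have smc: "summable (\<lambda>m. c m * q ^ m)" if "norm q < 1" for q
  proof (rule summable_comparison_test')
    show "summable (\<lambda>m. real (overpart m) * norm q ^ m)"
      using summable_overpart_real[of "norm q"] that by simp
    show "norm (c m * q ^ m) \<le> real (overpart m) * norm q ^ m" for m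
      unfolding norm_mult norm_power by (intro mult_right_mono nc) auto
  qed
  have dK: "(K has_field_derivative K' q) (at q)" if "norm q < 1" for q
    unfolding K_def K'_def by (rule termdiffs_strong'[OF smc that])
  have K'q: "(\<lambda>m. of_nat m * c m * q ^ m) sums (q * K' q)" if "norm q < 1" for q
  proof -
    have "summable (\<lambda>m. diffs c m * q ^ m)"
      by (rule termdiff_converges[OF that]) (use smc in auto)
    from sums_mult[OF diffs_equiv[OF this], of q]
    have "(\<lambda>m. q * (of_nat m * c m * q ^ (m - Suc 0))) sums (q * K' q)" by (simp add: K'_def)
    also have "(\<lambda>m. q * (of_nat m * c m * q ^ (m - Suc 0))) = (\<lambda>m. of_nat m * c m * q ^ m)"
      by (rule ext) (case_tac m; simp)
    finally show ?thesis .
  qed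
  define H where "H s = of_nat (overpart n) * s + e s * K (Q s)" for s
  show ?thesis
  proof (rule that[of H])
    fix s :: complex assume s: "Re s > 0"
    have q: "norm (Q s) < 1" using s by (simp add: Q_def)
    define q where "q = Q s"
    note q = q[folded q_def]
    have dQ: "(Q has_field_derivative - of_real pi * Q s) (at s)"
      unfolding Q_def by (auto intro!: derivative_eq_intros)
    have de: "(e has_field_derivative of_real pi * of_nat n * e s) (at s)"
      unfolding e_def by (auto intro!: derivative_eq_intros)
    have dKQ: "((\<lambda>s. K (Q s)) has_field_derivative K' q * (- of_real pi * Q s)) (at s)"
      using DERIV_chain2[OF dK[OF q, unfolded q_def] dQ] by (simp add: q_def)
    have "(H has_field_derivative (of_nat (overpart n) + (of_real pi * of_nat n * e s * K (Q s) + K' q * (- of_real pi * Q s) * e s))) (at s)"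
      unfolding H_def by (auto intro!: derivative_eq_intros de dKQ)
    moreover have "of_nat (overpart n) + (of_real pi * of_nat n * e s * K (Q s) + K' q * (- of_real pi * Q s) * e s) = opart_gf q * e s"
    proof -
      have "(\<lambda>m. of_real pi * of_nat n * (c m * q ^ m)) sums (of_real pi * of_nat n * K q)"
        unfolding K_def by (intro sums_mult summable_sums smc q)
      moreover have "(\<lambda>m. of_real pi * (of_nat m * c m * q ^ m)) sums (of_real pi * (q * K' q))"
        by (intro sums_mult K'q q)
      moreover have "(\<lambda>m. if m = n then of_nat (overpart n) * q ^ n else 0) sums (of_nat (overpart n) * q ^ n)"
        by (rule sums_single)
      ultimately have "(\<lambda>m. of_real pi * of_nat n * (c m * q ^ m) - of_real pi * (of_nat m * c m * q ^ m) + (if m = n then of_nat (overpart n) * q ^ n else 0))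
          sums (of_real pi * of_nat n * K q - of_real pi * (q * K' q) + of_nat (overpart n) * q ^ n)"
        by (intro sums_add sums_diff)
      also have "(\<lambda>m. of_real pi * of_nat n * (c m * q ^ m) - of_real pi * (of_nat m * c m * q ^ m) + (if m = n then of_nat (overpart n) * q ^ n else 0))
          = (\<lambda>m. of_nat (overpart m) * q ^ m)"
      proof
        fix m
        show "of_real pi * of_nat n * (c m * q ^ m) - of_real pi * (of_nat m * c m * q ^ m) + (if m = n then of_nat (overpart n) * q ^ n else 0)
          = of_nat (overpart m) * q ^ m"
        proof (cases "m = n")
          case False
          hence "of_real pi * (of_nat n - of_nat m) \<noteq> (0 :: complex)" by simp
          hence "(of_real pi * (of_nat n - of_nat m)) * c m = of_nat (overpart m)"
            using False by (simp add: c_def)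
          thus ?thesis using False by (simp add: algebra_simps) (metis (no_types, lifting) distrib_left mult.assoc mult.commute)
        qed (simp add: c_def)
      qed
      finally have gf: "opart_gf q = of_real pi * of_nat n * K q - of_real pi * (q * K' q) + of_nat (overpart n) * q ^ n"
        unfolding opart_gf_def by (rule sums_unique [symmetric])
      have "q ^ n * e s = exp (of_nat n * (- (of_real pi * s))) * e s"
        by (simp only: q_def Q_def exp_of_nat_mult)
      also have "\<dots> = 1" unfolding e_def exp_add [symmetric] by (simp add: algebra_simps)
      finally have one: "q ^ n * e s = 1" .
      have "opart_gf q * e s = (of_real pi * of_nat n * K q - of_real pi * (q * K' q)) * e s + of_nat (overpart n) * (q ^ n * e s)"
        unfolding gf by (simp add: algebra_simps)
      thus ?thesis unfolding one by (simp add: q_def algebra_simps)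
    qed
    ultimately show "(H has_field_derivative (opart_gf (exp (- (of_real pi * s))) * exp (of_real pi * of_nat n * s))) (at s)"
      by (simp add: q_def Q_def e_def)
  next
    fix s :: complex
    have "Q (s + 2 * \<i>) = Q s"
    proof -
      have "- (of_real pi * (s + 2 * \<i>)) = - (of_real pi * s) - 2 * of_real pi * \<i>" by (simp add: algebra_simps)
      thus ?thesis by (simp add: Q_def exp_diff)
    qed
    moreover have "e (s + 2 * \<i>) = e s"
    proof -
      have "of_real pi * of_nat n * (s + 2 * \<i>) = of_real pi * of_nat n * s + of_int (2 * int n) * pi * \<i>" by (simp add: algebra_simps)
      thus ?thesis using exp_integer_2pi[of "of_nat n"] by (simp add: e_def exp_add mult_ac)
    qed
    ultimately show "H (s + 2 * \<i>) = H s + 2 * \<i> * of_nat (overpart n)"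
      by (simp add: H_def algebra_simps)
  qed
qed

text \<open>Relative to the leading term, the dual theta series has the terms
  \<open>w ^ (k * (k + 1))\<close> with \<open>w = exp (- (of_real pi / s))\<close>. The first
  correction is the square of \<open>w\<close>, whence the exponent \<open>- 2 * pi * c\<close>; the
  coefficient 4 covers the geometric tail and the passage to the reciprocal.\<close>

lemma opart_gf_near_one:
  fixes s :: complex
  assumes c: "Re (1 / s) \<ge> c" "c \<ge> 1"
  obtains \<epsilon> where "opart_gf (exp (- (of_real pi * s))) = csqrt s / 2 * exp (of_real pi / (4 * s)) * (1 + \<epsilon>)"
    "norm \<epsilon> \<le> 4 * exp (- 2 * pi * c)"
proof -
  have s0: "s \<noteq> 0" using c by auto
  have "Re s = Re (1 / s) * (norm s)\<^sup>2"
    using s0 by (simp add: Re_divide cmod_power2 [symmetric])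
  moreover have "(norm s)\<^sup>2 > 0" using s0 by simp
  moreover have "Re (1 / s) > 0" using c by linarith
  ultimately have s: "Re s > 0" by simp
  define t where "t k = exp (- (of_real pi * (2 * of_nat k + 1)\<^sup>2 / (4 * s)))" for k :: nat
  define w where "w = exp (- (of_real pi / s))"
  define \<rho> where "\<rho> = norm w"
  have "Re (of_real pi / s) = pi * Re (1 / s)"
  proof -
    have "of_real pi / s = of_real pi * (1 / s)" by simp
    thus ?thesis by (simp only: times_complex.simps Re_complex_of_real Im_complex_of_real)
  qed
  hence \<rho>: "\<rho> = exp (- (pi * Re (1 / s)))" by (simp add: \<rho>_def w_def)
  hence \<rho>le: "\<rho> \<le> exp (- (pi * c))" using c by simp
  have \<rho>0: "\<rho> > 0" by (simp add: \<rho>)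
  have "exp (- (pi * c)) \<le> exp (- 3)" using c pi_gt3 mult_mono[of 3 pi 1 c] by simp
  also have "exp (- 3 :: real) \<le> 1 / 4"
    using exp_ge_add_one_self[of 3] by (simp add: exp_minus field_simps)
  finally have \<rho>4: "\<rho> \<le> 1 / 4" using \<rho>le by linarith
  have t: "t k = exp (- (of_real pi / (4 * s))) * w ^ (k * (k + 1))" for k
  proof -
    have "- (of_real pi * (2 * of_nat k + 1)\<^sup>2 / (4 * s)) = - (of_real pi / (4 * s)) + of_nat (k * (k + 1)) * (- (of_real pi / s))"
      using s0 by (simp add: field_simps power2_eq_square)
    thus ?thesis unfolding t_def w_def by (simp only: exp_add exp_of_nat_mult)
  qed
  have wb: "norm (w ^ (k * (k + 1))) \<le> \<rho> ^ k" for k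
    unfolding norm_power \<rho>_def [symmetric] using \<rho>0 \<rho>4 by (intro power_decreasing) auto
  have smw: "summable (\<lambda>k. w ^ (k * (k + 1)))"
    by (rule summable_comparison_test'[of "\<lambda>k. \<rho> ^ k" 0]) (use \<rho>0 \<rho>4 wb in auto)
  define \<eta> where "\<eta> = (\<Sum>k. w ^ (Suc k * (Suc k + 1)))"
  have sm1: "summable (\<lambda>k. w ^ (Suc k * (Suc k + 1)))"
    using smw by (subst summable_Suc_iff)
  have "(\<Sum>k. w ^ (k * (k + 1))) = 1 + \<eta>"
    unfolding \<eta>_def using suminf_split_head[OF smw] by simp
  hence sumt: "(\<Sum>k. t k) = exp (- (of_real pi / (4 * s))) * (1 + \<eta>)"
    unfolding t using suminf_mult[OF smw] by simp
  have \<eta>: "norm \<eta> \<le> 2 * \<rho>\<^sup>2"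
  proof -
    have b: "norm (w ^ (Suc k * (Suc k + 1))) \<le> \<rho>\<^sup>2 * \<rho> ^ k" for k
    proof -
      have "norm (w ^ (Suc k * (Suc k + 1))) \<le> \<rho> ^ (2 + k)"
        unfolding norm_power \<rho>_def [symmetric] using \<rho>0 \<rho>4 by (intro power_decreasing) auto
      thus ?thesis by (simp only: power_add)
    qed
    have g: "summable (\<lambda>k. \<rho>\<^sup>2 * \<rho> ^ k)" using \<rho>0 \<rho>4 by (intro summable_mult) auto
    have "norm \<eta> \<le> (\<Sum>k. \<rho>\<^sup>2 * \<rho> ^ k)"
      unfolding \<eta>_def by (rule norm_suminf_le[OF b g])
    also have "\<dots> = \<rho>\<^sup>2 * (1 / (1 - \<rho>))"
      using \<rho>0 \<rho>4 by (subst suminf_mult) (auto simp: suminf_geometric)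
    also have "\<dots> \<le> \<rho>\<^sup>2 * 2" using \<rho>4 by (intro mult_left_mono) (auto simp: field_simps)
    finally show ?thesis by simp
  qed
  have "\<rho>\<^sup>2 \<le> (1 / 4)\<^sup>2" using \<rho>0 \<rho>4 by (intro power_mono) auto
  hence \<eta>2: "norm \<eta> \<le> 1 / 2" using \<eta> by (simp add: power2_eq_square)
  hence \<eta>1: "norm (1 + \<eta>) \<ge> 1 / 2" using norm_diff_ineq[of 1 \<eta>] by simp
  hence \<eta>n: "1 + \<eta> \<noteq> 0" by auto
  define \<epsilon> where "\<epsilon> = - \<eta> / (1 + \<eta>)"
  have "norm \<epsilon> \<le> (2 * \<rho>\<^sup>2) / (1 / 2)"
    unfolding \<epsilon>_def norm_divide norm_minus_cancel using \<eta> \<eta>1 by (intro frac_le) auto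
  also have "\<dots> \<le> 4 * (exp (- (pi * c)))\<^sup>2" using \<rho>0 \<rho>le by (simp add: power_mono)
  also have "\<dots> = 4 * exp (- 2 * pi * c)" by (simp add: exp_double [symmetric])
  finally have \<epsilon>: "norm \<epsilon> \<le> 4 * exp (- 2 * pi * c)" .
  have cs: "csqrt s \<noteq> 0" using s0 by simp
  have "opart_gf (exp (- (of_real pi * s))) * theta4 (exp (- (of_real pi * s))) = 1"
    by (rule opart_gf_theta4) (use s in simp)
  hence XY: "opart_gf (exp (- (of_real pi * s))) * (2 / csqrt s * (exp (- (of_real pi / (4 * s))) * (1 + \<eta>))) = 1"
    unfolding theta4_transformation[OF s] sumt[unfolded t_def] .
  have "(2 / csqrt s * (exp (- (of_real pi / (4 * s))) * (1 + \<eta>))) * (csqrt s / 2 * exp (of_real pi / (4 * s)) * (1 / (1 + \<eta>)))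
      = exp (- (of_real pi / (4 * s))) * exp (of_real pi / (4 * s))"
  proof -
    have "(2 / c * (a * u)) * (c / 2 * b * (1 / u)) = a * b" if "c \<noteq> 0" "u \<noteq> 0" for a b c u :: complex
      using that by simp
    thus ?thesis using cs \<eta>n .
  qed
  also have "\<dots> = 1" unfolding exp_add [symmetric] by simp
  finally have YZ: "(2 / csqrt s * (exp (- (of_real pi / (4 * s))) * (1 + \<eta>))) * (csqrt s / 2 * exp (of_real pi / (4 * s)) * (1 / (1 + \<eta>))) = 1" .
  have "X = Z" if "X * Y = 1" "Y * Z = 1" for X Y Z :: complex
  proof -
    have "X = X * (Y * Z)" using that(2) by simp
    also have "\<dots> = Z" using that(1) by (simp add: mult.assoc [symmetric])
    finally show ?thesis .
  qed
  from this[OF XY YZ]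
  have "opart_gf (exp (- (of_real pi * s))) = csqrt s / 2 * exp (of_real pi / (4 * s)) * (1 / (1 + \<eta>))" .
  also have "1 / (1 + \<eta>) = 1 + \<epsilon>" using \<eta>n by (simp add: \<epsilon>_def field_simps)
  finally show ?thesis using that \<epsilon> by blast
qed

text \<open>\<open>main\<close> is the full Gaussian integral in
  \<open>v = sin (\<phi> / 2)\<close>. The first error term is the price of stopping at
  \<open>v = 1 / 2\<close> and \<open>v = - 1 / 2\<close>, the second one that of the smaller terms
  of the theta series.\<close>

lemma arc_integral_bound:
  fixes H :: "complex \<Rightarrow> complex" and n :: nat
  assumes n: "n > 0"
    and H: "\<And>s. Re s > 0 \<Longrightarrow> (H has_field_derivative (opart_gf (exp (- (of_real pi * s))) * exp (of_real pi * of_nat n * s))) (at s)"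
  defines "\<mu> \<equiv> pi * sqrt (real n)" and "\<sigma> \<equiv> 1 / (2 * sqrt (real n))"
  defines "main \<equiv> \<sigma> * sqrt \<sigma> * exp \<mu> * ((1 - 1 / \<mu>) * sqrt (pi / (2 * \<mu>)))"
  shows "\<bar>Im (H (of_real \<sigma> * cis (pi / 3)) - H (of_real \<sigma> * cis (- pi / 3))) - main\<bar> \<le>
    \<sigma> * sqrt \<sigma> * (exp (\<mu> / 2) / \<mu> + 5 * exp (- \<mu>))"
proof -
  define \<nu> where "\<nu> = sqrt (real n)"
  have \<nu>: "\<nu> \<ge> 1" "\<nu>\<^sup>2 = real n" using n by (auto simp: \<nu>_def)
  have \<mu>: "\<mu> = pi * \<nu>" "\<mu> > 3" using \<nu> pi_gt3 mult_mono[of 3 pi 1 \<nu>] unfolding \<mu>_def \<nu>_def [symmetric]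
    by (auto simp: less_le_trans mult_le_cancel_left1 intro: less_le_trans[of 3 pi])
  have \<sigma>: "\<sigma> = 1 / (2 * \<nu>)" "\<sigma> > 0" using \<nu> by (auto simp: \<sigma>_def \<nu>_def)
  obtain E :: "real \<Rightarrow> real" where E: "\<And>x. (E has_real_derivative exp (- x\<^sup>2)) (at x)"
    and Eodd: "\<And>x. E (- x) = - E x" and Elim: "(E \<longlongrightarrow> sqrt pi / 2) at_top"
    using gaussian_primitive by blast
  define a where "a = sqrt (2 * \<mu>)"
  have a: "a > 0" "a\<^sup>2 = 2 * \<mu>" using \<mu> by (auto simp: a_def)
  \<comment> \<open>Primitive for the main part in the variable \<open>v\<close>. Writing
    \<open>1 - 4 * v\<^sup>2\<close> as
    \<open>(1 - 1 / \<mu>) + (1 / \<mu>) * (1 - 4 * \<mu> * v\<^sup>2)\<close> separates a pure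
    Gaussian from the derivative of \<open>v * exp (- 2 * \<mu> * v\<^sup>2)\<close>.\<close>
  define W where "W v = 2 * exp \<mu> * ((1 - 1 / \<mu>) * (E (a * v) / a) + (1 / \<mu>) * (v * exp (- 2 * \<mu> * v\<^sup>2)))" for v
  have dW: "(W has_real_derivative 2 * exp \<mu> * (1 - 4 * v\<^sup>2) * exp (- 2 * \<mu> * v\<^sup>2)) (at v)" for v
  proof -
    have dE: "((\<lambda>v. E (a * v)) has_real_derivative exp (- 2 * \<mu> * v\<^sup>2) * a) (at v)"
    proof -
      have "((\<lambda>v. E (a * v)) has_real_derivative exp (- (a * v)\<^sup>2) * a) (at v)"
        by (rule DERIV_chain2[OF E]) (auto intro!: derivative_eq_intros)
      thus ?thesis by (simp add: power_mult_distrib a)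
    qed
    have "(W has_real_derivative 2 * exp \<mu> * ((1 - 1 / \<mu>) * (exp (- 2 * \<mu> * v\<^sup>2) * a / a) +
        (1 / \<mu>) * (exp (- 2 * \<mu> * v\<^sup>2) + v * (exp (- 2 * \<mu> * v\<^sup>2) * (- 2 * \<mu> * (2 * v)))))) (at v)"
      unfolding W_def by (intro DERIV_cmult DERIV_add DERIV_cdivide dE) (auto intro!: derivative_eq_intros)
    moreover have "2 * exp \<mu> * ((1 - 1 / \<mu>) * (exp (- 2 * \<mu> * v\<^sup>2) * a / a) +
        (1 / \<mu>) * (exp (- 2 * \<mu> * v\<^sup>2) + v * (exp (- 2 * \<mu> * v\<^sup>2) * (- 2 * \<mu> * (2 * v)))))
        = 2 * exp \<mu> * (1 - 4 * v\<^sup>2) * exp (- 2 * \<mu> * v\<^sup>2)"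
    proof -
      have "\<mu> \<noteq> 0" using \<mu>(2) by linarith
      thus ?thesis using a(1) by (simp add: field_simps power2_eq_square)
    qed
    ultimately show ?thesis by (simp only:)
  qed
  define P where "P = \<sigma> * sqrt \<sigma> / 2"
  have P: "P > 0" using \<sigma> by (simp add: P_def)
  define h where "h \<phi> = H (of_real \<sigma> * cis \<phi>)" for \<phi>
  define B where "B = 4 * P * exp (- \<mu>)"
  define \<Delta> where "\<Delta> \<phi> = Im (h \<phi>) - P * W (sin (\<phi> / 2))" for \<phi>
  have d\<Delta>: "\<exists>D. (\<Delta> has_real_derivative D) (at \<phi>) \<and> \<bar>D\<bar> \<le> B" if \<phi>: "- (pi / 3) \<le> \<phi>" "\<phi> \<le> pi / 3" for \<phi>
  proof -
    define s where "s = of_real \<sigma> * cis \<phi>"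
    \<comment> \<open>The half-angle \<open>pi / 3\<close> is used here: it keeps
      \<open>Re (1 / s)\<close> at least \<open>\<nu>\<close>, so the relative error of the leading
      term is at most \<open>4 * exp (- 2 * \<mu>)\<close> on the whole arc, which still beats the
      size \<open>exp \<mu>\<close> of the integrand.\<close>
    have "cos (pi / 3) \<le> cos \<bar>\<phi>\<bar>" using \<phi> by (intro cos_monotone_0_pi_le) auto
    hence cos: "cos \<phi> \<ge> 1 / 2" by (simp add: cos_60)
    have s: "Re s > 0" using cos \<sigma> by (simp add: s_def)
    have s0: "s \<noteq> 0" using s by auto
    have invs: "1 / s = of_real (2 * \<nu>) * cis (- \<phi>)"
      using \<nu> by (simp add: s_def \<sigma> divide_simps cis_mult)
    have "Re (1 / s) = 2 * \<nu> * cos \<phi>" unfolding invs by simp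
    hence "Re (1 / s) \<ge> \<nu>" using cos \<nu> mult_left_mono[of "1 / 2" "cos \<phi>" "2 * \<nu>"] by simp
    from opart_gf_near_one[OF this \<nu>(1)] obtain \<epsilon> where
      gf: "opart_gf (exp (- (of_real pi * s))) = csqrt s / 2 * exp (of_real pi / (4 * s)) * (1 + \<epsilon>)"
      and \<epsilon>: "norm \<epsilon> \<le> 4 * exp (- 2 * pi * \<nu>)" by blast
    have half: "\<bar>\<phi> / 2\<bar> < pi / 2" unfolding abs_less_iff using \<phi> pi_gt_zero by (intro conjI; linarith)
    have csq: "csqrt s = of_real (sqrt \<sigma>) * cis (\<phi> / 2)"
    proof (rule csqrt_unique)
      show "(of_real (sqrt \<sigma>) * cis (\<phi> / 2))\<^sup>2 = s"
        using \<sigma> by (simp add: power_mult_distrib s_def Complex.DeMoivre flip: of_real_power)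
      have "cos (\<phi> / 2) > 0" using half by (intro cos_gt_zero_pi) (auto simp: abs_less_iff)
      thus "0 < Re (of_real (sqrt \<sigma>) * cis (\<phi> / 2)) \<or>
          Re (of_real (sqrt \<sigma>) * cis (\<phi> / 2)) = 0 \<and> 0 \<le> Im (of_real (sqrt \<sigma>) * cis (\<phi> / 2))"
        using \<sigma> by simp
    qed
    \<comment> \<open>The radius \<open>1 / (2 * \<nu>)\<close> gives both exponents the modulus
      \<open>\<mu> / 2\<close> and opposite arguments.\<close>
    have ex: "of_real pi / (4 * s) + of_real pi * of_nat n * s = of_real (\<mu> * cos \<phi>)"
    proof -
      have "of_real pi / (4 * s) = of_real (pi / 4) * (1 / s)" by simp
      also have "\<dots> = of_real (\<mu> / 2) * cis (- \<phi>)" unfolding invs by (simp add: \<mu>)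
      moreover have "of_real pi * of_nat n * s = of_real (\<mu> / 2) * cis \<phi>"
      proof -
        have "pi * real n * \<sigma> = \<mu> / 2"
          using \<nu> by (simp add: \<sigma> \<mu> \<nu>(2) [symmetric] power2_eq_square)
        moreover have "of_real pi * of_nat n * s = of_real (pi * real n * \<sigma>) * cis \<phi>"
          by (simp add: s_def mult.assoc)
        ultimately show ?thesis by (simp only:)
      qed
      ultimately have "of_real pi / (4 * s) + of_real pi * of_nat n * s = of_real (\<mu> / 2) * (cis (- \<phi>) + cis \<phi>)"
        by (simp only: distrib_left)
      also have "cis (- \<phi>) + cis \<phi> = of_real (2 * cos \<phi>)" by (simp add: complex_eq_iff)
      finally show ?thesis by simp
    qed
    define M where "M = of_real (P * exp (\<mu> * cos \<phi>)) * (\<i> * cis (3 * \<phi> / 2))"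
    have Gs: "opart_gf (exp (- (of_real pi * s))) * exp (of_real pi * of_nat n * s) * (of_real \<sigma> * (\<i> * cis \<phi>)) = M * (1 + \<epsilon>)"
    proof -
      have "exp (of_real pi / (4 * s)) * exp (of_real pi * of_nat n * s) = of_real (exp (\<mu> * cos \<phi>))"
        unfolding exp_add [symmetric] ex by (simp only: exp_of_real)
      moreover have "cis (3 * \<phi> / 2) = cis (\<phi> / 2) * cis \<phi>" by (simp add: cis_mult)
      ultimately show ?thesis
        unfolding gf csq M_def by (simp add: P_def mult_ac)
    qed
    have "(cis has_vector_derivative \<i> * cis \<phi>) (at \<phi>)"
    proof -
      have "((\<lambda>z. exp (\<i> * z)) has_field_derivative \<i> * exp (\<i> * of_real \<phi>)) (at (of_real \<phi>))"
        by (auto intro!: derivative_eq_intros)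
      from has_vector_derivative_real_field[OF this] show ?thesis
        by (simp add: cis_conv_exp [symmetric])
    qed
    hence "((\<lambda>\<phi>. of_real \<sigma> * cis \<phi>) has_vector_derivative of_real \<sigma> * (\<i> * cis \<phi>)) (at \<phi>)"
      by (rule has_vector_derivative_mult_right)
    from field_vector_diff_chain_at[OF this, of H] H[OF s]
    have "(h has_vector_derivative (of_real \<sigma> * (\<i> * cis \<phi>) * (opart_gf (exp (- (of_real pi * s))) * exp (of_real pi * of_nat n * s)))) (at \<phi>)"
      by (simp add: h_def[abs_def] o_def s_def)
    hence "(h has_vector_derivative M * (1 + \<epsilon>)) (at \<phi>)"
      unfolding Gs [symmetric] by (simp add: mult_ac)
    from bounded_linear.has_vector_derivative[OF bounded_linear_Im this]
    have dh: "((\<lambda>\<phi>. Im (h \<phi>)) has_real_derivative Im (M * (1 + \<epsilon>))) (at \<phi>)"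
      unfolding has_real_derivative_iff_has_vector_derivative .
    define v where "v = sin (\<phi> / 2)"
    have cosv: "cos \<phi> = 1 - 2 * v\<^sup>2"
      using cos_double_sin[of "\<phi> / 2"] by (simp add: v_def)
    have dWs: "((\<lambda>\<phi>. W (sin (\<phi> / 2))) has_real_derivative exp (\<mu> * cos \<phi>) * cos (3 * \<phi> / 2)) (at \<phi>)"
    proof -
      have "((\<lambda>\<phi>. W (sin (\<phi> / 2))) has_real_derivative (2 * exp \<mu> * (1 - 4 * v\<^sup>2) * exp (- 2 * \<mu> * v\<^sup>2)) * (cos (\<phi> / 2) / 2)) (at \<phi>)"
        unfolding v_def by (rule DERIV_chain2[OF dW]) (auto intro!: derivative_eq_intros)
      moreover have "exp \<mu> * exp (- 2 * \<mu> * v\<^sup>2) = exp (\<mu> * cos \<phi>)"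
        unfolding exp_add [symmetric] cosv by (simp add: algebra_simps)
      moreover have "cos (3 * \<phi> / 2) = cos (\<phi> / 2) * (1 - 4 * v\<^sup>2)"
      proof -
        have "3 * \<phi> / 2 = \<phi> + \<phi> / 2" by simp
        hence "cos (3 * \<phi> / 2) = cos (\<phi> + \<phi> / 2)" by (simp only:)
        also have "\<dots> = cos \<phi> * cos (\<phi> / 2) - sin \<phi> * v"
          unfolding v_def by (rule cos_add)
        also have "sin \<phi> = 2 * v * cos (\<phi> / 2)" using sin_double[of "\<phi> / 2"] by (simp add: v_def)
        finally show ?thesis unfolding cosv by (simp add: power2_eq_square algebra_simps)
      qed
      moreover have "2 * exp \<mu> * (1 - 4 * v\<^sup>2) * exp (- 2 * \<mu> * v\<^sup>2) * (cos (\<phi> / 2) / 2) =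
          (exp \<mu> * exp (- 2 * \<mu> * v\<^sup>2)) * (cos (\<phi> / 2) * (1 - 4 * v\<^sup>2))"
        by simp
      ultimately show ?thesis by (simp only:)
    qed
    have "(\<Delta> has_real_derivative (Im (M * (1 + \<epsilon>)) - P * (exp (\<mu> * cos \<phi>) * cos (3 * \<phi> / 2)))) (at \<phi>)"
      unfolding \<Delta>_def by (intro DERIV_diff dh DERIV_cmult dWs)
    also have "Im (M * (1 + \<epsilon>)) - P * (exp (\<mu> * cos \<phi>) * cos (3 * \<phi> / 2)) = Im (M * \<epsilon>)"
    proof -
      have "Im M = P * (exp (\<mu> * cos \<phi>) * cos (3 * \<phi> / 2))" by (simp add: M_def)
      moreover have "Im (M * (1 + \<epsilon>)) = Im M + Im (M * \<epsilon>)" by (simp add: algebra_simps)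
      ultimately show ?thesis by simp
    qed
    finally have "(\<Delta> has_real_derivative Im (M * \<epsilon>)) (at \<phi>)" .
    moreover have "\<bar>Im (M * \<epsilon>)\<bar> \<le> B"
    proof -
      have "\<bar>Im (M * \<epsilon>)\<bar> \<le> norm M * norm \<epsilon>"
        using abs_Im_le_cmod[of "M * \<epsilon>"] by (simp add: norm_mult)
      also have "norm M = P * exp (\<mu> * cos \<phi>)" using P by (simp add: M_def norm_mult)
      also have "P * exp (\<mu> * cos \<phi>) * norm \<epsilon> \<le> P * exp \<mu> * (4 * exp (- 2 * \<mu>))"
      proof -
        have "norm \<epsilon> \<le> 4 * exp (- 2 * \<mu>)" using \<epsilon> by (simp add: \<mu>(1) mult.assoc)
        moreover have "\<mu> * cos \<phi> \<le> \<mu>" using \<mu>(2) by (intro mult_left_le) auto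
        ultimately show ?thesis using P by (intro mult_mono) auto
      qed
      also have "\<dots> = B"
        by (simp add: B_def mult_exp_exp)
      finally show ?thesis .
    qed
    ultimately show ?thesis by blast
  qed
  have "\<bar>\<Delta> (pi / 3) - \<Delta> (- (pi / 3))\<bar> \<le> B * (pi / 3 - (- (pi / 3)))"
  proof -
    have lt: "- (pi / 3) < pi / 3" by simp
    have ex: "\<exists>D. \<forall>\<phi>. - (pi / 3) \<le> \<phi> \<longrightarrow> \<phi> \<le> pi / 3 \<longrightarrow> (\<Delta> has_real_derivative D \<phi>) (at \<phi>) \<and> \<bar>D \<phi>\<bar> \<le> B"
      using d\<Delta> by metis
    then obtain D where D: "\<And>\<phi>. - (pi / 3) \<le> \<phi> \<Longrightarrow> \<phi> \<le> pi / 3 \<Longrightarrow> (\<Delta> has_real_derivative D \<phi>) (at \<phi>) \<and> \<bar>D \<phi>\<bar> \<le> B"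
      by blast
    obtain z where z: "- (pi / 3) < z" "z < pi / 3" "\<Delta> (pi / 3) - \<Delta> (- (pi / 3)) = (pi / 3 - (- (pi / 3))) * D z"
      using MVT2[OF lt, of \<Delta> D] D by blast
    have "\<bar>D z\<bar> \<le> B" using D z by simp
    thus ?thesis unfolding z(3) abs_mult by (simp add: mult_left_mono mult.commute)
  qed
  moreover have "B * (pi / 3 - (- (pi / 3))) \<le> \<sigma> * sqrt \<sigma> * (5 * exp (- \<mu>))"
  proof -
    have "pi < 3.75" using pi_approx by simp
    hence "B * (pi / 3 - (- (pi / 3))) \<le> B * 2.5"
      using P by (intro mult_left_mono) (auto simp: B_def)
    also have "\<dots> = \<sigma> * sqrt \<sigma> * (5 * exp (- \<mu>))" by (simp add: B_def P_def)
    finally show ?thesis .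
  qed
  moreover have "\<Delta> (pi / 3) - \<Delta> (- (pi / 3)) = Im (h (pi / 3) - h (- (pi / 3))) - 2 * P * W (1 / 2)"
  proof -
    have "W (- (1 / 2)) = - W (1 / 2)" by (simp add: W_def Eodd algebra_simps)
    thus ?thesis by (simp add: \<Delta>_def sin_30 algebra_simps)
  qed
  moreover have "\<bar>2 * P * W (1 / 2) - main\<bar> \<le> \<sigma> * sqrt \<sigma> * (exp (\<mu> / 2) / \<mu>)"
  proof -
    define x where "x = a / 2"
    have x: "x > 0" "x\<^sup>2 = \<mu> / 2" using a by (auto simp: x_def power_divide)
    note Eb = gaussian_primitive_bounds[OF E Elim x(1)]
    have sq: "sqrt (pi / (2 * \<mu>)) = sqrt pi / a" by (simp add: a_def real_sqrt_divide)
    \<comment> \<open>The missing Gaussian tail. It and the boundary term of \<open>W\<close> are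
      both at most \<open>exp (- \<mu> / 2) / \<mu>\<close> and enter with opposite signs, so one
      such bound suffices for their difference.\<close>
    define \<tau> where "\<tau> = sqrt pi / a - 2 * (E x / a)"
    have \<tau>0: "\<tau> \<ge> 0" using Eb(1) a by (simp add: \<tau>_def divide_right_mono flip: diff_divide_distrib)
    have \<tau>1: "\<tau> \<le> exp (- \<mu> / 2) / \<mu>"
    proof -
      have "sqrt pi - 2 * E x \<le> exp (- x\<^sup>2) / x" using Eb(2) by simp
      hence "(sqrt pi - 2 * E x) / a \<le> exp (- x\<^sup>2) / x / a" using a by (intro divide_right_mono) auto
      also have "exp (- x\<^sup>2) / x / a = exp (- \<mu> / 2) / \<mu>"
        using a x by (simp add: x_def field_simps power2_eq_square)
      finally show ?thesis by (simp add: \<tau>_def diff_divide_distrib)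
    qed
    have "2 * P * W (1 / 2) = \<sigma> * sqrt \<sigma> * exp \<mu> * ((1 - 1 / \<mu>) * (2 * (E x / a)) + exp (- \<mu> / 2) / \<mu>)"
      by (simp add: P_def W_def x_def power2_eq_square algebra_simps)
    hence "2 * P * W (1 / 2) - main = \<sigma> * sqrt \<sigma> * exp \<mu> * (exp (- \<mu> / 2) / \<mu> - (1 - 1 / \<mu>) * \<tau>)"
      unfolding main_def sq \<tau>_def by (simp add: algebra_simps)
    hence e1: "\<bar>2 * P * W (1 / 2) - main\<bar> = \<bar>\<sigma> * sqrt \<sigma> * exp \<mu> * (exp (- \<mu> / 2) / \<mu> - (1 - 1 / \<mu>) * \<tau>)\<bar>" by simp
    have e2: "0 \<le> (1 - 1 / \<mu>) * \<tau>" using \<tau>0 \<mu> by (intro mult_nonneg_nonneg) auto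
    have e3: "(1 - 1 / \<mu>) * \<tau> \<le> exp (- \<mu> / 2) / \<mu>"
    proof -
      have "(1 - 1 / \<mu>) * \<tau> \<le> 1 * \<tau>" using \<tau>0 \<mu> by (intro mult_right_mono) auto
      thus ?thesis using \<tau>1 by simp
    qed
    have "\<bar>2 * P * W (1 / 2) - main\<bar> \<le> \<sigma> * sqrt \<sigma> * exp \<mu> * (exp (- \<mu> / 2) / \<mu>)"
    proof -
      have "\<bar>C * (b - t)\<bar> \<le> C * b" if "C \<ge> 0" "0 \<le> t" "t \<le> b" for C b t :: real
        using that by (simp add: abs_mult mult_left_mono)
      from this[OF _ e2 e3, of "\<sigma> * sqrt \<sigma> * exp \<mu>"] show ?thesis
        unfolding e1 using \<sigma>(2) by simp
    qed
    also have "\<dots> = \<sigma> * sqrt \<sigma> * (exp (\<mu> / 2) / \<mu>)"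
    proof -
      have "exp \<mu> * exp (- \<mu> / 2) = exp (\<mu> / 2)" by (simp add: mult_exp_exp)
      hence "exp \<mu> * (exp (- \<mu> / 2) / \<mu>) = exp (\<mu> / 2) / \<mu>" by simp
      thus ?thesis by (simp only: mult.assoc)
    qed
    finally show ?thesis .
  qed
  ultimately have "\<bar>Im (h (pi / 3) - h (- (pi / 3))) - main\<bar> \<le> \<sigma> * sqrt \<sigma> * (exp (\<mu> / 2) / \<mu>) + \<sigma> * sqrt \<sigma> * (5 * exp (- \<mu>))"
    by linarith
  thus ?thesis by (simp add: h_def algebra_simps)
qed

section \<open>The exponential saving on the vertical lines\<close>

lemma geometric_real_part_gap:
  fixes q :: complex
  assumes r: "norm q = r" "r < 1" and c: "Re q = r * c"
  defines "d \<equiv> (1 - r)\<^sup>2 + 2 * r * (1 - c)"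
  assumes d: "d > 0"
  shows "2 * (r / (1 - r) - Re (q / (1 - q))) = (1 + r) / (1 - r) * (1 - (1 - r)\<^sup>2 / d)"
proof -
  have r2: "(Re q)\<^sup>2 + (Im q)\<^sup>2 = r\<^sup>2" using r(1) by (simp add: cmod_power2 flip: r(1))
  have d': "d = 1 - 2 * (r * c) + r\<^sup>2" by (simp add: d_def power2_eq_square algebra_simps)
  \<comment> \<open>So \<open>d\<close> is the square of \<open>norm (1 - q)\<close>. The claim
    expresses that the real part of \<open>(1 + q) / (1 - q)\<close>, which is
    \<open>1 + 2 * q / (1 - q)\<close>, equals \<open>(1 - r\<^sup>2) / d\<close>.\<close>
  have dq: "(Re (1 - q))\<^sup>2 + (Im (1 - q))\<^sup>2 = d"
    unfolding d' using r2 c by (simp add: power2_eq_square algebra_simps)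
  have "Re (q / (1 - q)) = (Re q * (1 - Re q) - (Im q)\<^sup>2) / d"
    unfolding Re_divide dq by (simp add: power2_eq_square)
  also have "Re q * (1 - Re q) - (Im q)\<^sup>2 = r * c - r\<^sup>2"
    using r2 c by (simp add: power2_eq_square algebra_simps)
  finally have re: "Re (q / (1 - q)) = (r * c - r\<^sup>2) / d" .
  have "2 * (r * d - (r * c - r\<^sup>2) * (1 - r)) = (1 + r) * (d - (1 - r)\<^sup>2)"
    unfolding d' by (simp add: power2_eq_square algebra_simps)
  hence "2 * ((r * d - (r * c - r\<^sup>2) * (1 - r)) / ((1 - r) * d)) = (1 + r) * (d - (1 - r)\<^sup>2) / ((1 - r) * d)"
    by simp
  moreover have "(r * d - (r * c - r\<^sup>2) * (1 - r)) / ((1 - r) * d) = r / (1 - r) - (r * c - r\<^sup>2) / d"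
    using r d by (simp add: diff_divide_distrib)
  moreover have "(1 + r) * (d - (1 - r)\<^sup>2) / ((1 - r) * d) = (1 + r) / (1 - r) * (1 - (1 - r)\<^sup>2 / d)"
  proof -
    have "(d - (1 - r)\<^sup>2) / d = 1 - (1 - r)\<^sup>2 / d" using d by (simp add: diff_divide_distrib)
    thus ?thesis by (simp only: times_divide_times_eq [symmetric])
  qed
  ultimately show ?thesis unfolding re by simp
qed

text \<open>The right side is the hyperbolic cotangent of \<open>a / 2\<close>.\<close>

lemma exp_minus_coth_bound:
  fixes a :: real
  assumes a: "a > 0"
  shows "2 / a \<le> (1 + exp (- a)) / (1 - exp (- a))"
proof -
  define g where "g x = x * (1 + exp (- x)) - 2 * (1 - exp (- x))" for x :: real
  have "g 0 \<le> g a"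
  proof (rule DERIV_nonneg_imp_nondecreasing[where f = g])
    fix x :: real assume x: "0 \<le> x" "x \<le> a"
    have "(g has_real_derivative (1 - (1 + x) * exp (- x))) (at x)"
      unfolding g_def by (auto intro!: derivative_eq_intros simp: algebra_simps)
    moreover have "(1 + x) * exp (- x) \<le> exp x * exp (- x)"
      by (intro mult_right_mono exp_ge_add_one_self) auto
    hence "1 - (1 + x) * exp (- x) \<ge> 0" by (simp add: mult_exp_exp)
    ultimately show "\<exists>d. (g has_real_derivative d) (at x) \<and> 0 \<le> d" by blast
  qed (use a in simp)
  hence "2 * (1 - exp (- a)) \<le> a * (1 + exp (- a))" by (simp add: g_def)
  thus ?thesis using a by (simp add: divide_simps mult.commute)
qed

lemma exp_minus_le_quadratic:
  fixes u :: real
  assumes "u \<ge> 0"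
  shows "exp (- u) \<le> 1 - u + u\<^sup>2 / 2"
proof -
  have "(\<lambda>u. 1 - u + u\<^sup>2 / 2 - exp (- u)) 0 \<le> (\<lambda>u. 1 - u + u\<^sup>2 / 2 - exp (- u)) u"
  proof (rule DERIV_nonneg_imp_nondecreasing[where f = "\<lambda>u. 1 - u + u\<^sup>2 / 2 - exp (- u)"])
    fix x :: real
    have "((\<lambda>u. 1 - u + u\<^sup>2 / 2 - exp (- u)) has_real_derivative (- 1 + x + exp (- x))) (at x)"
      by (auto intro!: derivative_eq_intros)
    moreover have "- 1 + x + exp (- x) \<ge> 0" using exp_ge_add_one_self[of "- x"] by simp
    ultimately show "\<exists>d. ((\<lambda>u. 1 - u + u\<^sup>2 / 2 - exp (- u)) has_real_derivative d) (at x) \<and> 0 \<le> d" by blast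
  qed (use assms in simp)
  thus ?thesis by simp
qed

text \<open>For small \<open>a\<close> the square of \<open>norm (1 - q)\<close> is about
  \<open>a\<^sup>2 + t\<^sup>2\<close>, at least four times \<open>a\<^sup>2\<close> in this range,
  so the ideal constant would be \<open>2 * (1 - 1 / 4) = 1.5\<close>. With
  \<open>a \<le> 0.0353\<close> the factor 4 becomes 3.88, and \<open>2 * 0.742 = 1.484\<close>
  remains.\<close>

lemma minor_arc_exponent:
  fixes a t :: real
  assumes a: "0 < a" "a \<le> 0.0353" and t: "sqrt 3 * a \<le> \<bar>t\<bar>" "\<bar>t\<bar> \<le> pi"
  defines "q \<equiv> exp (- Complex a t)"
  shows "1.484 / a \<le> 2 * (norm q / (1 - norm q) - Re (q / (1 - q)))"
proof -
  define r where "r = exp (- a)"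
  have r: "0 < r" "r < 1" "norm q = r" using a by (auto simp: r_def q_def)
  have ra: "1 - a \<le> r" using exp_ge_add_one_self[of "- a"] by (simp add: r_def)
  define c where "c = cos t"
  have c: "Re q = r * c" by (simp add: q_def r_def c_def Re_exp)
  define x where "x = sqrt 3 * a"
  have x: "x\<^sup>2 = 3 * a\<^sup>2" "0 \<le> x" using a by (auto simp: x_def power_mult_distrib)
  have "sqrt 3 \<le> 2" by (rule real_le_lsqrt) auto
  hence xle: "x \<le> 2 * 0.0353" unfolding x_def using a by (intro mult_mono) auto
  have "c = cos \<bar>t\<bar>" by (simp add: c_def)
  also have "\<dots> \<le> cos x" using x t unfolding x_def by (intro cos_monotone_0_pi_le) auto
  also have "\<dots> \<le> exp (- (x\<^sup>2 / 2))"
    using cos_le_exp[of x] x xle pi_gt3 by simp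
  also have "\<dots> \<le> 1 - x\<^sup>2 / 2 + (x\<^sup>2 / 2)\<^sup>2 / 2" by (rule exp_minus_le_quadratic) simp
  also have "\<dots> = 1 - 3 / 2 * a\<^sup>2 * (1 - 3 / 4 * a\<^sup>2)" unfolding x by (simp add: power2_eq_square algebra_simps)
  finally have \<kappa>: "3 / 2 * a\<^sup>2 * (1 - 3 / 4 * a\<^sup>2) \<le> 1 - c" by linarith
  have a2: "a\<^sup>2 \<le> 0.0013"
    using power_mono[of a "0.0353" 2] a by (simp add: power2_eq_square)
  have "1.44 * a\<^sup>2 \<le> r * (1 - c)"
  proof -
    have "1.44 * a\<^sup>2 \<le> 0.9647 * (3 / 2 * a\<^sup>2 * (1 - 3 / 4 * 0.0013))" by simp
    also have "\<dots> \<le> r * (3 / 2 * a\<^sup>2 * (1 - 3 / 4 * a\<^sup>2))"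
      using ra a a2 r by (intro mult_mono) auto
    also have "\<dots> \<le> r * (1 - c)" using \<kappa> r by (intro mult_left_mono) auto
    finally show ?thesis .
  qed
  moreover have "(1 - r)\<^sup>2 \<le> a\<^sup>2" using ra r by (intro power_mono) auto
  ultimately have X: "2.88 * (1 - r)\<^sup>2 \<le> 2 * r * (1 - c)" by simp
  define d where "d = (1 - r)\<^sup>2 + 2 * r * (1 - c)"
  have r1: "(1 - r)\<^sup>2 > 0" using r by simp
  have d: "3.88 * (1 - r)\<^sup>2 \<le> d" using X by (simp add: d_def)
  have "0 < 3.88 * (1 - r)\<^sup>2" using r1 by simp
  hence d0: "d > 0" using d by (rule less_le_trans)
  have "(1 - r)\<^sup>2 / d \<le> 1 / 3.88" using d d0 by (simp add: divide_le_eq)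
  hence "0.742 \<le> 1 - (1 - r)\<^sup>2 / d" by simp
  hence "2 / a * 0.742 \<le> (1 + r) / (1 - r) * (1 - (1 - r)\<^sup>2 / d)"
    using exp_minus_coth_bound[OF a(1)] a r by (intro mult_mono) (auto simp: r_def)
  also have "\<dots> = 2 * (r / (1 - r) - Re (q / (1 - q)))"
    using geometric_real_part_gap[OF r(3) r(2) c] d0 unfolding d_def by simp
  finally show ?thesis using r(3) by simp
qed

text \<open>Balance of exponents on the line \<open>Re s = \<sigma>\<close>:
  \<open>1 / theta4\<close> at \<open>norm q\<close> contributes \<open>\<mu>\<close>, the factor
  \<open>exp (of_real pi * of_nat n * s)\<close> contributes \<open>\<mu> / 4\<close>, and
  \<open>minor_arc_exponent\<close> saves at least \<open>0.6 * \<mu>\<close>, since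
  \<open>a * \<mu> = pi\<^sup>2 / 4\<close>. The assumption \<open>\<mu> \<ge> 70\<close> is what
  makes \<open>a \<le> 0.0353\<close>.\<close>

lemma minor_arc_bound:
  fixes n :: nat and t :: real
  defines "\<mu> \<equiv> pi * sqrt (real n)" and "\<sigma> \<equiv> 1 / (4 * sqrt (real n))"
  assumes \<mu>: "\<mu> \<ge> 70" and t: "sqrt 3 * \<sigma> \<le> \<bar>t\<bar>" "\<bar>t\<bar> \<le> 1"
  defines "s \<equiv> Complex \<sigma> t"
  shows "norm (opart_gf (exp (- (of_real pi * s))) * exp (of_real pi * of_nat n * s)) \<le> exp (0.65 * \<mu>) / 16"
proof -
  define \<nu> where "\<nu> = sqrt (real n)"
  have \<mu>\<nu>: "\<mu> = pi * \<nu>" by (simp add: \<mu>_def \<nu>_def)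
  have pi315: "pi \<le> 3.1416" "pi \<ge> 3.1415" using pi_approx by auto
  have \<nu>16: "\<nu> \<ge> 16"
  proof (rule ccontr)
    assume "\<not> \<nu> \<ge> 16"
    hence "pi * \<nu> \<le> 3.1416 * 16" using pi315 by (intro mult_mono) (auto simp: \<nu>_def)
    thus False using \<mu> \<mu>\<nu> by simp
  qed
  have \<sigma>: "\<sigma> = 1 / (4 * \<nu>)" by (simp add: \<sigma>_def \<nu>_def)
  have \<sigma>0: "\<sigma> > 0" using \<nu>16 by (simp add: \<sigma>)
  define a where "a = pi * \<sigma>"
  have a\<mu>: "a * \<mu> = pi\<^sup>2 / 4" using \<nu>16 by (simp add: a_def \<sigma> \<mu>\<nu> power2_eq_square)
  have pi2: "pi\<^sup>2 \<le> 9.8697" using power_mono[OF pi315(1), of 2] by (simp add: power2_eq_square)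
  have a0: "a > 0" using \<sigma>0 by (simp add: a_def)
  have a1: "a \<le> 0.0353"
  proof -
    have "a * 70 \<le> a * \<mu>" using a0 \<mu> by (intro mult_left_mono) auto
    thus ?thesis using a\<mu> pi2 by simp
  qed
  define q where "q = exp (- Complex a (pi * t))"
  have qs: "exp (- (of_real pi * s)) = q"
    by (simp add: q_def s_def a_def complex_eq_iff complex_of_real_mult_Complex)
  define r where "r = exp (- a)"
  have nq: "norm q = r" by (simp add: q_def r_def)
  have r: "r < 1" using a0 by (simp add: r_def)
  have pt: "sqrt 3 * a \<le> \<bar>pi * t\<bar>" "\<bar>pi * t\<bar> \<le> pi"
    using t mult_left_mono[OF t(1), of pi] mult_left_mono[OF t(2), of pi] by (auto simp: abs_mult a_def mult_ac)
  have gap: "0.6 * \<mu> \<le> 2 * (r / (1 - r) - Re (q / (1 - q)))"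
  proof -
    have "0.6 * \<mu> * a \<le> 1.484" using a\<mu> pi2 by (simp add: mult_ac)
    hence "0.6 * \<mu> \<le> 1.484 / a" using a0 by (simp add: le_divide_eq)
    also have "\<dots> \<le> 2 * (r / (1 - r) - Re (q / (1 - q)))"
      using minor_arc_exponent[OF a0 a1 pt] unfolding q_def [symmetric] nq .
    finally show ?thesis .
  qed
  have th: "1 / theta4 r \<le> sqrt \<sigma> / 2 * exp \<mu>"
  proof -
    have "2 / sqrt \<sigma> * exp (- (pi / (4 * \<sigma>))) \<le> theta4 r"
      using theta4_real_ge[OF \<sigma>0] by (simp add: r_def a_def)
    moreover have "pi / (4 * \<sigma>) = \<mu>" using \<nu>16 by (simp add: \<sigma> \<mu>\<nu>)
    ultimately have le: "2 / sqrt \<sigma> * exp (- \<mu>) \<le> theta4 r" by simp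
    have "1 / theta4 r \<le> 1 / (2 / sqrt \<sigma> * exp (- \<mu>))"
      using le \<sigma>0 by (intro divide_left_mono mult_pos_pos) (auto intro: less_le_trans[OF _ le])
    also have "\<dots> = sqrt \<sigma> / 2 * exp \<mu>" using \<sigma>0 by (simp add: exp_minus field_simps)
    finally show ?thesis .
  qed
  have "norm (exp (of_real pi * of_nat n * s)) = exp (\<mu> / 4)"
  proof -
    have "pi * real n * \<sigma> = \<mu> / 4"
    proof -
      have "real n = \<nu> * \<nu>" by (simp add: \<nu>_def)
      thus ?thesis using \<nu>16 by (simp add: \<sigma> \<mu>\<nu>)
    qed
    thus ?thesis by (simp add: s_def)
  qed
  hence "norm (opart_gf (exp (- (of_real pi * s))) * exp (of_real pi * of_nat n * s)) = norm (opart_gf q) * exp (\<mu> / 4)"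
    by (simp only: norm_mult qs)
  also have "norm (opart_gf q) \<le> 1 / theta4 r * exp (2 * (Re (q / (1 - q)) - r / (1 - r)))"
    using norm_opart_gf_le[of q] r by (simp add: nq)
  also have "1 / theta4 r * exp (2 * (Re (q / (1 - q)) - r / (1 - r))) \<le> (sqrt \<sigma> / 2 * exp \<mu>) * exp (- 0.6 * \<mu>)"
  proof (intro mult_mono th)
    show "exp (2 * (Re (q / (1 - q)) - r / (1 - r))) \<le> exp (- 0.6 * \<mu>)" using gap by simp
  qed (use \<sigma>0 in auto)
  also have "(sqrt \<sigma> / 2 * exp \<mu>) * exp (- 0.6 * \<mu>) * exp (\<mu> / 4) = sqrt \<sigma> / 2 * exp (0.65 * \<mu>)"
    by (simp add: mult_exp_exp)
  also have "sqrt \<sigma> / 2 * exp (0.65 * \<mu>) \<le> exp (0.65 * \<mu>) / 16"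
  proof -
    have "\<sigma> \<le> (1 / 8)\<^sup>2" using \<nu>16 by (simp add: \<sigma> power2_eq_square divide_simps)
    hence "sqrt \<sigma> \<le> 1 / 8" by (rule real_le_lsqrt[rotated]) auto
    hence "sqrt \<sigma> / 2 * exp (0.65 * \<mu>) \<le> (1 / 8) / 2 * exp (0.65 * \<mu>)" by (intro mult_right_mono) auto
    thus ?thesis by simp
  qed
  finally show ?thesis by simp
qed

text \<open>The path runs from \<open>Complex \<sigma>' (- 1)\<close> up to the arc, along it and up
  to \<open>Complex \<sigma>' 1\<close>. The end points of the arc lie on the line
  \<open>Re s = \<sigma>'\<close> because \<open>\<sigma>'\<close> is
  \<open>\<sigma> * cos (pi / 3)\<close>. Over the whole path \<open>H\<close> increases by
  \<open>2 * i * overpart n\<close>.\<close>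

lemma overpart_near_main_term:
  fixes n :: nat
  defines "\<mu> \<equiv> pi * sqrt (real n)"
  assumes \<mu>: "\<mu> \<ge> 70"
  shows "\<bar>real (overpart n) - exp \<mu> * (1 - 1 / \<mu>) / (8 * real n)\<bar> \<le> exp (0.65 * \<mu>) / 12"
proof -
  define \<nu> where "\<nu> = sqrt (real n)"
  have \<mu>\<nu>: "\<mu> = pi * \<nu>" by (simp add: \<mu>_def \<nu>_def)
  have \<nu>16: "\<nu> \<ge> 16"
  proof (rule ccontr)
    assume "\<not> \<nu> \<ge> 16"
    hence "pi * \<nu> \<le> 3.1416 * 16" using pi_approx by (intro mult_mono) (auto simp: \<nu>_def)
    thus False using \<mu> \<mu>\<nu> by simp
  qed
  hence n: "n > 0" by (cases "n = 0") (auto simp: \<nu>_def)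
  define \<sigma> where "\<sigma> = 1 / (2 * \<nu>)"
  define \<sigma>' where "\<sigma>' = 1 / (4 * \<nu>)"
  have \<sigma>: "\<sigma> > 0" "\<sigma>' > 0" "\<sigma> = 2 * \<sigma>'" "\<sigma> \<le> 1 / 32" using \<nu>16 by (auto simp: \<sigma>_def \<sigma>'_def divide_simps)
  obtain H where H: "\<And>s. Re s > 0 \<Longrightarrow> (H has_field_derivative (opart_gf (exp (- (of_real pi * s))) * exp (of_real pi * of_nat n * s))) (at s)"
    and Hp: "\<And>s. H (s + 2 * \<i>) = H s + 2 * \<i> * of_nat (overpart n)"
    using overpart_contour_primitive[of n] by blast
  have corner: "of_real \<sigma> * cis (pi / 3) = Complex \<sigma>' (sqrt 3 * \<sigma>')"
    "of_real \<sigma> * cis (- pi / 3) = Complex \<sigma>' (- (sqrt 3 * \<sigma>'))"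
    by (simp_all add: complex_eq_iff cos_60 sin_60 \<sigma>(3))
  have "sqrt 3 \<le> 2" by (rule real_le_lsqrt) auto
  hence s31: "sqrt 3 * \<sigma>' \<le> 1" using \<sigma> mult_mono[of "sqrt 3" 2 \<sigma>' "1 / 64"] by simp
  have seg: "norm (H (Complex \<sigma>' t) - H (Complex \<sigma>' u)) \<le> exp (0.65 * \<mu>) / 16"
    if tu: "sqrt 3 * \<sigma>' \<le> t \<and> t \<le> 1 \<and> sqrt 3 * \<sigma>' \<le> u \<and> u \<le> 1 \<or>
        sqrt 3 * \<sigma>' \<le> - t \<and> - t \<le> 1 \<and> sqrt 3 * \<sigma>' \<le> - u \<and> - u \<le> 1" for t u
  proof -
    define S where "S = closed_segment (Complex \<sigma>' t) (Complex \<sigma>' u)"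
    have inS: "\<exists>x. z = Complex \<sigma>' x \<and> sqrt 3 * \<sigma>' \<le> \<bar>x\<bar> \<and> \<bar>x\<bar> \<le> 1" if z: "z \<in> S" for z
    proof (intro exI conjI)
      have z': "Re z = \<sigma>'" "Im z \<in> closed_segment t u"
        using z unfolding S_def by (simp_all add: closed_segment_same_Re)
      show "z = Complex \<sigma>' (Im z)" using z'(1) by (simp add: complex_eq_iff)
      have "0 \<le> sqrt 3 * \<sigma>'" using \<sigma>(2) by simp
      thus "sqrt 3 * \<sigma>' \<le> \<bar>Im z\<bar>" "\<bar>Im z\<bar> \<le> 1"
        using z'(2) tu unfolding closed_segment_eq_real_ivl by (auto split: if_splits)
    qed
    have "norm (H (Complex \<sigma>' t) - H (Complex \<sigma>' u)) \<le> exp (0.65 * \<mu>) / 16 * norm (Complex \<sigma>' t - Complex \<sigma>' u)"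
    proof (rule field_differentiable_bound)
      show "convex S" unfolding S_def by simp
      show "Complex \<sigma>' t \<in> S" "Complex \<sigma>' u \<in> S" by (auto simp: S_def)
      fix z assume "z \<in> S"
      from inS[OF this] obtain x where x: "z = Complex \<sigma>' x" "sqrt 3 * \<sigma>' \<le> \<bar>x\<bar>" "\<bar>x\<bar> \<le> 1" by blast
      have "Re z > 0" using \<sigma> by (simp add: x)
      from H[OF this]
      show "(H has_field_derivative opart_gf (exp (- (of_real pi * z))) * exp (of_real pi * of_nat n * z)) (at z within S)"
        by (rule has_field_derivative_at_within)
      show "norm (opart_gf (exp (- (of_real pi * z))) * exp (of_real pi * of_nat n * z)) \<le> exp (0.65 * \<mu>) / 16"
        unfolding x(1) \<mu>_def \<sigma>'_def \<nu>_def
        by (rule minor_arc_bound) (use \<mu> x(2,3) in \<open>auto simp: \<mu>_def \<sigma>'_def \<nu>_def\<close>)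
    qed
    also have "\<dots> \<le> exp (0.65 * \<mu>) / 16 * 1"
    proof (rule mult_left_mono)
      have "Complex \<sigma>' t - Complex \<sigma>' u = \<i> * of_real (t - u)" by (simp add: complex_eq_iff)
      hence "norm (Complex \<sigma>' t - Complex \<sigma>' u) = \<bar>t - u\<bar>"
        by (simp only: norm_mult norm_of_real norm_ii mult_1_left)
      moreover have "sqrt 3 * \<sigma>' \<ge> 0" using \<sigma> by simp
      ultimately show "norm (Complex \<sigma>' t - Complex \<sigma>' u) \<le> 1" using tu by (auto simp: abs_le_iff)
    qed simp
    finally show ?thesis by simp
  qed
  define A where "A = H (Complex \<sigma>' 1) - H (Complex \<sigma>' (sqrt 3 * \<sigma>'))"
  define B where "B = H (Complex \<sigma>' (- (sqrt 3 * \<sigma>'))) - H (Complex \<sigma>' (- 1))"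
  define C where "C = H (of_real \<sigma> * cis (pi / 3)) - H (of_real \<sigma> * cis (- pi / 3))"
  have "norm A \<le> exp (0.65 * \<mu>) / 16" "norm B \<le> exp (0.65 * \<mu>) / 16"
    unfolding A_def B_def by (rule seg, use s31 in simp)+
  hence AB: "\<bar>Im A\<bar> \<le> exp (0.65 * \<mu>) / 16" "\<bar>Im B\<bar> \<le> exp (0.65 * \<mu>) / 16"
    using abs_Im_le_cmod order.trans by blast+
  have "Complex \<sigma>' (- 1) + 2 * \<i> = Complex \<sigma>' 1" by (simp add: complex_eq_iff)
  hence "2 * \<i> * of_nat (overpart n) = A + B + C"
    using Hp[of "Complex \<sigma>' (- 1)"] unfolding A_def B_def C_def corner by simp
  hence "Im (2 * \<i> * of_nat (overpart n)) = Im (A + B + C)" by (rule arg_cong)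
  hence p: "2 * real (overpart n) = Im A + Im B + Im C" by simp
  define main where "main = \<sigma> * sqrt \<sigma> * exp \<mu> * ((1 - 1 / \<mu>) * sqrt (pi / (2 * \<mu>)))"
  have arc: "\<bar>Im C - main\<bar> \<le> \<sigma> * sqrt \<sigma> * (exp (\<mu> / 2) / \<mu> + 5 * exp (- \<mu>))"
    using arc_integral_bound[OF n H] unfolding C_def main_def \<sigma>_def \<nu>_def \<mu>_def by simp
  \<comment> \<open>The square root left by the Gaussian integral is that of \<open>\<sigma>\<close>
    itself and combines with \<open>sqrt \<sigma>\<close> from the theta transformation.\<close>
  have "\<sigma> = pi / (2 * \<mu>)" using \<nu>16 by (simp add: \<sigma>_def \<mu>\<nu>)
  hence "main = \<sigma> * exp \<mu> * (1 - 1 / \<mu>) * (sqrt \<sigma> * sqrt \<sigma>)" by (simp add: main_def mult_ac)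
  also have "sqrt \<sigma> * sqrt \<sigma> = \<sigma>" using \<sigma> by simp
  also have "\<sigma> * exp \<mu> * (1 - 1 / \<mu>) * \<sigma> = 2 * (exp \<mu> * (1 - 1 / \<mu>) / (8 * real n))"
  proof -
    have "real n = \<nu> * \<nu>" by (simp add: \<nu>_def)
    thus ?thesis using \<nu>16 by (simp add: \<sigma>_def)
  qed
  finally have main: "main = 2 * (exp \<mu> * (1 - 1 / \<mu>) / (8 * real n))" .
  have "\<sigma> * sqrt \<sigma> * (exp (\<mu> / 2) / \<mu> + 5 * exp (- \<mu>)) \<le> (1 / 160) * (6 * exp (0.65 * \<mu>))"
  proof (rule mult_mono)
    have "\<sigma> \<le> (1 / 5)\<^sup>2" using \<sigma>(4) by (simp add: power2_eq_square)
    hence "sqrt \<sigma> \<le> 1 / 5" by (rule real_le_lsqrt[rotated]) auto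
    hence "\<sigma> * sqrt \<sigma> \<le> 1 / 32 * (1 / 5)" using \<sigma> by (intro mult_mono) auto
    thus "\<sigma> * sqrt \<sigma> \<le> 1 / 160" by simp
    have "exp (\<mu> / 2) / \<mu> \<le> exp (\<mu> / 2) / 1" using \<mu> by (intro divide_left_mono) auto
    moreover have "exp (\<mu> / 2) \<le> exp (0.65 * \<mu>)" "exp (- \<mu>) \<le> exp (0.65 * \<mu>)" using \<mu> by auto
    ultimately show "exp (\<mu> / 2) / \<mu> + 5 * exp (- \<mu>) \<le> 6 * exp (0.65 * \<mu>)" by linarith
  qed (use \<mu> in auto)
  hence "\<bar>Im C - main\<bar> \<le> exp (0.65 * \<mu>) * (3 / 80)" using arc by linarith
  hence "\<bar>2 * real (overpart n) - main\<bar> \<le> exp (0.65 * \<mu>) * (1 / 6)" using AB p by linarith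
  thus ?thesis unfolding main by linarith
qed

text \<open>The exponential saving is weakened to a fifth power, the shape of the term
  \<open>1000 / mu (n - 1) ^ 5\<close> that it is compared with. Two further powers of
  \<open>\<mu>\<close> come from the denominator \<open>8 * n\<close>.\<close>

theorem overpart_asymptotic:
  fixes n :: nat
  defines "\<mu> \<equiv> pi * sqrt (real n)"
  assumes \<mu>: "\<mu> \<ge> 70"
  shows "\<bar>real (overpart n) - exp \<mu> * (1 - 1 / \<mu>) / (8 * real n)\<bar> \<le> 50 / \<mu> ^ 5 * (exp \<mu> * (1 - 1 / \<mu>) / (8 * real n))"
proof -
  \<comment> \<open>Since \<open>0.35 * \<mu> = 7 * y\<close>, a linear bound of
    \<open>\<mu>\<close> by \<open>exp y\<close> can be raised to the seventh power. It comes from a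
    line through the left end \<open>y = 7 / 2\<close> of the range, with 30 in place of
    \<open>exp (7 / 2)\<close>.\<close>
  define y where "y = \<mu> / 20"
  have "exp (1 / 4 :: real) ^ 14 \<ge> (1.28125) ^ 14"
    using exp_lower_Taylor_quadratic[of "1 / 4"] by (intro power_mono) (auto simp: power2_eq_square)
  moreover have "exp (1 / 4 :: real) ^ 14 = exp (7 / 2)"
    using exp_of_nat_mult[of 14 "1 / 4 :: real"] by simp
  moreover have "(30 :: real) \<le> 1.28125 ^ 14" by (simp add: power_numeral_reduce)
  ultimately have "exp (7 / 2 :: real) \<ge> 30" by linarith
  moreover have "exp (y - 7 / 2) \<ge> y - 5 / 2" using exp_ge_add_one_self[of "y - 7 / 2"] by simp
  ultimately have "30 * (y - 5 / 2) \<le> exp (7 / 2) * exp (y - 7 / 2)"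
    using \<mu> by (intro mult_mono) (auto simp: y_def)
  also have "\<dots> = exp y" by (simp add: mult_exp_exp)
  finally have "\<mu> \<le> 2.5 * exp y" using \<mu> by (simp add: y_def)
  hence "\<mu> ^ 7 \<le> (2.5 * exp y) ^ 7" using \<mu> by (intro power_mono) auto
  also have "\<dots> = 2.5 ^ 7 * exp y ^ 7" by (rule power_mult_distrib)
  also have "exp y ^ 7 = exp (0.35 * \<mu>)"
    using exp_of_nat_mult[of 7 y] by (simp add: y_def)
  finally have m7: "\<mu> ^ 7 \<le> 620 * exp (0.35 * \<mu>)"
    by (rule order.trans) (simp add: power_numeral_reduce)
  have n: "real n = \<mu>\<^sup>2 / pi\<^sup>2" by (simp add: \<mu>_def power_mult_distrib)
  have pi2: "pi\<^sup>2 \<ge> 9.8" using power_mono[of "3.14" pi 2] pi_approx by (simp add: power2_eq_square)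
  have "exp (0.65 * \<mu>) / 12 * (\<mu> ^ 5 * (8 * \<mu>\<^sup>2)) = exp (0.65 * \<mu>) * (2 / 3) * \<mu> ^ 7"
    by (simp add: power_numeral_reduce)
  also have "\<dots> \<le> exp (0.65 * \<mu>) * (2 / 3) * (620 * exp (0.35 * \<mu>))"
    using m7 by (intro mult_left_mono) auto
  also have "\<dots> = 1240 / 3 * exp \<mu>" by (simp add: mult_exp_exp)
  also have "\<dots> \<le> 50 * (9.8 * (69 / 70)) * exp \<mu>" by simp
  also have "\<dots> \<le> 50 * (pi\<^sup>2 * (1 - 1 / \<mu>)) * exp \<mu>"
  proof -
    have "1 / \<mu> \<le> 1 / 70" using \<mu> by (intro divide_left_mono) auto
    hence "9.8 * (69 / 70) \<le> pi\<^sup>2 * (1 - 1 / \<mu>)" using pi2 by (intro mult_mono) auto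
    thus ?thesis by (intro mult_right_mono mult_left_mono) auto
  qed
  finally have "exp (0.65 * \<mu>) / 12 \<le> 50 * (pi\<^sup>2 * (1 - 1 / \<mu>)) * exp \<mu> / (\<mu> ^ 5 * (8 * \<mu>\<^sup>2))"
    using \<mu> by (subst pos_le_divide_eq) auto
  also have "\<dots> = 50 / \<mu> ^ 5 * (exp \<mu> * (1 - 1 / \<mu>) / (8 * real n))"
    unfolding n by simp
  finally show ?thesis using overpart_near_main_term[of n] \<mu> unfolding \<mu>_def by linarith
qed

section \<open>Large arguments\<close>

text \<open>With \<open>w = sqrt (1 - u)\<close> one has \<open>Q u = 1 - (w / (1 + w))\<^sup>2\<close>, and \<open>w / (1 + w) < v\<close> amounts to
  \<open>w * (1 - v) < v\<close>.\<close>
lemma less_Q_I: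
  fixes u v F :: real
  assumes u: "0 < u" "u \<le> 1" and v: "0 \<le> v" "v < 1"
    and F: "v\<^sup>2 \<le> 1 - F" and uv: "(1 - u) * (1 - v)\<^sup>2 < v\<^sup>2"
  shows "F < Q u"
proof -
  define w where "w = sqrt (1 - u)"
  have w: "w \<ge> 0" "w\<^sup>2 = 1 - u" using u by (auto simp: w_def)
  have ueq: "u = (1 - w) * (1 + w)" using w by (simp add: power2_eq_square algebra_simps)
  hence w1: "1 - w \<noteq> 0" "1 + w > 0" using u w by auto
  have "sqrt ((1 - u) ^ 3) = w ^ 3"
    unfolding w(2)[symmetric] using w(1) by (intro real_sqrt_unique) (auto simp flip: power_mult)
  hence "Q u = (3 * (1 - w\<^sup>2) + 2 * w ^ 3 - 2) / ((1 - w) * (1 + w))\<^sup>2"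
    using w(2) ueq by (simp add: Q_def)
  also have "3 * (1 - w\<^sup>2) + 2 * w ^ 3 - 2 = (1 - w)\<^sup>2 * (1 + 2 * w)"
    by (simp add: power2_eq_square power3_eq_cube algebra_simps)
  also have "(1 - w)\<^sup>2 * (1 + 2 * w) / ((1 - w) * (1 + w))\<^sup>2 = (1 + 2 * w) / (1 + w)\<^sup>2"
    using w1 by (simp add: power_mult_distrib)
  also have "\<dots> = 1 - (w / (1 + w))\<^sup>2"
    using w1 by (simp add: divide_simps power2_eq_square) (simp add: algebra_simps)
  finally have Q: "Q u = 1 - (w / (1 + w))\<^sup>2" .
  have "(w * (1 - v))\<^sup>2 < v\<^sup>2" using uv by (simp add: power_mult_distrib w)
  from this v(1) have "w * (1 - v) < v" by (rule power2_less_imp_less)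
  hence "w / (1 + w) < v" using w1 by (simp add: divide_less_eq algebra_simps)
  hence "(w / (1 + w))\<^sup>2 < v\<^sup>2" using w w1 by (intro power_strict_mono) auto
  thus ?thesis using F Q by linarith
qed

text \<open>The sum of the two outer roots is squared, and their product is bounded by
  \<open>sqrt (x\<^sup>2 - 1) \<le> x - 1 / (2 * x)\<close>. The result has the exact leading
  term.\<close>

lemma second_difference_sqrt:
  fixes x :: real
  assumes x: "x \<ge> 1"
  shows "sqrt (x - 1) + sqrt (x + 1) - 2 * sqrt x \<le> - 1 / (4 * sqrt x ^ 3)"
proof -
  have x0: "x > 0" using x by simp
  have "sqrt (x - 1) * sqrt (x + 1) = sqrt (x\<^sup>2 - 1)"
    by (simp add: real_sqrt_mult [symmetric] power2_eq_square algebra_simps)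
  also have "\<dots> \<le> x - 1 / (2 * x)"
  proof (rule real_le_lsqrt)
    have "1 / (2 * x) \<le> 1 / 2" using x by simp
    thus "0 \<le> x - 1 / (2 * x)" using x by linarith
    show "x\<^sup>2 - 1 \<le> (x - 1 / (2 * x))\<^sup>2"
      using x0 by (simp add: power2_diff power_divide)
  qed
  finally have p: "sqrt (x - 1) * sqrt (x + 1) \<le> x - 1 / (2 * x)" .
  define s where "s = sqrt x"
  have s: "s \<ge> 1" "s\<^sup>2 = x" using x by (auto simp: s_def)
  have "(sqrt (x - 1) + sqrt (x + 1))\<^sup>2 = 2 * x + 2 * (sqrt (x - 1) * sqrt (x + 1))"
    using x by (simp add: power2_sum)
  also have "\<dots> \<le> 4 * x - 1 / x" using p by simp
  also have "\<dots> \<le> (2 * s - 1 / (4 * s ^ 3))\<^sup>2"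
  proof -
    have "(2 * s - 1 / (4 * s ^ 3))\<^sup>2 = 4 * s\<^sup>2 - 1 / s\<^sup>2 + (1 / (4 * s ^ 3))\<^sup>2"
      using s(1) by (simp add: power2_diff power_numeral_reduce field_simps)
    thus ?thesis using s by simp
  qed
  finally have "sqrt (x - 1) + sqrt (x + 1) \<le> 2 * s - 1 / (4 * s ^ 3)"
  proof (rule power2_le_imp_le)
    have "s ^ 3 \<ge> 1" using s by simp
    hence "1 / (4 * s ^ 3) \<le> 1 / (4 * 1)" by (intro divide_left_mono) (use s in auto)
    thus "0 \<le> 2 * s - 1 / (4 * s ^ 3)" using s by linarith
  qed
  thus ?thesis by (simp add: s_def)
qed

text \<open>In this form \<open>f_fun n\<close> is the quotient \<open>u_seq n\<close> formed with
  main terms, except that each factor \<open>1 - 1 / mu m\<close> is perturbed by a fifth power,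
  always in the direction that lowers the quotient.\<close>

lemma f_fun_eq:
  assumes "n \<ge> 2"
  defines "x \<equiv> mu (real n - 1)" and "y \<equiv> mu (real n)" and "z \<equiv> mu (real n + 1)"
  shows "f_fun n = exp (x - 2 * y + z) * ((real n)\<^sup>2 / ((real n)\<^sup>2 - 1)) *
    ((1 - 1 / x - 1 / x ^ 5) * (1 - 1 / z - 1 / z ^ 5) / (1 - 1 / y + 1 / y ^ 5)\<^sup>2)"
proof -
  have pos: "x > 0" "y > 0" "z > 0" using assms(1) by (auto simp: x_def y_def z_def mu_def)
  have x5: "x ^ 5 - x ^ 4 - 1 = x ^ 5 * (1 - 1 / x - 1 / x ^ 5)"
    and z5: "z ^ 5 - z ^ 4 - 1 = z ^ 5 * (1 - 1 / z - 1 / z ^ 5)"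
    and y5: "y ^ 5 - y ^ 4 + 1 = y ^ 5 * (1 - 1 / y + 1 / y ^ 5)"
    using pos by (simp_all add: algebra_simps power_numeral_reduce)
  have sq: "x\<^sup>2 = pi\<^sup>2 * (real n - 1)" "y\<^sup>2 = pi\<^sup>2 * real n" "z\<^sup>2 = pi\<^sup>2 * (real n + 1)"
    using assms(1) by (simp_all add: x_def y_def z_def mu_def power_mult_distrib)
  have "(real n)\<^sup>2 / ((real n)\<^sup>2 - 1) = (y\<^sup>2)\<^sup>2 / (x\<^sup>2 * z\<^sup>2)"
  proof -
    have "(real n)\<^sup>2 - 1 = (real n - 1) * (real n + 1)" by (simp add: power2_eq_square algebra_simps)
    moreover have "pi\<^sup>2 * pi\<^sup>2 \<noteq> 0" by simp
    ultimately show ?thesis unfolding sq power_mult_distrib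
      by (simp add: power2_eq_square mult_ac)
  qed
  hence r: "(real n)\<^sup>2 / ((real n)\<^sup>2 - 1) = y ^ 4 / (x\<^sup>2 * z\<^sup>2)" by (simp flip: power_mult)
  have "f_fun n = exp (x - 2 * y + z) * (y ^ 14 * (x ^ 5 - x ^ 4 - 1) * (z ^ 5 - z ^ 4 - 1)) / (x ^ 7 * z ^ 7 * (y ^ 5 - y ^ 4 + 1)\<^sup>2)"
    by (simp add: f_fun_def Let_def x_def y_def z_def)
  also have "\<dots> = exp (x - 2 * y + z) * (y ^ 4 / (x\<^sup>2 * z\<^sup>2)) *
    ((1 - 1 / x - 1 / x ^ 5) * (1 - 1 / z - 1 / z ^ 5) / (1 - 1 / y + 1 / y ^ 5)\<^sup>2)"
  proof -
    have "e * (y4 * Y\<^sup>2 * (X * A) * (Z * B)) / (x2 * X * (z2 * Z) * (Y * C)\<^sup>2) = e * (y4 / (x2 * z2)) * (A * B / C\<^sup>2)"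
      if "X \<noteq> 0" "Y \<noteq> 0" "Z \<noteq> 0" for e y4 Y X A Z B x2 z2 C :: real
      using that by (simp add: power_mult_distrib)
    moreover have "y ^ 14 = y ^ 4 * (y ^ 5)\<^sup>2" "x ^ 7 = x\<^sup>2 * x ^ 5" "z ^ 7 = z\<^sup>2 * z ^ 5"
      by (simp_all flip: power_add power_mult)
    moreover have "x ^ 5 \<noteq> 0" "y ^ 5 \<noteq> 0" "z ^ 5 \<noteq> 0" using pos by auto
    ultimately show ?thesis unfolding x5 y5 z5 by (simp only: not_False_eq_True)
  qed
  finally show ?thesis unfolding r .
qed

text \<open>Both sides are compared with \<open>U\<close>, the quotient of the main terms:
  \<open>f_fun n\<close> is at most \<open>U\<close>, and \<open>u_seq n\<close> is at least
  \<open>U * (1 - 4 * E)\<close>. What decides is that \<open>1 - U\<close> is at least a multiple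
  of \<open>h ^ 3\<close>, while all errors are multiples of \<open>h ^ 5\<close>.\<close>

lemma f_fun_bound_large:
  fixes n :: nat
  assumes n: "n \<ge> 500"
  shows "f_fun n + 1000 / (mu (real n - 1)) ^ 5 < Q (u_seq n)"
proof -
  define x y z where "x = mu (real n - 1)" and "y = mu (real n)" and "z = mu (real n + 1)"
  define \<nu> where "\<nu> = sqrt (real n)"
  have n1: "real (n - 1) = real n - 1" using n by (simp add: of_nat_diff)
  have n2: "real (n + 1) = real n + 1" by simp
  have nr: "real n \<ge> 500" using n by simp
  have \<nu>: "\<nu>\<^sup>2 = real n" "\<nu> > 22"
  proof -
    show "\<nu>\<^sup>2 = real n" by (simp add: \<nu>_def)
    show "\<nu> > 22" unfolding \<nu>_def by (rule real_less_rsqrt) (use nr in simp)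
  qed
  have xsq: "x\<^sup>2 = pi\<^sup>2 * (real n - 1)" using nr by (simp add: x_def mu_def power_mult_distrib)
  have pi2: "pi\<^sup>2 \<ge> (9869 / 1000)" using power_mono[of "(6283 / 2000)" pi 2] pi_approx by (simp add: power2_eq_square)
  have xpos: "x > 0" using nr by (simp add: x_def mu_def)
  have x70: "x \<ge> 70"
  proof (rule power2_le_imp_le)
    have "(9869 / 1000) * 499 \<le> pi\<^sup>2 * (real n - 1)" using pi2 nr by (intro mult_mono) auto
    thus "70\<^sup>2 \<le> x\<^sup>2" unfolding xsq by simp
  qed (use xpos in simp)
  have xy: "x \<le> y" "y \<le> z" by (auto simp: x_def y_def z_def mu_def)
  hence y70: "y \<ge> 70" "z \<ge> 70" using x70 by auto
  have x31: "(31 / 10) * \<nu> \<le> x"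
  proof (rule power2_le_imp_le)
    have "(961 / 100) * real n \<le> (9869 / 1000) * (real n - 1)" using nr by simp
    also have "\<dots> \<le> pi\<^sup>2 * (real n - 1)" using pi2 nr by (intro mult_right_mono) auto
    finally show "((31 / 10) * \<nu>)\<^sup>2 \<le> x\<^sup>2" unfolding xsq power_mult_distrib \<nu>(1) by (simp add: power2_eq_square)
  qed (use xpos in simp)
  define h where "h = 1 / \<nu>"
  have h: "0 < h" "h < 1 / 22" using \<nu> by (auto simp: h_def divide_simps)
  have x5: "1 / x ^ 5 \<le> h ^ 5 / 286"
  proof -
    have "286 * \<nu> ^ 5 \<le> (31 / 10) ^ 5 * \<nu> ^ 5" using \<nu> by (intro mult_right_mono) (auto simp: power_numeral_reduce)
    also have "\<dots> = ((31 / 10) * \<nu>) ^ 5" by (rule power_mult_distrib [symmetric])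
    also have "\<dots> \<le> x ^ 5" using x31 \<nu> by (intro power_mono) auto
    finally have "1 / x ^ 5 \<le> 1 / (286 * \<nu> ^ 5)" using \<nu> xpos by (intro divide_left_mono mult_pos_pos) auto
    thus ?thesis by (simp add: h_def power_divide mult.commute)
  qed
  define M where "M m = exp (mu m) * (1 - 1 / mu m) / (8 * m)" for m :: real
  \<comment> \<open>A common bound for the relative errors at \<open>n - 1\<close>, \<open>n\<close>
    and \<open>n + 1\<close>, since \<open>x\<close> is the smallest of the three arguments.\<close>
  define E where "E = 50 / x ^ 5"
  have E0: "E > 0" using xpos by (simp add: E_def)
  have h5p: "h ^ 5 > 0" and h3p: "h ^ 3 > 0" using h by simp_all
  have "E = 50 * (1 / x ^ 5)" by (simp add: E_def)
  hence Eh: "E \<le> h ^ 5 * (7 / 40)" using x5 h5p by linarith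
  have h5: "h ^ 5 \<le> h ^ 3 * (1 / 484)"
  proof -
    have "h ^ 5 = h ^ 3 * h\<^sup>2" by (simp flip: power_add)
    also have "\<dots> \<le> h ^ 3 * (1 / 22)\<^sup>2" using h by (intro mult_left_mono power_mono) auto
    finally show ?thesis by (simp add: power2_eq_square)
  qed
  have h3: "h ^ 3 \<le> 1 / 10000"
  proof -
    have "h ^ 3 \<le> (1 / 22) ^ 3" using h by (intro power_mono) auto
    thus ?thesis by (simp add: power_numeral_reduce)
  qed
  have est: "\<bar>real (overpart m) - M (real m)\<bar> \<le> E * M (real m)" "M (real m) > 0" if m: "m \<ge> n - 1" for m
  proof -
    have mm: "x \<le> mu (real m)" using m n by (simp add: x_def mu_def)
    hence m70: "mu (real m) \<ge> 70" using x70 by simp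
    have m0: "real m > 0" using m n by simp
    show M0: "M (real m) > 0" using m70 m0 unfolding M_def by (intro divide_pos_pos mult_pos_pos) auto
    have "\<bar>real (overpart m) - M (real m)\<bar> \<le> 50 / mu (real m) ^ 5 * M (real m)"
      using overpart_asymptotic[of m] m70 unfolding M_def mu_def by simp
    also have "\<dots> \<le> E * M (real m)"
      unfolding E_def using mm xpos M0 m70 by (intro mult_right_mono divide_left_mono power_mono mult_pos_pos) auto
    finally show "\<bar>real (overpart m) - M (real m)\<bar> \<le> E * M (real m)" .
  qed
  define p0 p1 p2 where "p0 = real (overpart (n - 1))" and "p1 = real (overpart n)" and "p2 = real (overpart (n + 1))"
  define M0 M1 M2 where "M0 = M (real n - 1)" and "M1 = M (real n)" and "M2 = M (real n + 1)"
  have Mpos: "M0 > 0" "M1 > 0" "M2 > 0"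
    using est(2)[of "n - 1", unfolded n1, OF order.refl] est(2)[of n] est(2)[of "n + 1", unfolded n2]
    by (auto simp: M0_def M1_def M2_def)
  have "\<bar>p0 - M0\<bar> \<le> E * M0" "\<bar>p1 - M1\<bar> \<le> E * M1" "\<bar>p2 - M2\<bar> \<le> E * M2"
    using est(1)[of "n - 1", unfolded n1, OF order.refl] est(1)[of n] est(1)[of "n + 1", unfolded n2]
    by (auto simp: M0_def M1_def M2_def p0_def p1_def p2_def)
  hence b: "M0 * (1 - E) \<le> p0" "p0 \<le> M0 * (1 + E)" "M1 * (1 - E) \<le> p1" "p1 \<le> M1 * (1 + E)"
    "M2 * (1 - E) \<le> p2" "p2 \<le> M2 * (1 + E)" by (auto simp: abs_le_iff algebra_simps)
  have E1: "E \<le> (1 / 100)" using Eh h5 h3 by linarith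
  define U where "U = M0 * M2 / M1\<^sup>2"
  have U0: "U > 0" using Mpos by (simp add: U_def)
  have pM: "M0 * (1 - E) \<ge> 0" "M2 * (1 - E) \<ge> 0" "M1 * (1 - E) > 0" using Mpos E1 by simp_all
  have p1pos: "p1 > 0" using b(3) pM(3) by linarith
  have u: "u_seq n = p0 * p2 / p1\<^sup>2" by (simp add: u_seq_def p0_def p1_def p2_def)
  have ulow: "U * (1 - 4 * E) \<le> u_seq n"
  proof -
    have "(1 - 4 * E) * (1 + E)\<^sup>2 \<le> (1 - E)\<^sup>2"
      using E0 by (simp add: power2_eq_square algebra_simps)
    hence "1 - 4 * E \<le> (1 - E)\<^sup>2 / (1 + E)\<^sup>2" using E0 by (simp add: le_divide_eq)
    hence "U * (1 - 4 * E) \<le> U * ((1 - E)\<^sup>2 / (1 + E)\<^sup>2)" using U0 by (intro mult_left_mono) auto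
    also have "\<dots> = (M0 * (1 - E)) * (M2 * (1 - E)) / (M1 * (1 + E))\<^sup>2"
      by (simp add: U_def power_mult_distrib power2_eq_square mult_ac)
    also have "\<dots> \<le> p0 * p2 / p1\<^sup>2"
      using b pM p1pos by (intro frac_le mult_mono power_mono) (auto intro: order.trans)
    finally show ?thesis unfolding u .
  qed
  have uup: "u_seq n \<le> U * (1 + 5 * E)"
  proof -
    have "p0 * p2 / p1\<^sup>2 \<le> (M0 * (1 + E)) * (M2 * (1 + E)) / (M1 * (1 - E))\<^sup>2"
      using b pM p1pos Mpos E0 by (intro frac_le mult_mono power_mono zero_less_power) (auto intro: order.trans mult_nonneg_nonneg)
    also have "\<dots> = U * ((1 + E)\<^sup>2 / (1 - E)\<^sup>2)"
      by (simp add: U_def power_mult_distrib power2_eq_square mult_ac)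
    also have "(1 + E)\<^sup>2 / (1 - E)\<^sup>2 \<le> 1 + 5 * E"
    proof -
      have "E * E \<le> (1 / 100) * E" using E0 E1 by (intro mult_right_mono) auto
      moreover have "E * E * E \<ge> 0" using E0 by simp
      moreover have "(1 + 5 * E) * (1 - E)\<^sup>2 = 1 + 3 * E - 9 * (E * E) + 5 * (E * E * E)"
        "(1 + E)\<^sup>2 = 1 + 2 * E + E * E"
        by (simp_all add: power2_eq_square algebra_simps)
      ultimately have "(1 + E)\<^sup>2 \<le> (1 + 5 * E) * (1 - E)\<^sup>2" using E0 by linarith
      thus ?thesis using E1 by (simp add: divide_le_eq)
    qed
    finally show ?thesis unfolding u using U0 by simp
  qed
  define R where "R = exp (x - 2 * y + z) * ((real n)\<^sup>2 / ((real n)\<^sup>2 - 1))"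
  have R0: "R \<ge> 0" unfolding R_def using nr by (intro mult_nonneg_nonneg divide_nonneg_nonneg) auto
  define S where "S = (1 - 1 / x) * (1 - 1 / z) / (1 - 1 / y)\<^sup>2"
  have URS: "U = R * S"
  proof -
    have "(real n)\<^sup>2 - 1 = (real n - 1) * (real n + 1)" by (simp add: power2_eq_square algebra_simps)
    moreover have "exp (x - 2 * y + z) = exp x * exp z / (exp y)\<^sup>2"
      by (simp add: exp_diff exp_add exp_double)
    moreover have "(a * A / (8 * k0)) * (c * B / (8 * k2)) / (b * C / (8 * k))\<^sup>2 = a * c / b\<^sup>2 * (k\<^sup>2 / (k0 * k2)) * (A * B / C\<^sup>2)"
      for a b c A B C k k0 k2 :: real
      by (simp add: power2_eq_square mult_ac)
    ultimately show ?thesis unfolding R_def S_def U_def M0_def M1_def M2_def M_def x_def [symmetric] y_def [symmetric] z_def [symmetric]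
      by (simp only:)
  qed
  have inv: "0 < 1 / x" "1 / x \<le> 1 / 70" "0 < 1 / y" "1 / y \<le> 1 / 70" "0 < 1 / z" "1 / z \<le> 1 / 70"
    using x70 y70 by (auto simp: divide_simps)
  have fU: "f_fun n \<le> U"
  proof -
    have "f_fun n = R * ((1 - 1 / x - 1 / x ^ 5) * (1 - 1 / z - 1 / z ^ 5) / (1 - 1 / y + 1 / y ^ 5)\<^sup>2)"
      using f_fun_eq[of n] n by (simp add: R_def x_def y_def z_def)
    also have "\<dots> \<le> R * S"
      unfolding S_def
    proof (intro mult_left_mono frac_le mult_mono power_mono zero_less_power R0)
      have "1 / z ^ 5 \<le> 1 / z ^ 1" using y70 by (intro divide_left_mono power_increasing mult_pos_pos) auto
      hence "1 / z ^ 5 \<le> 1 / z" by simp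
      thus "0 \<le> 1 - 1 / z - 1 / z ^ 5" using inv by linarith
    qed (use inv y70 xpos in auto)
    finally show ?thesis by (simp add: URS)
  qed
  \<comment> \<open>With \<open>P\<close> the geometric mean of \<open>1 / x\<close> and
    \<open>1 / z\<close>, the inequality of the means bounds the numerator by the square of
    \<open>1 - P\<close>, and \<open>x * z \<le> y\<^sup>2\<close> gives
    \<open>1 / y \<le> P\<close>.\<close>
  have S1: "S \<le> 1"
  proof -
    define P where "P = 1 / sqrt (x * z)"
    have zpos: "z > 0" "y > 0" using y70 by auto
    have P2: "P * P = 1 / (x * z)" using xpos zpos by (simp add: P_def)
    have "x * z \<le> y\<^sup>2"
    proof -
      have "(real n - 1) * (real n + 1) \<le> (real n)\<^sup>2" by (simp add: power2_eq_square algebra_simps)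
      hence "sqrt (real n - 1) * sqrt (real n + 1) \<le> real n"
        unfolding real_sqrt_mult [symmetric] by (intro real_le_lsqrt) auto
      hence "pi * pi * (sqrt (real n - 1) * sqrt (real n + 1)) \<le> pi * pi * real n" by (intro mult_left_mono) auto
      thus ?thesis by (simp add: x_def y_def z_def mu_def power_mult_distrib power2_eq_square mult_ac)
    qed
    hence "sqrt (x * z) \<le> y" using zpos by (intro real_le_lsqrt) auto
    hence yP: "1 / y \<le> P" unfolding P_def using xpos zpos by (intro divide_left_mono mult_pos_pos) auto
    have P1: "P \<le> 1"
    proof -
      have "1 * 1 \<le> x * z" using x70 y70 by (intro mult_mono) auto
      thus ?thesis by (simp add: P_def)
    qed
    have "2 * P \<le> 1 / x + 1 / z"
    proof -
      have "0 \<le> (sqrt (1 / x) - sqrt (1 / z))\<^sup>2" by simp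
      also have "\<dots> = 1 / x + 1 / z - 2 * (sqrt (1 / x) * sqrt (1 / z))" using inv by (simp add: power2_diff)
      also have "sqrt (1 / x) * sqrt (1 / z) = P" by (simp add: P_def real_sqrt_mult real_sqrt_divide)
      finally show ?thesis by simp
    qed
    hence "(1 - 1 / x) * (1 - 1 / z) \<le> (1 - P)\<^sup>2"
      using P2 by (simp add: power2_eq_square algebra_simps)
    also have "\<dots> \<le> (1 - 1 / y)\<^sup>2" using yP P1 by (intro power_mono) auto
    finally have "(1 - 1 / x) * (1 - 1 / z) \<le> 1 * (1 - 1 / y)\<^sup>2" by simp
    moreover have "(1 - 1 / y)\<^sup>2 > 0" using inv by (intro zero_less_power) simp
    ultimately show ?thesis unfolding S_def by (simp only: divide_le_eq if_True)
  qed
  \<comment> \<open>The second difference of the roots yields \<open>pi / 4 * h ^ 3\<close> with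
    \<open>pi / 4 \<ge> 157 / 200\<close>. The quadratic term of the exponential and the factor
    \<open>n\<^sup>2 / (n\<^sup>2 - 1)\<close>, whose excess over 1 is of order
    \<open>h ^ 4\<close>, reduce this to \<open>7 / 10\<close>.\<close>
  have R1: "R \<le> 1 - (7 / 10) * h ^ 3"
  proof -
    define t where "t = (157 / 200) * h ^ 3"
    have t: "0 \<le> t" "t \<le> 1 / 10000" using h3 h by (auto simp: t_def)
    have "x - 2 * y + z = pi * (sqrt (real n - 1) + sqrt (real n + 1) - 2 * sqrt (real n))"
      by (simp add: x_def y_def z_def mu_def algebra_simps)
    also have "\<dots> \<le> pi * (- 1 / (4 * sqrt (real n) ^ 3))"
      using nr by (intro mult_left_mono second_difference_sqrt) auto
    also have "\<dots> = - (pi / 4) * h ^ 3" by (simp add: h_def \<nu>_def power_divide)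
    also have "\<dots> \<le> - t"
    proof -
      have "(157 / 200) * h ^ 3 \<le> pi / 4 * h ^ 3" using pi_approx h by (intro mult_right_mono) auto
      thus ?thesis by (simp add: t_def)
    qed
    finally have "exp (x - 2 * y + z) \<le> exp (- t)" by simp
    also have "\<dots> \<le> 1 - t + t\<^sup>2 / 2" by (rule exp_minus_le_quadratic[OF t(1)])
    also have "t\<^sup>2 \<le> t * (1 / 10000)" unfolding power2_eq_square using t by (intro mult_left_mono) auto
    finally have e: "exp (x - 2 * y + z) \<le> 1 - (39 / 50) * h ^ 3" using h3p unfolding t_def by linarith
    have r: "(real n)\<^sup>2 / ((real n)\<^sup>2 - 1) \<le> 1 + (1 / 20) * h ^ 3"
    proof -
      have nn: "(real n)\<^sup>2 = \<nu> ^ 4" by (simp add: \<nu>(1) [symmetric] flip: power_mult)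
      have "\<nu> ^ 3 * 22 \<le> \<nu> ^ 3 * \<nu>" using \<nu> by (intro mult_left_mono) auto
      hence n4: "22 * \<nu> ^ 3 \<le> (real n)\<^sup>2" unfolding nn by (simp add: power_numeral_reduce mult_ac)
      have n3: "\<nu> ^ 3 \<ge> 22 ^ 3" using \<nu> by (intro power_mono) auto
      hence n5: "20 * \<nu> ^ 3 \<le> (real n)\<^sup>2 - 1" using n4 by simp
      have "(real n)\<^sup>2 / ((real n)\<^sup>2 - 1) = 1 + 1 / ((real n)\<^sup>2 - 1)"
        using n5 n3 by (simp add: divide_simps)
      also have "1 / ((real n)\<^sup>2 - 1) \<le> 1 / (20 * \<nu> ^ 3)"
        using n5 n3 \<nu>(2) by (intro divide_left_mono mult_pos_pos) auto
      also have "1 / (20 * \<nu> ^ 3) = (1 / 20) * h ^ 3" by (simp add: h_def power_divide)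
      finally show ?thesis by simp
    qed
    have "R \<le> (1 - (39 / 50) * h ^ 3) * (1 + (1 / 20) * h ^ 3)"
      unfolding R_def using e r nr h3 by (intro mult_mono) auto
    also have "\<dots> \<le> 1 - (7 / 10) * h ^ 3"
    proof -
      have "h ^ 3 * h ^ 3 \<ge> 0" using h by simp
      moreover have "(1 - (39 / 50) * h ^ 3) * (1 + (1 / 20) * h ^ 3) = 1 - (73 / 100) * h ^ 3 - (39 / 1000) * (h ^ 3 * h ^ 3)"
        by (simp add: algebra_simps)
      moreover have "h ^ 3 \<ge> 0" using h by simp
      ultimately show ?thesis by linarith
    qed
    finally show ?thesis .
  qed
  have U1: "U \<le> 1 - (7 / 10) * h ^ 3"
  proof -
    have "U \<le> R * 1" unfolding URS using S1 R0 by (intro mult_left_mono) auto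
    thus ?thesis using R1 by simp
  qed
  \<comment> \<open>Its root is the largest witness that \<open>less_Q_I\<close> admits when
    \<open>f_fun n\<close> is replaced by its bound \<open>U\<close>.\<close>
  define g where "g = 1 - U - 1000 / x ^ 5"
  have g: "(16 / 25) * h ^ 3 \<le> g" "g < 1"
  proof -
    have "1000 / x ^ 5 = 1000 * (1 / x ^ 5)" by simp
    hence "1000 / x ^ 5 \<le> (1 / 100) * h ^ 3" using x5 h5 h3p by linarith
    thus "(16 / 25) * h ^ 3 \<le> g" using U1 h3p unfolding g_def by linarith
    have "1000 / x ^ 5 > 0" using xpos by simp
    thus "g < 1" using U0 unfolding g_def by linarith
  qed
  have g0: "g > 0" using g(1) h3p by linarith
  define v where "v = sqrt g"
  have v: "v\<^sup>2 = g" "v > 0" "v < 1" using g g0 by (auto simp: v_def)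
  \<comment> \<open>Here 1200 is 1000 plus 4 times the 50 in \<open>E\<close>, so
    \<open>1 - u_seq n\<close> is at most \<open>v\<^sup>2 + \<delta>\<close>. Since
    \<open>(1 + 2 * v) * (1 - v)\<^sup>2\<close> is at most 1, \<open>less_Q_I\<close> tolerates any
    \<open>\<delta>\<close> below \<open>2 * v ^ 3\<close>. Squared, this compares a multiple of
    \<open>h ^ 10\<close> with one of \<open>h ^ 9\<close>.\<close>
  define \<delta> where "\<delta> = 1200 / x ^ 5"
  have \<delta>: "\<delta> < 2 * v ^ 3"
  proof (rule power2_less_imp_less)
    have "\<delta> = 1200 * (1 / x ^ 5)" by (simp add: \<delta>_def)
    hence "\<delta> \<le> (21 / 5) * h ^ 5" using x5 h5p by linarith
    hence "\<delta>\<^sup>2 \<le> ((21 / 5) * h ^ 5)\<^sup>2" using xpos by (intro power_mono) (auto simp: \<delta>_def)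
    also have "\<dots> = (441 / 25) * h * h ^ 9" by (simp add: power_mult_distrib power_numeral_reduce)
    also have "\<dots> \<le> (441 / 25) * (1 / 22) * h ^ 9" using h by (intro mult_right_mono) auto
    also have "\<dots> < 4 * (16 / 25) ^ 3 * h ^ 9" using h by (simp add: power_numeral_reduce)
    also have "\<dots> = 4 * ((16 / 25) * h ^ 3) ^ 3"
      unfolding power_mult_distrib by (simp flip: power_mult)
    also have "\<dots> \<le> 4 * g ^ 3" using g(1) h by (intro mult_left_mono power_mono) auto
    also have "\<dots> = (2 * v ^ 3)\<^sup>2" unfolding v(1) [symmetric] by (simp add: power_mult_distrib flip: power_mult)
    finally show "\<delta>\<^sup>2 < (2 * v ^ 3)\<^sup>2" .
  qed (use v in simp)
  show ?thesis unfolding x_def [symmetric]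
  proof (rule less_Q_I[of _ v])
    have "0 < U * (1 - 4 * E)" using E1 U0 by (intro mult_pos_pos) auto
    thus u0: "0 < u_seq n" using ulow by linarith
    have "U * (1 + 5 * E) \<le> (1 - (7 / 10) * h ^ 3) * (1 + 5 * E)" using U1 E0 by (intro mult_right_mono) auto
    also have "\<dots> \<le> 1 - (7 / 10) * h ^ 3 + 5 * E"
    proof -
      have "h ^ 3 * E \<ge> 0" using E0 h3p by simp
      moreover have "(1 - (7 / 10) * h ^ 3) * (1 + 5 * E) = 1 - (7 / 10) * h ^ 3 + 5 * E - (7 / 2) * (h ^ 3 * E)"
        by (simp add: algebra_simps)
      ultimately show ?thesis by linarith
    qed
    also have "\<dots> \<le> 1" using Eh h5 h3p by linarith
    finally show u1: "u_seq n \<le> 1" using uup by linarith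
    show "0 \<le> v" "v < 1" using v by auto
    show "v\<^sup>2 \<le> 1 - (f_fun n + 1000 / x ^ 5)" using fU by (simp add: v g_def)
    have "U \<le> 1" using U1 h3p by linarith
    hence "U * (4 * E) \<le> 1 * (4 * E)" using E0 by (intro mult_right_mono) auto
    hence "1 - u_seq n \<le> 1 - U + 4 * E" using ulow by (simp add: algebra_simps)
    also have "\<dots> = v\<^sup>2 + \<delta>" by (simp add: v g_def E_def \<delta>_def)
    also have "\<dots> < v\<^sup>2 * (1 + 2 * v)" using \<delta> by (simp add: power2_eq_square power3_eq_cube algebra_simps)
    finally have "(1 - u_seq n) * (1 - v)\<^sup>2 < v\<^sup>2 * (1 + 2 * v) * (1 - v)\<^sup>2"
      using v by (intro mult_strict_right_mono) auto
    also have "\<dots> = v\<^sup>2 * (1 - v\<^sup>2 * (3 - 2 * v))" by (simp add: power2_eq_square algebra_simps)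
    also have "\<dots> \<le> v\<^sup>2 * 1"
      using v by (intro mult_left_mono) (auto intro!: mult_nonneg_nonneg)
    finally show "(1 - u_seq n) * (1 - v)\<^sup>2 < v\<^sup>2" by simp
  qed
qed

section \<open>Small arguments\<close>

text \<open>Numbers are represented in fixed point, in units of \<open>2 ^ - 40\<close>; the numerators \<open>9869604401070\<close> and
  \<open>9869604401100\<close> are bounds for \<open>10 ^ 12 * pi\<^sup>2\<close>, and \<open>2712936200131\<close> is a lower bound for \<open>2 ^ 40 * pi\<^sup>2 / 4\<close>.\<close>
definition inv_mu_approx :: "int \<Rightarrow> int \<Rightarrow> bool" where
  "inv_mu_approx k r \<longleftrightarrow> 0 < r \<and> r * r * k * 9869604401100 \<le> 10 ^ 12 * 2 ^ 80 \<and>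
     10 ^ 12 * 2 ^ 80 \<le> (r + 2) * (r + 2) * k * 9869604401070"

text \<open>Truncation to units of \<open>2 ^ - 23\<close> keeps the fifth power short; it is in
  units of \<open>2 ^ - 115\<close>, and a shift by 75 returns to \<open>2 ^ - 40\<close>.\<close>

definition fifth_low :: "int \<Rightarrow> int" where
  "fifth_low r = drop_bit 75 (drop_bit 17 r ^ 5)"

text \<open>The summand 2 covers both the truncation by 17 bits and the uncertainty
  \<open>r + 2\<close> of the approximation itself; the final 1 compensates for the last
  shift.\<close>

definition fifth_up :: "int \<Rightarrow> int" where
  "fifth_up r = drop_bit 75 ((drop_bit 17 r + 2) ^ 5) + 1"

text \<open>Upper bound for a numerator factor of \<open>f_fun_eq\<close>; \<open>den_low\<close> is
  the matching lower bound for the denominator.\<close>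

definition num_up :: "int \<Rightarrow> int" where
  "num_up r = 2 ^ 40 - r - fifth_low r"

definition den_low :: "int \<Rightarrow> int" where
  "den_low r = 2 ^ 40 - (r + 2) + fifth_low r"

text \<open>Lower bound for \<open>pi\<^sup>2 / 4 * (1 / mu n)\<close>. Divided by \<open>n\<close>
  this is \<open>pi / (4 * sqrt n ^ 3)\<close>, the bound from
  \<open>second_difference_sqrt\<close>, without a further root or approximation of
  \<open>pi\<close>.\<close>

definition exp_arg_low :: "int \<Rightarrow> int" where
  "exp_arg_low r = drop_bit 40 (2712936200131 * r)"

text \<open>After squaring, only \<open>pi\<^sup>2 * k\<close> occurs, so no square root has to be
  evaluated to check an approximation.\<close>

lemma inv_mu_approxD:
  assumes "inv_mu_approx (int k) r" and k: "k > 0"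
  shows "real_of_int r / 2 ^ 40 \<le> 1 / mu (real k)" "1 / mu (real k) \<le> (real_of_int r + 2) / 2 ^ 40"
proof -
  define R where "R = real_of_int r"
  have R: "R > 0" using assms(1) by (simp add: R_def inv_mu_approx_def)
  have "real_of_int (r * r * int k * 9869604401100) \<le> real_of_int (10 ^ 12 * 2 ^ 80)"
    "real_of_int (10 ^ 12 * 2 ^ 80) \<le> real_of_int ((r + 2) * (r + 2) * int k * 9869604401070)"
    using assms(1) unfolding inv_mu_approx_def of_int_le_iff by auto
  hence b: "R * R * real k * 9869604401100 \<le> 10 ^ 12 * 2 ^ 80" "10 ^ 12 * 2 ^ 80 \<le> (R + 2) * (R + 2) * real k * 9869604401070"
    by (simp_all add: R_def)
  define m where "m = mu (real k)"
  have m: "m > 0" "m\<^sup>2 = pi\<^sup>2 * real k" using k by (simp_all add: m_def mu_def power_mult_distrib)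
  have pi_up: "pi\<^sup>2 \<le> 9869604401100 / 10 ^ 12"
  proof -
    have "pi\<^sup>2 \<le> (31415926535899 / 10 ^ 13)\<^sup>2" by (rule power_mono) (use pi_approx in auto)
    also have "\<dots> \<le> 9869604401100 / 10 ^ 12" by (simp add: power2_eq_square)
    finally show ?thesis .
  qed
  have pi_low: "9869604401070 / 10 ^ 12 \<le> pi\<^sup>2"
  proof -
    have "9869604401070 / 10 ^ 12 \<le> (3141592653588 / 10 ^ 12 :: real)\<^sup>2" by (simp add: power2_eq_square)
    also have "\<dots> \<le> pi\<^sup>2" by (rule power_mono) (use pi_approx in auto)
    finally show ?thesis .
  qed
  have "(R / 2 ^ 40 * m)\<^sup>2 \<le> 1\<^sup>2"
  proof -
    have "(R / 2 ^ 40 * m)\<^sup>2 = R * R * real k * pi\<^sup>2 / 2 ^ 80"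
      unfolding power_mult_distrib m(2) by (simp add: power2_eq_square)
    also have "\<dots> \<le> R * R * real k * (9869604401100 / 10 ^ 12) / 2 ^ 80"
      using R pi_up by (intro divide_right_mono mult_left_mono) auto
    also have "\<dots> \<le> 1" using b(1) by simp
    finally show ?thesis by simp
  qed
  hence "R / 2 ^ 40 * m \<le> 1" by (rule power2_le_imp_le) simp
  thus "real_of_int r / 2 ^ 40 \<le> 1 / mu (real k)"
    using m by (simp add: R_def m_def le_divide_eq)
  have "1\<^sup>2 \<le> ((R + 2) / 2 ^ 40 * m)\<^sup>2"
  proof -
    define Y where "Y = (R + 2) * (R + 2) * real k"
    have "1 \<le> Y * (9869604401070 / 10 ^ 12) / 2 ^ 80" using b(2) unfolding Y_def [symmetric] by simp
    hence "1 \<le> (R + 2) * (R + 2) * real k * (9869604401070 / 10 ^ 12) / 2 ^ 80" unfolding Y_def .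
    also have "(R + 2) * (R + 2) * real k * (9869604401070 / 10 ^ 12) / 2 ^ 80 \<le> (R + 2) * (R + 2) * real k * pi\<^sup>2 / 2 ^ 80"
      using R pi_low by (intro divide_right_mono mult_left_mono) auto
    also have "\<dots> = ((R + 2) / 2 ^ 40 * m)\<^sup>2"
      unfolding power_mult_distrib m(2) by (simp add: power2_eq_square)
    finally show ?thesis by simp
  qed
  hence "1 \<le> (R + 2) / 2 ^ 40 * m" by (rule power2_le_imp_le) (use R m in auto)
  thus "1 / mu (real k) \<le> (real_of_int r + 2) / 2 ^ 40"
    using m by (simp add: R_def m_def divide_le_eq)
qed

lemma real_drop_bit_bounds:
  fixes x :: int
  shows "real_of_int (drop_bit m x) * 2 ^ m \<le> real_of_int x"
    "real_of_int x \<le> (real_of_int (drop_bit m x) + 1) * 2 ^ m"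
proof -
  have "drop_bit m x * 2 ^ m + x mod 2 ^ m = x" unfolding drop_bit_eq_div by (rule div_mult_mod_eq)
  moreover have "0 \<le> x mod 2 ^ m" "x mod 2 ^ m < 2 ^ m" by simp_all
  moreover have "(drop_bit m x + 1) * 2 ^ m = drop_bit m x * 2 ^ m + 2 ^ m" by (simp add: distrib_right)
  ultimately have "drop_bit m x * 2 ^ m \<le> x" "x \<le> (drop_bit m x + 1) * 2 ^ m" by linarith+
  hence "real_of_int (drop_bit m x * 2 ^ m) \<le> real_of_int x" "real_of_int x \<le> real_of_int ((drop_bit m x + 1) * 2 ^ m)"
    by (simp_all only: of_int_le_iff)
  thus "real_of_int (drop_bit m x) * 2 ^ m \<le> real_of_int x"
    "real_of_int x \<le> (real_of_int (drop_bit m x) + 1) * 2 ^ m"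
    by simp_all
qed

lemma fifth_bounds:
  assumes r: "r > 0" and a: "real_of_int r / 2 ^ 40 \<le> a" "a \<le> (real_of_int r + 2) / 2 ^ 40"
  shows "real_of_int (fifth_low r) / 2 ^ 40 \<le> a ^ 5" "a ^ 5 \<le> real_of_int (fifth_up r) / 2 ^ 40"
proof -
  define s where "s = drop_bit 17 r"
  have s0: "s \<ge> 0" using r by (simp add: s_def)
  note sb = real_drop_bit_bounds[where m = 17 and x = r, folded s_def]
  have "a \<ge> 0" using r a(1) by (intro order.trans[OF _ a(1)]) simp
  have low: "real_of_int s / 2 ^ 23 \<le> a" using sb(1) a(1) by simp
  have up: "a \<le> (real_of_int s + 2) / 2 ^ 23" using sb(2) a(2) by simp
  have "real_of_int (fifth_low r) / 2 ^ 40 \<le> (real_of_int s / 2 ^ 23) ^ 5"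
    using real_drop_bit_bounds(1)[where m = 75 and x = "s ^ 5"] by (simp add: fifth_low_def s_def power_divide)
  also have "\<dots> \<le> a ^ 5" using low s0 by (intro power_mono) auto
  finally show "real_of_int (fifth_low r) / 2 ^ 40 \<le> a ^ 5" .
  have "a ^ 5 \<le> ((real_of_int s + 2) / 2 ^ 23) ^ 5" using up \<open>a \<ge> 0\<close> by (intro power_mono) auto
  also have "\<dots> \<le> real_of_int (fifth_up r) / 2 ^ 40"
    using real_drop_bit_bounds(2)[where m = 75 and x = "(s + 2) ^ 5"] by (simp add: fifth_up_def s_def power_divide)
  finally show "a ^ 5 \<le> real_of_int (fifth_up r) / 2 ^ 40" .
qed

text \<open>The bound on \<open>v\<^sup>2\<close> in \<open>less_Q_I\<close>, scaled by
  \<open>2 ^ 46\<close> and cleared of denominators, with \<open>v = V / 2 ^ 23\<close>. The sum of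
  two squares is \<open>1 - t + t\<^sup>2 / 2\<close>, a bound for \<open>exp (- t)\<close>, times
  \<open>2 * (n * 2 ^ 40)\<^sup>2\<close>. The number 64000 is \<open>1000 * 2 ^ 6\<close>, and the
  powers of two that remain combine to \<open>2 ^ 35\<close>.\<close>

definition check_numeric :: "int \<Rightarrow> int \<Rightarrow> int \<Rightarrow> int \<Rightarrow> int \<Rightarrow> bool" where
  "check_numeric n r0 r1 r2 V \<longleftrightarrow> 0 < den_low r1 \<and>
     ((n * 2 ^ 40 - exp_arg_low r1)\<^sup>2 + (n * 2 ^ 40)\<^sup>2) * (num_up r0 * num_up r2) \<le>
     (2 ^ 46 - V * V - 64000 * fifth_up r0) * (2 ^ 35 * (n * n - 1)) * (den_low r1 * den_low r1)"

lemma check_numeric_sound: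
  assumes n: "n \<ge> 92"
    and r: "inv_mu_approx (int n - 1) r0" "inv_mu_approx (int n) r1" "inv_mu_approx (int n + 1) r2"
    and chk: "check_numeric (int n) r0 r1 r2 V"
  shows "(real_of_int V / 2 ^ 23)\<^sup>2 \<le> 1 - (f_fun n + 1000 / mu (real n - 1) ^ 5)"
proof -
  have nr: "real n \<ge> 92" using n by simp
  have ki: "int (n - 1) = int n - 1" "int (n + 1) = int n + 1" "real (n - 1) = real n - 1" "real (n + 1) = real n + 1"
    using n by (simp_all add: of_nat_diff)
  define x y z where "x = mu (real n - 1)" and "y = mu (real n)" and "z = mu (real n + 1)"
  define a b c where "a = 1 / x" and "b = 1 / y" and "c = 1 / z"
  have x9: "x \<ge> 27"
  proof -
    have "3 * 9 \<le> pi * sqrt (real n - 1)"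
      using pi_gt3 nr by (intro mult_mono real_le_rsqrt) auto
    thus ?thesis by (simp add: x_def mu_def)
  qed
  have xyz: "x \<le> y" "y \<le> z" by (auto simp: x_def y_def z_def mu_def)
  have pos: "0 < a" "a \<le> 1 / 27" "0 < b" "b \<le> 1 / 27" "0 < c" "c \<le> 1 / 27"
    using x9 xyz by (auto simp: a_def b_def c_def divide_simps)
  note ra = inv_mu_approxD[of "n - 1" r0, unfolded ki, OF r(1), folded x_def a_def]
  note rb = inv_mu_approxD[of n r1, OF r(2), folded y_def b_def]
  note rc = inv_mu_approxD[of "n + 1" r2, unfolded ki, OF r(3), folded z_def c_def]
  have ra: "real_of_int r0 / 2 ^ 40 \<le> a" "a \<le> (real_of_int r0 + 2) / 2 ^ 40" using ra n by auto
  have rb: "real_of_int r1 / 2 ^ 40 \<le> b" "b \<le> (real_of_int r1 + 2) / 2 ^ 40" using rb n by auto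
  have rc: "real_of_int r2 / 2 ^ 40 \<le> c" "c \<le> (real_of_int r2 + 2) / 2 ^ 40" using rc n by auto
  have r0: "r0 > 0" "r1 > 0" "r2 > 0" using r by (auto simp: inv_mu_approx_def)
  note fa = fifth_bounds[OF r0(1) ra] and fb = fifth_bounds[OF r0(2) rb] and fc = fifth_bounds[OF r0(3) rc]
  define A C B where "A = real_of_int (num_up r0)" and "C = real_of_int (num_up r2)"
    and "B = real_of_int (den_low r1)"
  define E where "E = (real n * 2 ^ 40 - real_of_int (exp_arg_low r1))\<^sup>2 + (real n * 2 ^ 40)\<^sup>2"
  have A: "1 - a - a ^ 5 \<le> A / 2 ^ 40" using ra(1) fa(1) by (simp add: A_def num_up_def diff_divide_distrib)
  have C: "1 - c - c ^ 5 \<le> C / 2 ^ 40" using rc(1) fc(1) by (simp add: C_def num_up_def diff_divide_distrib)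
  have B: "B / 2 ^ 40 \<le> 1 - b + b ^ 5"
    using rb(2) fb(1) by (simp add: B_def den_low_def diff_divide_distrib add_divide_distrib)
  have B0: "B > 0" using chk by (simp add: B_def check_numeric_def)
  have a5: "a ^ 5 \<le> a ^ 1" "c ^ 5 \<le> c ^ 1" using pos by (intro power_decreasing; simp)+
  have nonneg: "0 \<le> 1 - a - a ^ 5" "0 \<le> 1 - c - c ^ 5" using a5 pos by auto
  have e: "exp (x - 2 * y + z) \<le> E / (2 * (real n * 2 ^ 40)\<^sup>2)"
  proof -
    define \<tau> where "\<tau> = real_of_int (exp_arg_low r1)"
    define t where "t = \<tau> / (real n * 2 ^ 40)"
    have \<tau>0: "\<tau> \<ge> 0" using r0 by (simp add: \<tau>_def exp_arg_low_def)
    have pi_low: "2712936200131 / 2 ^ 40 \<le> pi\<^sup>2 / 4"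
    proof -
      have "4 * (2712936200131 / 2 ^ 40) \<le> (3141592653588 / 10 ^ 12 :: real)\<^sup>2" by (simp add: power2_eq_square)
      also have "\<dots> \<le> pi\<^sup>2" by (rule power_mono) (use pi_approx in auto)
      finally show ?thesis by simp
    qed
    have "\<tau> / 2 ^ 40 \<le> 2712936200131 / 2 ^ 40 * (real_of_int r1 / 2 ^ 40)"
      using real_drop_bit_bounds(1)[where m = 40 and x = "2712936200131 * r1"] by (simp add: \<tau>_def exp_arg_low_def)
    also have "\<dots> \<le> pi\<^sup>2 / 4 * b" using pi_low rb(1) r0 by (intro mult_mono) auto
    finally have "t * real n \<le> pi\<^sup>2 / 4 * b" using nr by (simp add: t_def)
    hence "t \<le> pi\<^sup>2 / 4 * b / real n" using nr by (simp add: le_divide_eq)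
    also have "\<dots> = pi / (4 * sqrt (real n) ^ 3)"
    proof -
      have "real n = sqrt (real n) * sqrt (real n)" by simp
      thus ?thesis by (simp add: b_def y_def mu_def power2_eq_square power3_eq_cube)
    qed
    finally have tpi: "t \<le> pi / (4 * sqrt (real n) ^ 3)" .
    have "x - 2 * y + z = pi * (sqrt (real n - 1) + sqrt (real n + 1) - 2 * sqrt (real n))"
      by (simp add: x_def y_def z_def mu_def algebra_simps)
    also have "\<dots> \<le> pi * (- 1 / (4 * sqrt (real n) ^ 3))"
      using nr by (intro mult_left_mono second_difference_sqrt) auto
    also have "\<dots> \<le> - t" using tpi by simp
    finally have "exp (x - 2 * y + z) \<le> exp (- t)" by simp
    also have "\<dots> \<le> 1 - t + t\<^sup>2 / 2" by (rule exp_minus_le_quadratic) (use \<tau>0 in \<open>simp add: t_def\<close>)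
    also have "\<dots> = E / (2 * (real n * 2 ^ 40)\<^sup>2)"
    proof -
      have "1 - t + t\<^sup>2 / 2 = ((M - M * t)\<^sup>2 + M\<^sup>2) / (2 * M\<^sup>2)" if "M > 0" for M :: real
        using that by (simp add: field_simps power2_eq_square)
      from this[of "real n * 2 ^ 40"] show ?thesis using nr by (simp add: E_def \<tau>_def t_def)
    qed
    finally show ?thesis .
  qed
  \<comment> \<open>\<open>2 ^ 46\<close> times the room left for \<open>f_fun n\<close> once the
    square of \<open>V / 2 ^ 23\<close> and the term with 1000 have been subtracted from 1.\<close>
  define W where "W = 2 ^ 46 - real_of_int V * real_of_int V - 64000 * real_of_int (fifth_up r0)"
  have n2: "real n * real n - 1 > 0" using mult_mono[of 92 "real n" 92 "real n"] nr by simp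
  have chk': "E * (A * C) \<le> W * (2 ^ 35 * (real n * real n - 1)) * (B * B)"
  proof -
    have "real_of_int (((int n * 2 ^ 40 - exp_arg_low r1)\<^sup>2 + (int n * 2 ^ 40)\<^sup>2) * (num_up r0 * num_up r2)) \<le>
      real_of_int ((2 ^ 46 - V * V - 64000 * fifth_up r0) * (2 ^ 35 * (int n * int n - 1)) * (den_low r1 * den_low r1))"
      using chk unfolding check_numeric_def of_int_le_iff by blast
    thus ?thesis by (simp add: E_def A_def B_def C_def W_def)
  qed
  have "f_fun n = exp (x - 2 * y + z) * ((real n)\<^sup>2 / ((real n)\<^sup>2 - 1)) * ((1 - a - a ^ 5) * (1 - c - c ^ 5) / (1 - b + b ^ 5)\<^sup>2)"
    using f_fun_eq[of n] n by (simp add: x_def y_def z_def a_def b_def c_def power_divide)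
  also have "\<dots> \<le> E / (2 * (real n * 2 ^ 40)\<^sup>2) * ((real n)\<^sup>2 / ((real n)\<^sup>2 - 1)) * (A / 2 ^ 40 * (C / 2 ^ 40) / (B / 2 ^ 40)\<^sup>2)"
  proof -
    have E0: "0 \<le> E / (2 * (real n * 2 ^ 40)\<^sup>2)" by (rule order.trans[OF _ e]) simp
    have N0: "0 \<le> (real n)\<^sup>2 / ((real n)\<^sup>2 - 1)" using n2 by (simp add: power2_eq_square)
    have A0: "0 \<le> A / 2 ^ 40" and C0: "0 \<le> C / 2 ^ 40" using nonneg A C by linarith+
    show ?thesis
    proof (rule mult_mono)
      show "exp (x - 2 * y + z) * ((real n)\<^sup>2 / ((real n)\<^sup>2 - 1)) \<le> E / (2 * (real n * 2 ^ 40)\<^sup>2) * ((real n)\<^sup>2 / ((real n)\<^sup>2 - 1))"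
        by (rule mult_right_mono[OF e N0])
      show "(1 - a - a ^ 5) * (1 - c - c ^ 5) / (1 - b + b ^ 5)\<^sup>2 \<le> A / 2 ^ 40 * (C / 2 ^ 40) / (B / 2 ^ 40)\<^sup>2"
        using A C A0 C0 B B0 nonneg by (intro frac_le mult_mono power_mono mult_nonneg_nonneg zero_less_power) auto
      show "0 \<le> E / (2 * (real n * 2 ^ 40)\<^sup>2) * ((real n)\<^sup>2 / ((real n)\<^sup>2 - 1))" by (rule mult_nonneg_nonneg[OF E0 N0])
      show "0 \<le> (1 - a - a ^ 5) * (1 - c - c ^ 5) / (1 - b + b ^ 5)\<^sup>2"
        using nonneg by (intro divide_nonneg_nonneg mult_nonneg_nonneg) auto
    qed
  qed
  also have "\<dots> = E * (A * C) / (2 ^ 35 * (real n * real n - 1) * (B * B)) / 2 ^ 46"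
  proof -
    have "E / (2 * (N * T)\<^sup>2) * (N\<^sup>2 / D) * (A / T * (C / T) / (B / T)\<^sup>2) = E * (A * C) / (2 * T\<^sup>2 * D * (B * B))"
      if "N > 0" "T > 0" for N T D :: real
      using that by (simp add: power2_eq_square field_simps)
    from this[of "real n" "2 ^ 40" "(real n)\<^sup>2 - 1"] show ?thesis using nr by (simp add: power2_eq_square)
  qed
  also have "\<dots> \<le> W / 2 ^ 46"
    using chk' n2 B0 by (intro divide_right_mono) (simp_all add: divide_le_eq mult.assoc)
  finally have f: "f_fun n \<le> W / 2 ^ 46" .
  have "1000 / x ^ 5 = 1000 * a ^ 5" by (simp add: a_def power_divide)
  hence "1000 / x ^ 5 \<le> 1000 * (real_of_int (fifth_up r0) / 2 ^ 40)" using fa(2) by simp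
  moreover have "W / 2 ^ 46 = 1 - (real_of_int V / 2 ^ 23)\<^sup>2 - 1000 * (real_of_int (fifth_up r0) / 2 ^ 40)"
    by (simp add: W_def power2_eq_square diff_divide_distrib)
  ultimately show ?thesis using f unfolding x_def by linarith
qed

text \<open>The last hypothesis of \<open>less_Q_I\<close>, multiplied by \<open>2 ^ 46 * P\<close>.
  Here \<open>P\<close> stands for the square of \<open>overpart n\<close>, \<open>R\<close> for the
  product of its two neighbours, and \<open>R \<le> P\<close> expresses
  \<open>u_seq n \<le> 1\<close>.\<close>

definition check_overpart :: "int \<Rightarrow> int \<Rightarrow> int \<Rightarrow> bool" where
  "check_overpart V P R \<longleftrightarrow> 0 < V \<and> V < 2 ^ 23 \<and> 0 < R \<and> R \<le> P \<and> (P - R) * (2 ^ 23 - V)\<^sup>2 < (V * V) * P"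

section \<open>Exact values of \<open>overpart\<close> and the run through the certificate\<close>

definition overpart_int :: "int \<Rightarrow> int" where
  "overpart_int n = int (overpart (nat n))"

lemma less_Q_of_checks:
  assumes n: "n \<ge> 92"
    and r: "inv_mu_approx (int n - 1) r0" "inv_mu_approx (int n) r1" "inv_mu_approx (int n + 1) r2"
    and chk: "check_numeric (int n) r0 r1 r2 V"
    and chk2: "check_overpart V (overpart_int (int n) * overpart_int (int n)) (overpart_int (int n - 1) * overpart_int (int n + 1))"
  shows "f_fun n + 1000 / mu (real n - 1) ^ 5 < Q (u_seq n)"
proof (rule less_Q_I[OF _ _ _ _ check_numeric_sound[OF n r chk]])
  define p0 p1 p2 where "p0 = real (overpart (n - 1))" and "p1 = real (overpart n)" and "p2 = real (overpart (n + 1))"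
  define v where "v = real_of_int V / 2 ^ 23"
  have ip: "nat (int n - 1) = n - 1" "nat (int n + 1) = n + 1" using n by auto
  define P R where "P = int (overpart n) * int (overpart n)" and "R = int (overpart (n - 1)) * int (overpart (n + 1))"
  have c: "0 < V" "V < 2 ^ 23" "0 < R" "R \<le> P" "(P - R) * (2 ^ 23 - V)\<^sup>2 < (V * V) * P"
    using chk2 unfolding check_overpart_def overpart_int_def ip nat_int P_def R_def by blast+
  have PR: "real_of_int P = p1\<^sup>2" "real_of_int R = p0 * p2"
    by (simp_all add: P_def R_def p0_def p1_def p2_def power2_eq_square)
  have u: "u_seq n = real_of_int R / real_of_int P" unfolding PR by (simp add: u_seq_def p0_def p1_def p2_def)
  have P0: "real_of_int P > 0" using c by simp
  show "0 < u_seq n" "u_seq n \<le> 1" unfolding u using c by (auto simp: divide_le_eq)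
  show "0 \<le> real_of_int V / 2 ^ 23" using c by simp
  have "real_of_int V < real_of_int (2 ^ 23)" using c(2) by (simp only: of_int_less_iff)
  thus "real_of_int V / 2 ^ 23 < 1" by simp
  have "real_of_int ((P - R) * (2 ^ 23 - V)\<^sup>2) < real_of_int ((V * V) * P)" using c(5) by (simp only: of_int_less_iff)
  hence "(real_of_int P - real_of_int R) * (2 ^ 23 - real_of_int V)\<^sup>2 < (real_of_int V)\<^sup>2 * real_of_int P"
    by (simp add: power2_eq_square)
  hence "(real_of_int P - real_of_int R) * (1 - v)\<^sup>2 < v\<^sup>2 * real_of_int P"
    by (simp add: v_def power2_eq_square field_simps)
  hence "(real_of_int P - real_of_int R) / real_of_int P * (1 - v)\<^sup>2 < v\<^sup>2"
    using P0 by (simp add: divide_less_eq)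
  thus "(1 - u_seq n) * (1 - real_of_int V / 2 ^ 23)\<^sup>2 < (real_of_int V / 2 ^ 23)\<^sup>2"
    using P0 by (simp add: u v_def diff_divide_distrib)
qed

text \<open>The alternating sum of \<open>overpart (n - j\<^sup>2)\<close> over
  \<open>j \<ge> k\<close>, starting with a positive sign. The signs arise from nested subtraction,
  so that unfolding needs only comparisons and subtractions of integers.\<close>

function overpart_alt :: "int \<Rightarrow> int \<Rightarrow> int" where
  "overpart_alt n k = (if k * k \<le> n then overpart_int (n - k * k) - overpart_alt n (k + 1) else 0)"
  by auto
termination
proof (relation "Wellfounded.measure (\<lambda>(n, k). nat (n + 1 - k))")
  fix n k :: int
  assume "k * k \<le> n"
  moreover have "k \<le> k * k" by (cases "k \<le> 0") (auto intro: order.trans)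
  ultimately show "((n, k + 1), (n, k)) \<in> Wellfounded.measure (\<lambda>(n, k). nat (n + 1 - k))" by auto
qed auto
declare overpart_alt.simps [simp del]

lemma overpart_alt_eq:
  assumes "k \<ge> 1"
  shows "overpart_alt (int n) (int k) = (\<Sum>j=k..n. (-1) ^ (j - k) * (if j\<^sup>2 \<le> n then int (overpart (n - j\<^sup>2)) else 0))"
  using assms
proof (induction "n + 1 - k" arbitrary: k rule: less_induct)
  case less
  have sq: "int k * int k \<le> int n \<longleftrightarrow> k\<^sup>2 \<le> n" by (simp add: power2_eq_square flip: of_nat_mult)
  show ?case
  proof (cases "k\<^sup>2 \<le> n")
    case False
    have "(if j\<^sup>2 \<le> n then int (overpart (n - j\<^sup>2)) else 0) = 0" if "j \<in> {k..n}" for j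
    proof -
      have "k\<^sup>2 \<le> j\<^sup>2" using that by (intro power_mono) auto
      hence "\<not> j\<^sup>2 \<le> n" using False by linarith
      thus ?thesis by simp
    qed
    thus ?thesis using False sq by (subst overpart_alt.simps) (simp add: sum.neutral)
  next
    case True
    have kn: "k \<le> n" using True less.prems order.trans[of k "k\<^sup>2" n] by (simp add: power2_eq_square)
    have "overpart_alt (int n) (int k) = overpart_int (int n - int k * int k) - overpart_alt (int n) (int (k + 1))"
      using True sq by (subst overpart_alt.simps) (simp add: add.commute)
    also have "int n - int k * int k = int (n - k\<^sup>2)" using True by (simp add: of_nat_diff power2_eq_square)
    also have "overpart_alt (int n) (int (k + 1)) = (\<Sum>j=k+1..n. (-1) ^ (j - (k + 1)) * (if j\<^sup>2 \<le> n then int (overpart (n - j\<^sup>2)) else 0))"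
      by (rule less.hyps) (use kn in auto)
    also have "\<dots> = - (\<Sum>j=k+1..n. (-1) ^ (j - k) * (if j\<^sup>2 \<le> n then int (overpart (n - j\<^sup>2)) else 0))"
      unfolding sum_negf [symmetric]
    proof (rule sum.cong)
      fix j assume "j \<in> {k+1..n}"
      hence "j - k = Suc (j - (k + 1))" by auto
      thus "(-1) ^ (j - (k + 1)) * (if j\<^sup>2 \<le> n then int (overpart (n - j\<^sup>2)) else 0) =
          - ((-1) ^ (j - k) * (if j\<^sup>2 \<le> n then int (overpart (n - j\<^sup>2)) else 0))" by simp
    qed simp
    also have "overpart_int (int (n - k\<^sup>2)) = int (overpart (n - k\<^sup>2))"
      by (simp only: overpart_int_def nat_int)
    finally show ?thesis using True kn by (simp add: sum.atLeast_Suc_atMost[of k n])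
  qed
qed

lemma overpart_int_recurrence:
  assumes "n \<ge> 1"
  shows "overpart_int n = 2 * overpart_alt n 1"
proof -
  define m where "m = nat n"
  have m: "n = int m" "m \<ge> 1" using assms by (auto simp: m_def)
  have "overpart_alt (int m) 1 = (\<Sum>j=1..m. (-1) ^ (j - 1) * (if j\<^sup>2 \<le> m then int (overpart (m - j\<^sup>2)) else 0))"
    using overpart_alt_eq[of 1 m] by simp
  also have "\<dots> = (\<Sum>j=1..m. - (if j\<^sup>2 \<le> m then (-1) ^ j * int (overpart (m - j\<^sup>2)) else 0))"
  proof (rule sum.cong)
    fix j assume "j \<in> {1..m}"
    then obtain i where "j = Suc i" by (cases j) auto
    thus "(-1) ^ (j - 1) * (if j\<^sup>2 \<le> m then int (overpart (m - j\<^sup>2)) else 0) =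
        - (if j\<^sup>2 \<le> m then (-1) ^ j * int (overpart (m - j\<^sup>2)) else 0)" by simp
  qed simp
  finally show ?thesis
    using overpart_recurrence[of m m] m by (simp add: overpart_int_def sum_negf)
qed

text \<open>The following two constants steer the simplifier through the computation below: the argument of
  \<open>eval_then\<close> is evaluated to a numeral before it is passed on, and \<open>assuming\<close> makes an equation available
  as a rewrite rule without evaluating the equation itself. All earlier values of \<open>overpart_int\<close> are thus
  remembered.\<close>
definition eval_then :: "int \<Rightarrow> (int \<Rightarrow> bool) \<Rightarrow> bool" where
  "eval_then x f = f x"

definition assuming :: "bool \<Rightarrow> bool \<Rightarrow> bool" where
  "assuming P R = (P \<longrightarrow> R)"

lemma eval_then_cong: "x = x' \<Longrightarrow> eval_then x f = eval_then x' f"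
  by simp

lemma assuming_cong: "(P \<Longrightarrow> R = R') \<Longrightarrow> assuming P R = assuming P R'"
  by (auto simp: assuming_def)

lemma eval_then_numeral: "eval_then (numeral k) f = f (numeral k)"
  by (simp add: eval_then_def)

lemma assuming_True: "assuming P True = True"
  by (simp add: assuming_def)

text \<open>The entry for \<open>n\<close>, where \<open>92 \<le> n \<le> 499\<close>, consists of approximations of \<open>2 ^ 40 / mu (n + 1)\<close> and of
  \<open>2 ^ 23 * v\<close>, where \<open>v\<close> is the witness for \<open>less_Q_I\<close>.\<close>
definition certificate :: "(int \<times> int) list" where
  "certificate = [
    (36291797553,227171), (36098239919,225487), (35907746558,223830), (35720237461,222202),
    (35535635515,220603), (35353866367,219029), (35174858298,217482), (34998542109,215961),
    (34824851001,214464), (34653720477,212991), (34485088233,211543), (34318894069,210117),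
    (34155079797,208713), (33993589153,207332), (33834367720,205972), (33677362846,204632),
    (33522523576,203314), (33369800579,202015), (33219146082,200735), (33070513810,199474),
    (32923858924,198232), (32779137965,197008), (32636308798,195801), (32495330563,194612),
    (32356163625,193440), (32218769528,192284), (32083110949,191144), (31949151654,190020),
    (31816856462,188912), (31686191202,187819), (31557122677,186740), (31429618629,185676),
    (31303647707,184626), (31179179430,183590), (31056184160,182568), (30934633071,181559),
    (30814498119,180563), (30695752020,179580), (30578368217,178609), (30462320860,177651),
    (30347584781,176705), (30234135469,175770), (30121949050,174847), (30011002268,173936),
    (29901272459,173035), (29792737537,172145), (29685375971,171266), (29579166772,170398),
    (29474089471,169540), (29370124105,168692), (29267251200,167854), (29165451757,167025),
    (29064707236,166207), (28964999541,165397), (28866311011,164597), (28768624399,163806),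
    (28671922867,163024), (28576189969,162250), (28481409642,161485), (28387566192,160729),
    (28294644285,159981), (28202628938,159241), (28111505505,158509), (28021259668,157785),
    (27931877432,157068), (27843345110,156360), (27755649317,155659), (27668776962,154965),
    (27582715239,154278), (27497451618,153598), (27412973841,152926), (27329269908,152260),
    (27246328078,151601), (27164136856,150949), (27082684988,150304), (27001961455,149665),
    (26921955468,149032), (26842656458,148406), (26764054074,147785), (26686138176,147171),
    (26608898830,146563), (26532326300,145960), (26456411048,145364), (26381143723,144773),
    (26306515162,144188), (26232516379,143608), (26159138567,143033), (26086373089,142465),
    (26014211476,141901), (25942645422,141343), (25871666779,140790), (25801267555,140241),
    (25731439910,139698), (25662176151,139160), (25593468728,138627), (25525310235,138098),
    (25457693401,137574), (25390611088,137055), (25324056292,136541), (25258022134,136030),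
    (25192501863,135525), (25127488846,135023), (25062976573,134527), (24998958649,134034),
    (24935428791,133546), (24872380830,133061), (24809808703,132581), (24747706456,132106),
    (24686068237,131633), (24624888296,131166), (24564160983,130701), (24503880742,130241),
    (24444042116,129784), (24384639739,129331), (24325668335,128883), (24267122719,128437),
    (24208997790,127995), (24151288536,127557), (24093990025,127122), (24037097407,126691),
    (23980605913,126263), (23924510851,125839), (23868807607,125417), (23813491641,125000),
    (23758558484,124585), (23704003743,124174), (23649823092,123766), (23596012276,123361),
    (23542567106,122959), (23489483459,122560), (23436757280,122164), (23384384572,121771),
    (23332361405,121382), (23280683908,120995), (23229348269,120610), (23178350736,120229),
    (23127687614,119851), (23077355263,119475), (23027350101,119103), (22977668597,118733),
    (22928307276,118365), (22879262712,118000), (22830531533,117638), (22782110415,117279),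
    (22733996084,116922), (22686185313,116568), (22638674925,116216), (22591461788,115866),
    (22544542813,115520), (22497914960,115175), (22451575230,114832), (22405520669,114493),
    (22359748362,114156), (22314255439,113821), (22269039070,113488), (22224096463,113158),
    (22179424867,112829), (22135021569,112504), (22090883895,112180), (22047009207,111858),
    (22003394902,111539), (21960038417,111222), (21916937221,110906), (21874088817,110593),
    (21831490746,110283), (21789140579,109973), (21747035920,109666), (21705174407,109362),
    (21663553708,109059), (21622171524,108758), (21581025584,108459), (21540113651,108162),
    (21499433513,107866), (21458982991,107574), (21418759932,107282), (21378762213,106992),
    (21338987737,106705), (21299434436,106419), (21260100267,106135), (21220983214,105852),
    (21182081287,105571), (21143392522,105293), (21104914978,105016), (21066646742,104740),
    (21028585922,104467), (20990730651,104195), (20953079086,103924), (20915629406,103656),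
    (20878379814,103388), (20841328534,103123), (20804473813,102859), (20767813919,102596),
    (20731347141,102336), (20695071790,102077), (20658986197,101819), (20623088713,101563),
    (20587377710,101308), (20551851579,101055), (20516508730,100804), (20481347592,100553),
    (20446366615,100305), (20411564263,100057), (20376939023,99811), (20342489398,99567), (20308213907,99324),
    (20274111088,99082), (20240179498,98842), (20206417707,98603), (20172824305,98366), (20139397895,98129),
    (20106137100,97895), (20073040555,97661), (20040106914,97429), (20007334845,97198), (19974723031,96968),
    (19942270169,96740), (19909974974,96512), (19877836171,96287), (19845852504,96062), (19814022729,95838),
    (19782345614,95616), (19750819943,95395), (19719444514,95176), (19688218138,94957), (19657139637,94739),
    (19626207848,94523), (19595421620,94308), (19564779817,94094), (19534281310,93881), (19503924989,93670),
    (19473709750,93459), (19443634504,93250), (19413698175,93041), (19383899695,92834), (19354238010,92627),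
    (19324712077,92423), (19295320863,92218), (19266063346,92015), (19236938517,91813), (19207945376,91612),
    (19179082932,91412), (19150350208,91213), (19121746233,91016), (19093270050,90819), (19064920710,90623),
    (19036697274,90428), (19008598812,90234), (18980624406,90041), (18952773145,89849), (18925044127,89658),
    (18897436463,89468), (18869949268,89279), (18842581669,89091), (18815332802,88904), (18788201811,88718),
    (18761187847,88532), (18734290073,88348), (18707507658,88164), (18680839779,87981), (18654285622,87800),
    (18627844382,87619), (18601515260,87439), (18575297466,87259), (18549190219,87081), (18523192742,86904),
    (18497304270,86727), (18471524043,86551), (18445851308,86377), (18420285320,86202), (18394825342,86029),
    (18369470643,85856), (18344220499,85685), (18319074195,85514), (18294031020,85344), (18269090270,85174),
    (18244251251,85006), (18219513272,84838), (18194875650,84671), (18170337708,84505), (18145898776,84340),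
    (18121558190,84175), (18097315292,84011), (18073169430,83848), (18049119959,83686), (18025166239,83524),
    (18001307637,83363), (17977543524,83203), (17953873278,83044), (17930296284,82885), (17906811931,82727),
    (17883419613,82569), (17860118730,82413), (17836908690,82257), (17813788902,82101), (17790758784,81947),
    (17767817757,81793), (17744965249,81640), (17722200691,81487), (17699523522,81335), (17676933183,81184),
    (17654429121,81033), (17632010789,80884), (17609677645,80734), (17587429149,80586), (17565264768,80438),
    (17543183974,80290), (17521186242,80144), (17499271054,79998), (17477437894,79852), (17455686251,79708),
    (17434015621,79563), (17412425500,79420), (17390915392,79276), (17369484805,79134), (17348133248,78993),
    (17326860238,78851), (17305665294,78711), (17284547940,78571), (17263507703,78431), (17242544116,78293),
    (17221656714,78154), (17200845036,78017), (17180108627,77879), (17159447034,77743), (17138859808,77607),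
    (17118346503,77471), (17097906679,77336), (17077539898,77202), (17057245726,77068), (17037023732,76935),
    (17016873490,76802), (16996794576,76670), (16976786571,76539), (16956849058,76407), (16936981624,76277),
    (16917183859,76147), (16897455358,76017), (16877795718,75888), (16858204538,75760), (16838681422,75631),
    (16819225978,75504), (16799837815,75377), (16780516546,75251), (16761261787,75125), (16742073159,74999),
    (16722950282,74874), (16703892782,74750), (16684900289,74626), (16665972432,74502), (16647108847,74379),
    (16628309169,74256), (16609573040,74134), (16590900103,74013), (16572290001,73891), (16553742385,73770),
    (16535256905,73650), (16516833214,73530), (16498470971,73411), (16480169832,73292), (16461929462,73174),
    (16443749523,73056), (16425629683,72938), (16407569612,72821), (16389568982,72704), (16371627467,72588),
    (16353744745,72472), (16335920494,72357), (16318154398,72242), (16300446141,72128), (16282795409,72013),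
    (16265201892,71900), (16247665281,71787), (16230185270,71674), (16212761556,71561), (16195393836,71450),
    (16178081812,71338), (16160825187,71227), (16143623665,71116), (16126476954,71005), (16109384764,70895),
    (16092346806,70786), (16075362794,70677), (16058432444,70568), (16041555474,70460), (16024731604,70352),
    (16007960557,70244), (15991242055,70137), (15974575827,70030), (15957961599,69924), (15941399102,69817),
    (15924888068,69712), (15908428231,69607), (15892019327,69502), (15875661093,69397), (15859353271,69293),
    (15843095600,69189), (15826887826,69085), (15810729692,68982), (15794620946,68880), (15778561338,68777),
    (15762550617,68675), (15746588536,68574), (15730674850,68472), (15714809314,68371), (15698991686,68271),
    (15683221726,68171), (15667499194,68070), (15651823853,67971)]"

text \<open>In a call with \<open>n\<close>, \<open>r0\<close> and \<open>r1\<close> belong to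
  \<open>n - 2\<close> and \<open>n - 1\<close>. The entry at the head settles the inequality for
  \<open>n - 1\<close>, because that is the first moment at which \<open>overpart n\<close> is
  known. The final test ensures that the list reaches 499.\<close>

fun check_run :: "int \<Rightarrow> int \<Rightarrow> int \<Rightarrow> (int \<times> int) list \<Rightarrow> bool" where
  "check_run n r0 r1 [] \<longleftrightarrow> 500 < n"
| "check_run n r0 r1 ((r2, V) # cs) \<longleftrightarrow>
     eval_then (2 * overpart_alt n 1) (\<lambda>p. assuming (overpart_int n = p)
       (eval_then (overpart_int (n - 1) * overpart_int (n - 1)) (\<lambda>P.
        eval_then (overpart_int (n - 2) * p) (\<lambda>R.
          inv_mu_approx n r2 \<and> check_numeric (n - 1) r0 r1 r2 V \<and> check_overpart V P R \<and>
          check_run (n + 1) r1 r2 cs))))"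

text \<open>As a congruence rule it has no premise for \<open>cs\<close>, so the simplifier does not
  traverse the remaining certificate at every step.\<close>

lemma check_run_cong:
  "n = n' \<Longrightarrow> r0 = r0' \<Longrightarrow> r1 = r1' \<Longrightarrow> check_run n r0 r1 cs = check_run n' r0' r1' cs"
  by simp

text \<open>Collects the values of \<open>overpart_int\<close> up to 92 before the run begins; the
  two constants approximate \<open>2 ^ 40 / mu 91\<close> and \<open>2 ^ 40 / mu 92\<close>.\<close>

function check_start :: "int \<Rightarrow> bool" where
  "check_start n = eval_then (2 * overpart_alt n 1) (\<lambda>p. assuming (overpart_int n = p)
     (if n \<ge> 92 then check_run 93 36688441000 36488502503 certificate else check_start (n + 1)))"
  by auto
termination by (relation "Wellfounded.measure (\<lambda>n. nat (92 - n))") auto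
declare check_start.simps [simp del]

text \<open>Base case of the bitwise evaluation, in which the shift is counted down to the constant
  \<open>1\<close>.\<close>

lemma drop_bit_one:
  "drop_bit 1 (numeral (num.Bit0 m)) = (numeral m :: int)" "drop_bit 1 (numeral (num.Bit1 m)) = (numeral m :: int)"
  by (simp_all add: drop_bit_eq_div)

text \<open>The whole computation, in a single call of the simplifier. The premise seeds the
  recurrence; each later value becomes an assumption through \<open>assuming\<close> and is found by
  rewriting. The recursive equations do not loop because \<open>if_weak_cong\<close> leaves a branch
  untouched until its guard has been decided.\<close>

lemma check_start_1: "assuming (overpart_int 0 = 1) (check_start 1)"
  by (simp only: check_start.simps[unfolded certificate_def] check_run.simps overpart_alt.simps
    eval_then_numeral assuming_True inv_mu_approx_def fifth_low_def fifth_up_def num_up_def den_low_def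
    exp_arg_low_def check_numeric_def check_overpart_def arith_simps arith_special numeral_One rel_simps
    le_numeral_extra less_numeral_extra mult_1_left mult_1_right add_0_left add_0_right diff_self
    power_numeral pow.simps sqr.simps drop_bit_numeral_bit0 drop_bit_numeral_bit1 drop_bit_one
    pred_numeral_simps BitM.simps if_True if_False simp_thms order.refl
    cong: if_weak_cong eval_then_cong assuming_cong check_run_cong)

lemma check_start_sound:
  "check_start n \<Longrightarrow> 1 \<le> n \<Longrightarrow> n \<le> 92 \<Longrightarrow> check_run 93 36688441000 36488502503 certificate"
proof (induction n rule: check_start.induct)
  case (1 n)
  have step: "if n \<ge> 92 then check_run 93 36688441000 36488502503 certificate else check_start (n + 1)"
    using "1.prems"(1) overpart_int_recurrence[OF "1.prems"(2)]
    unfolding check_start.simps[of n] eval_then_def assuming_def by (rule mp)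
  show ?case
  proof (cases "n \<ge> 92")
    case True
    thus ?thesis using step by (simp only: if_True)
  next
    case False
    hence "check_start (n + 1)" using step by (simp only: if_False)
    thus ?thesis using False "1.prems" by (intro "1.IH") auto
  qed
qed

text \<open>Induction along the certificate: the head entry serves \<open>m = n - 1\<close>, larger
  \<open>m\<close> are left to the tail. With an empty list the final test \<open>500 < n\<close>
  contradicts \<open>n - 1 \<le> m\<close> and \<open>m \<le> 499\<close>.\<close>

lemma check_run_sound:
  assumes "check_run n r0 r1 cs" "n \<ge> 93" "inv_mu_approx (n - 2) r0" "inv_mu_approx (n - 1) r1"
    and "n - 1 \<le> m" "m \<le> 499"
  shows "\<exists>r0 r1 r2 V. inv_mu_approx (m - 1) r0 \<and> inv_mu_approx m r1 \<and> inv_mu_approx (m + 1) r2 \<and>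
    check_numeric m r0 r1 r2 V \<and>
    check_overpart V (overpart_int m * overpart_int m) (overpart_int (m - 1) * overpart_int (m + 1))"
  using assms
proof (induction n r0 r1 cs rule: check_run.induct)
  case (1 n r0 r1)
  thus ?case by simp
next
  case (2 n r0 r1 r2 V cs)
  have n: "overpart_int n = 2 * overpart_alt n 1" using "2.prems"(2) by (intro overpart_int_recurrence) auto
  have s: "inv_mu_approx n r2" "check_numeric (n - 1) r0 r1 r2 V"
    "check_overpart V (overpart_int (n - 1) * overpart_int (n - 1)) (overpart_int (n - 2) * overpart_int n)"
    "check_run (n + 1) r1 r2 cs"
    using "2.prems"(1) n by (simp_all add: eval_then_def assuming_def)
  show ?case
  proof (cases "m = n - 1")
    case True
    have "inv_mu_approx (m - 1) r0 \<and> inv_mu_approx m r1 \<and> inv_mu_approx (m + 1) r2 \<and> check_numeric m r0 r1 r2 V \<and>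
      check_overpart V (overpart_int m * overpart_int m) (overpart_int (m - 1) * overpart_int (m + 1))"
      using "2.prems"(3,4) s unfolding True by simp
    thus ?thesis by blast
  next
    case False
    show ?thesis by (rule "2.IH"[OF s(4)]) (use "2.prems" s False in auto)
  qed
qed

theorem theorem3p3:
  fixes n :: nat
  assumes "n \<ge> 92"
  shows "f_fun n + 1000 / (mu (real n - 1))^5 < Q (u_seq n)"
proof (cases "n \<ge> 500")
  case True
  thus ?thesis by (rule f_fun_bound_large)
next
  case False
  have "overpart 0 = 1" using overpart_recurrence[of 0 0] by simp
  hence "check_start 1" using check_start_1 by (simp add: assuming_def overpart_int_def)
  hence run: "check_run 93 36688441000 36488502503 certificate" by (rule check_start_sound) auto
  have "inv_mu_approx 91 36688441000" "inv_mu_approx 92 36488502503" by (simp_all add: inv_mu_approx_def)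
  hence "\<exists>r0 r1 r2 V. inv_mu_approx (int n - 1) r0 \<and> inv_mu_approx (int n) r1 \<and> inv_mu_approx (int n + 1) r2 \<and>
    check_numeric (int n) r0 r1 r2 V \<and>
    check_overpart V (overpart_int (int n) * overpart_int (int n)) (overpart_int (int n - 1) * overpart_int (int n + 1))"
    using assms False by (intro check_run_sound[OF run]) auto
  thus ?thesis using less_Q_of_checks[OF assms] by blast
qed

end
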